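(* Let $Y=(Y_t)_{t\in T}$ be a Poissonian infinitely divisible process with Lévy measure $\nu$. Then $\nu$ is not $\sigma$-finite if and only if $T$ is uncountable and there is a version $\widetilde Y=(\widetilde Y_t)_{t\in T}$ of the process $Y$ such that for every nonempty countable $T_0\subset T$ there exist $t_1\in T\setminus T_0$ and independent random variables $\xi$ and $\eta$ such that (a) $\widetilde Y_{t_1}=\xi+\eta$; (b) $(\widetilde Y_t,\xi,\eta: t\in T_0)$ are jointly Poissonian infinitely divisible; (c) $\eta$ is non-degenerate and independent of $(\widetilde Y_t,\xi: t\in T_0)$.
   Context: $T$ is an arbitrary nonempty set, $\mathbb{R}^T$ the space of all functions $x:T\to\mathbb{R}$, $\mathcal{B}^T$ its cylindrical (product) $\sigma$-algebra, $0_T$ the zero function, $x_I$ the restriction of $x$ to $I$. A measure $\nu$ on $(\mathbb{R}^T,\mathcal{B}^T)$ is a Lévy measure if (L1) $\int_{\mathbb{R}^T}|x(t)|^2\wedge1\,\nu(dx)<\infty$ for every $t\in T$, and (L2) $\nu(A)=\nu_*(A\setminus\{0_T\})$ for every $A\in\mathcal{B}^T$, where $\nu_*(E)=\sup\{\nu(D):D\subset E,\ D\in\mathcal{B}^T\}$. A process (or family of random variables) is Poissonian infinitely divisible if all its finite-dimensional distributions are infinitely divisible without Gaussian part. Every Poissonian infinitely divisible process $Y=(Y_t)_{t\in T}$ has a unique Lévy measure $\nu$ on $(\mathbb{R}^T,\mathcal{B}^T)$, i.e. the unique Lévy measure such that for some $b\in\mathbb{R}^T$, all finite nonempty $I\subset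 T$ and $a\in\mathbb{R}^I$, $$\mathbb{E}e^{i\sum_{t\in I}a_tY_t}=\exp\Big\{\int_{\mathbb{R}^T}\Big(e^{i\sum_{t\in I}a_tx(t)}-1-i\sum_{t\in I}a_tx(t)\mathbf{1}_{\{|x(t)|\le1\}}\Big)\nu(dx)+i\sum_{t\in I}a_tb(t)\Big\}.$$ A version of $Y$ is a process with the same finite-dimensional distributions, possibly defined on another probability space. Non-degenerate means not almost surely constant. Countable includes finite. *)

theory Defs
  imports "HOL-Probability.Probability"
begin

abbreviation Rpow :: "'t set \<Rightarrow> ('t \<Rightarrow> real) measure" where
  "Rpow T \<equiv> PiM T (\<lambda>_. borel)"

text \<open>Elements of \<^term>\<open>space (Rpow T)\<close> are extensional functions, so the zero function on
  \<^term>\<open>T\<close> is \<^term>\<open>\<lambda>t\<in>T. 0 :: real\<close>.\<close>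

definition inner_measure :: "'a measure \<Rightarrow> 'a set \<Rightarrow> ennreal" where
  "inner_measure \<nu> E = Sup {emeasure \<nu> D | D. D \<in> sets \<nu> \<and> D \<subseteq> E}"

text \<open>For uncountable \<^term>\<open>T\<close> the singleton of the zero function is not measurable, hence the
  inner measure in the last clause. For countable \<^term>\<open>T\<close> that clause says that
  the zero function has mass 0.\<close>

definition levy_measure :: "'t set \<Rightarrow> ('t \<Rightarrow> real) measure \<Rightarrow> bool" where
  "levy_measure T \<nu> \<longleftrightarrow>
     sets \<nu> = sets (Rpow T) \<and>
     (\<forall>t\<in>T. (\<integral>\<^sup>+x. ennreal (min (\<bar>x t\<bar>\<^sup>2) 1) \<partial>\<nu>) < \<infinity>) \<and>
     (\<forall>A\<in>sets (Rpow T). emeasure \<nu> A = inner_measure \<nu> (A - {\<lambda>t\<in>T. 0}))"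

text \<open>The Gaussian-free Levy--Khintchine exponent at \<^term>\<open>a\<close>, for finite \<^term>\<open>I\<close>. The
  truncation is coordinatewise. If \<^term>\<open>levy_measure T \<nu>\<close> and \<^term>\<open>I \<subseteq> T\<close>, the integrand is
  integrable, so the Bochner integral is a genuine one.\<close>

definition levy_exponent ::
  "'t set \<Rightarrow> ('t \<Rightarrow> real) measure \<Rightarrow> ('t \<Rightarrow> real) \<Rightarrow> ('t \<Rightarrow> real) \<Rightarrow> complex" where
  "levy_exponent I \<nu> b a =
     (\<integral>x. exp (\<i> * of_real (\<Sum>t\<in>I. a t * x t)) - 1
          - \<i> * of_real (\<Sum>t\<in>I. a t * x t * indicat_real {-1..1} (x t)) \<partial>\<nu>)
     + \<i> * of_real (\<Sum>t\<in>I. a t * b t)"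

text \<open>\<^term>\<open>(S, \<nu>, b)\<close> is the Levy--Khintchine triplet of the law \<^term>\<open>\<mu>\<close> on
  \<^term>\<open>Rpow I\<close>, for finite \<^term>\<open>I\<close>; \<^term>\<open>S\<close> is the covariance matrix of the Gaussian part.
  Triplets are unique on \<^term>\<open>I\<close>.\<close>

definition levy_khintchine_triplet ::
  "'t set \<Rightarrow> ('t \<Rightarrow> real) measure \<Rightarrow> ('t \<Rightarrow> 't \<Rightarrow> real) \<Rightarrow> ('t \<Rightarrow> real) measure
     \<Rightarrow> ('t \<Rightarrow> real) \<Rightarrow> bool" where
  "levy_khintchine_triplet I \<mu> S \<nu> b \<longleftrightarrow>
     (\<forall>s\<in>I. \<forall>t\<in>I. S s t = S t s) \<and>
     (\<forall>a. 0 \<le> (\<Sum>s\<in>I. \<Sum>t\<in>I. a s * S s t * a t)) \<and>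
     levy_measure I \<nu> \<and>
     (\<forall>a. (\<integral>x. exp (\<i> * of_real (\<Sum>t\<in>I. a t * x t)) \<partial>\<mu>) =
          exp (of_real (- (\<Sum>s\<in>I. \<Sum>t\<in>I. a s * S s t * a t) / 2) + levy_exponent I \<nu> b a))"

definition infinitely_divisible :: "'t set \<Rightarrow> ('t \<Rightarrow> real) measure \<Rightarrow> bool" where
  "infinitely_divisible I \<mu> \<longleftrightarrow>
     prob_space \<mu> \<and> sets \<mu> = sets (Rpow I) \<and>
     (\<forall>n\<ge>1. \<exists>\<rho>. prob_space \<rho> \<and> sets \<rho> = sets (Rpow I) \<and>
        \<mu> = distr (PiM {..<n::nat} (\<lambda>_. \<rho>)) (Rpow I) (\<lambda>z. \<lambda>t\<in>I. \<Sum>k<n. z k t))"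

definition no_gaussian_part :: "'t set \<Rightarrow> ('t \<Rightarrow> real) measure \<Rightarrow> bool" where
  "no_gaussian_part I \<mu> \<longleftrightarrow> (\<exists>\<nu> b. levy_khintchine_triplet I \<mu> (\<lambda>_ _. 0) \<nu> b)"

definition real_process :: "'w measure \<Rightarrow> 't set \<Rightarrow> ('t \<Rightarrow> 'w \<Rightarrow> real) \<Rightarrow> bool" where
  "real_process M T Y \<longleftrightarrow> prob_space M \<and> (\<forall>t\<in>T. Y t \<in> borel_measurable M)"

definition fdd :: "'w measure \<Rightarrow> ('t \<Rightarrow> 'w \<Rightarrow> real) \<Rightarrow> 't set \<Rightarrow> ('t \<Rightarrow> real) measure" where
  "fdd M Y I = distr M (Rpow I) (\<lambda>\<omega>. \<lambda>t\<in>I. Y t \<omega>)"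

definition poissonian_id :: "'w measure \<Rightarrow> 't set \<Rightarrow> ('t \<Rightarrow> 'w \<Rightarrow> real) \<Rightarrow> bool" where
  "poissonian_id M T Y \<longleftrightarrow>
     real_process M T Y \<and>
     (\<forall>I. finite I \<and> I \<noteq> {} \<and> I \<subseteq> T \<longrightarrow>
        infinitely_divisible I (fdd M Y I) \<and> no_gaussian_part I (fdd M Y I))"

definition has_levy_measure ::
  "'w measure \<Rightarrow> 't set \<Rightarrow> ('t \<Rightarrow> 'w \<Rightarrow> real) \<Rightarrow> ('t \<Rightarrow> real) measure \<Rightarrow> bool" where
  "has_levy_measure M T Y \<nu> \<longleftrightarrow>
     levy_measure T \<nu> \<and>
     (\<exists>b. \<forall>I a. finite I \<and> I \<noteq> {} \<and> I \<subseteq> T \<longrightarrow>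
        (\<integral>\<omega>. exp (\<i> * of_real (\<Sum>t\<in>I. a t * Y t \<omega>)) \<partial>M) = exp (levy_exponent I \<nu> b a))"

definition is_version ::
  "'t set \<Rightarrow> 'w measure \<Rightarrow> ('t \<Rightarrow> 'w \<Rightarrow> real) \<Rightarrow> 'v measure \<Rightarrow> ('t \<Rightarrow> 'v \<Rightarrow> real) \<Rightarrow> bool" where
  "is_version T M Y N Z \<longleftrightarrow>
     real_process N T Z \<and>
     (\<forall>I. finite I \<and> I \<noteq> {} \<and> I \<subseteq> T \<longrightarrow> fdd N Z I = fdd M Y I)"

definition nondegenerate :: "'w measure \<Rightarrow> ('w \<Rightarrow> real) \<Rightarrow> bool" where
  "nondegenerate M X \<longleftrightarrow> \<not> (\<exists>c. AE \<omega> in M. X \<omega> = c)"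

text \<open>The family consisting of \<^term>\<open>Z t\<close> at index \<^term>\<open>Inl t\<close>, of \<^term>\<open>\<xi>\<close> at
  \<^term>\<open>Inr True\<close> and of \<^term>\<open>\<eta>\<close> at \<^term>\<open>Inr False\<close>.\<close>

definition adjoin2 ::
  "('t \<Rightarrow> 'w \<Rightarrow> real) \<Rightarrow> ('w \<Rightarrow> real) \<Rightarrow> ('w \<Rightarrow> real) \<Rightarrow> 't + bool \<Rightarrow> 'w \<Rightarrow> real" where
  "adjoin2 Z \<xi> \<eta> = case_sum Z (\<lambda>c. if c then \<xi> else \<eta>)"

text \<open>The library's \<^term>\<open>prob_space.indep_var\<close> requires both variables to have values
  in the same type.\<close>

definition independent_of ::
  "'w measure \<Rightarrow> ('w \<Rightarrow> 'a) \<Rightarrow> 'a measure \<Rightarrow> ('w \<Rightarrow> 'b) \<Rightarrow> 'b measure \<Rightarrow> bool" where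
  "independent_of N X A W B \<longleftrightarrow>
     X \<in> measurable N A \<and> W \<in> measurable N B \<and>
     prob_space.indep_set N {X -` E \<inter> space N | E. E \<in> sets A} {W -` E \<inter> space N | E. E \<in> sets B}"

definition splits_off_independent_summand ::
  "'w measure \<Rightarrow> 't set \<Rightarrow> ('t \<Rightarrow> 'w \<Rightarrow> real) \<Rightarrow> bool" where
  "splits_off_independent_summand N T Z \<longleftrightarrow>
     (\<forall>T0. T0 \<noteq> {} \<and> countable T0 \<and> T0 \<subseteq> T \<longrightarrow>
       (\<exists>t1\<in>T - T0. \<exists>\<xi> \<eta>.
          prob_space.indep_var N borel \<xi> borel \<eta> \<and>
          (AE \<omega> in N. Z t1 \<omega> = \<xi> \<omega> + \<eta> \<omega>) \<and>
          poissonian_id N (T0 <+> {True, False}) (adjoin2 Z \<xi> \<eta>) \<and>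
          nondegenerate N \<eta> \<and>
          independent_of N \<eta> borel
            (\<lambda>\<omega>. \<lambda>j\<in>T0 <+> {True}. adjoin2 Z \<xi> \<eta> j \<omega>) (Rpow (T0 <+> {True}))))"

text \<open>Types cannot be quantified existentially, so a sample space type has to be named for
  a version on some probability space. This one suffices: if a version with the above property
  exists on any probability space, choose one \<open>\<xi>\<close> for each countable nonempty \<open>T0\<close>;
  the joint law of the \<open>Z t\<close> and the chosen \<open>\<xi>\<close> lives on functions from \<^typ>\<open>'t + 't set\<close> to the
  reals, and its coordinate process, with \<open>\<eta> = Z t1 - \<xi>\<close>, again has the property.\<close>

type_synonym 't version_space = "'t + 't set \<Rightarrow> real"

end

theory Submission
  imports Defs "HOL-Real_Asymp.Real_Asymp"
begin

text \<open>
  Write \<open>x\<close> for a path and \<open>T0\<close> for a countable nonempty subset of \<open>T\<close>. Everything turns on the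
  sets \<open>{x. x = 0 on T0}\<close>. Off such a set \<open>\<nu>\<close> is \<open>\<sigma>\<close>-finite, because by (L1) each set
  \<open>{x. \<bar>x t\<bar> \<ge> 1/n}\<close> has finite mass. In the other direction, (L2) says that up to null sets a set of
  finite mass avoids the zero path in a measurable way, and a measurable set depends on countably many
  coordinates only; so \<open>\<nu>\<close> is \<open>\<sigma>\<close>-finite if and only if some \<open>{x. x = 0 on T0}\<close> is \<open>\<nu>\<close>-null
  (\<open>levy_measure_sigma_finite_iff\<close>).

  Suppose that \<open>\<nu>\<close> is not \<open>\<sigma>\<close>-finite. Then for each \<open>T0\<close> there is \<open>t1\<close> such that
  \<open>{x. x = 0 on T0, x t1 \<noteq> 0}\<close> has positive mass, and \<open>t1\<close> cannot lie in \<open>T0\<close>; in particular \<open>T\<close> is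
  uncountable. The jumps of \<open>Y t1\<close> along paths that vanish on \<open>T0\<close> make up \<open>\<eta>\<close>, the other jumps of
  \<open>Y t1\<close> make up \<open>\<xi>\<close>. The jumps of \<open>\<eta>\<close> never occur together with jumps of \<open>\<xi>\<close> or of \<open>Y t\<close>,
  \<open>t \<in> T0\<close>, which is independence for Poissonian vectors. To have \<open>\<xi>\<close> and \<open>\<eta>\<close> for all \<open>T0\<close> on one
  probability space, the index set \<open>T\<close> is enlarged by one index for every \<open>T0\<close>, which carries \<open>\<xi>\<close>, and
  the process with these jumps is taken from Kolmogorov's extension theorem
  (\<open>poissonian_process_exists\<close>). Its finite-dimensional laws are sums of independent compound
  Poisson vectors, centred at their small jumps (\<open>poissonian_law_exists\<close>). Their consistency, the
  version property and independence come down to the uniqueness theorem for characteristic functions on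
  finite powers of the real line (\<open>characteristic_function_unique\<close>).

  Suppose conversely that a version \<open>Z\<close> has the splitting property while \<open>{x. x = 0 on T0}\<close> is
  \<open>\<nu>\<close>-null. For finite \<open>I \<subseteq> T0\<close>, with \<open>Z I\<close> for the vector of the \<open>Z t\<close>, \<open>t \<in> I\<close>, the absolute value of
  the characteristic function of \<open>(Z I, Z t1)\<close> is the product of those of \<open>(Z I, \<xi>)\<close> and of \<open>\<eta>\<close>.
  Absolute values of Poissonian characteristic functions are exponentials of \<open>- \<integral> (1 - cos)\<close>. Taking logarithms, then a second difference in the frequency \<open>c\<close>
  of \<open>Z t1\<close>, and averaging over Gaussian frequencies of \<open>Z I\<close> with variance tending to infinity, one
  bounds \<open>- ln \<bar>E exp (i c \<eta>)\<bar>\<close> by the integral of \<open>1 - cos (c * x t1)\<close> over the paths that vanish on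
  \<open>I\<close>, and as \<open>I\<close> grows to \<open>T0\<close> by the integral over a null set. So \<open>\<eta>\<close> is degenerate, a contradiction
  (\<open>splitting_imp_not_sigma_finite\<close>).
\<close>

section \<open>Characteristic exponents of jump families\<close>

text \<open>Condition (L1) for functions \<open>f j\<close> on any measure space. Reading \<open>f j x\<close> as the jump of the
  \<open>j\<close>-th component, a vector whose log-characteristic function is \<open>lk_exponent \<nu> f J b\<close> has as Levy
  measure the image of \<open>\<nu>\<close> under \<open>f\<close> with the mass at zero removed. Keeping \<open>\<nu>\<close> and varying \<open>f\<close> lets
  one measure drive \<open>Y\<close>, \<open>\<xi>\<close> and \<open>\<eta>\<close> together and makes simultaneous jumps visible.\<close>

definition levy_family :: "'x measure \<Rightarrow> ('j \<Rightarrow> 'x \<Rightarrow> real) \<Rightarrow> 'j set \<Rightarrow> bool" where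
  "levy_family \<nu> f J \<longleftrightarrow>
     (\<forall>j\<in>J. f j \<in> borel_measurable \<nu> \<and> (\<integral>\<^sup>+x. ennreal (min (\<bar>f j x\<bar>\<^sup>2) 1) \<partial>\<nu>) < \<infinity>)"

definition lk_integrand :: "('j \<Rightarrow> 'x \<Rightarrow> real) \<Rightarrow> 'j set \<Rightarrow> ('j \<Rightarrow> real) \<Rightarrow> 'x \<Rightarrow> complex" where
  "lk_integrand f J a x =
     exp (\<i> * of_real (\<Sum>j\<in>J. a j * f j x)) - 1
       - \<i> * of_real (\<Sum>j\<in>J. a j * f j x * indicat_real {-1..1} (f j x))"

definition lk_exponent ::
  "'x measure \<Rightarrow> ('j \<Rightarrow> 'x \<Rightarrow> real) \<Rightarrow> 'j set \<Rightarrow> ('j \<Rightarrow> real) \<Rightarrow> ('j \<Rightarrow> real) \<Rightarrow> complex" where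
  "lk_exponent \<nu> f J b a =
     (\<integral>x. lk_integrand f J a x \<partial>\<nu>) + \<i> * of_real (\<Sum>j\<in>J. a j * b j)"

lemma levy_exponent_eq_lk_exponent: "levy_exponent I \<nu> b a = lk_exponent \<nu> (\<lambda>t x. x t) I b a"
  by (simp add: levy_exponent_def lk_exponent_def lk_integrand_def)

lemma levy_family_subset: "levy_family \<nu> f J \<Longrightarrow> I \<subseteq> J \<Longrightarrow> levy_family \<nu> f I"
  by (auto simp: levy_family_def)

lemma levy_familyD:
  assumes "levy_family \<nu> f J" "j \<in> J"
  shows "f j \<in> borel_measurable \<nu>" "integrable \<nu> (\<lambda>x. min ((f j x)\<^sup>2) 1)"
proof -
  show m: "f j \<in> borel_measurable \<nu>" using assms by (auto simp: levy_family_def)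
  show "integrable \<nu> (\<lambda>x. min ((f j x)\<^sup>2) 1)"
  proof (rule integrableI_nonneg)
    show "(\<lambda>x. min ((f j x)\<^sup>2) 1) \<in> borel_measurable \<nu>" using m by measurable
    show "(\<integral>\<^sup>+x. ennreal (min ((f j x)\<^sup>2) 1) \<partial>\<nu>) < \<infinity>" using assms by (auto simp: levy_family_def)
  qed auto
qed

lemma measurable_lk_integrand:
  assumes "levy_family \<nu> f J"
  shows "lk_integrand f J a \<in> borel_measurable \<nu>"
proof -
  have [measurable]: "f j \<in> borel_measurable \<nu>" if "j \<in> J" for j using levy_familyD(1)[OF assms that] .
  have *: "lk_integrand f J a = (\<lambda>x. exp (\<i> * of_real (\<Sum>j\<in>J. a j * f j x)) - 1
       - \<i> * of_real (\<Sum>j\<in>J. a j * f j x * indicat_real {-1..1} (f j x)))"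
    by (simp add: lk_integrand_def fun_eq_iff)
  show ?thesis unfolding * by measurable
qed

text \<open>If all \<open>\<bar>f j x\<bar> \<le> 1\<close> the integrand is a second-order Taylor remainder at \<open>u = (\<Sum>j\<in>J. a j * f j x)\<close>,
  and \<open>u\<^sup>2\<close> is at most \<open>(\<Sum>j\<in>J. \<bar>a j\<bar>)\<^sup>2\<close> times the sum of the \<open>(f j x)\<^sup>2\<close>. Otherwise the sum of the
  \<open>min ((f j x)\<^sup>2) 1\<close> is at least 1, and the integrand has a bound that is independent of \<open>x\<close>.\<close>

lemma norm_lk_integrand_le:
  assumes "finite J"
  shows "cmod (lk_integrand f J a x) \<le>
    ((\<Sum>j\<in>J. \<bar>a j\<bar>)\<^sup>2 + 2 + (\<Sum>j\<in>J. \<bar>a j\<bar>)) * (\<Sum>j\<in>J. min ((f j x)\<^sup>2) 1)"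
    (is "_ \<le> (?A\<^sup>2 + 2 + ?A) * ?F")
proof -
  let ?u = "\<Sum>j\<in>J. a j * f j x" and ?v = "\<Sum>j\<in>J. a j * f j x * indicat_real {-1..1} (f j x)"
  have A: "0 \<le> ?A" and F: "0 \<le> ?F" by (auto intro!: sum_nonneg)
  have sq: "y\<^sup>2 \<le> 1 \<longleftrightarrow> \<bar>y\<bar> \<le> 1" for y :: real by (simp add: abs_square_le_1)
  show ?thesis
  proof (cases "\<forall>j\<in>J. \<bar>f j x\<bar> \<le> 1")
    case True
    then have uv: "?v = ?u" by (intro sum.cong) (auto simp: indicator_def abs_le_iff)
    have "\<bar>f j x\<bar> \<le> sqrt ?F" if "j \<in> J" for j
    proof (rule real_le_rsqrt)
      have "\<bar>f j x\<bar>\<^sup>2 = min ((f j x)\<^sup>2) 1" using True that by (auto simp: sq min_def)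
      also have "\<dots> \<le> ?F" using assms that by (intro member_le_sum) auto
      finally show "\<bar>f j x\<bar>\<^sup>2 \<le> ?F" .
    qed
    then have "\<bar>?u\<bar> \<le> ?A * sqrt ?F"
      unfolding sum_distrib_right
      by (intro order.trans[OF sum_abs] sum_mono) (auto simp: abs_mult intro!: mult_left_mono)
    then have "\<bar>?u\<bar>\<^sup>2 \<le> (?A * sqrt ?F)\<^sup>2" by (intro power_mono) auto
    then have u2: "?u\<^sup>2 \<le> ?A\<^sup>2 * ?F" using F by (simp add: power_mult_distrib)
    have "lk_integrand f J a x = exp (\<i> * of_real ?u) - (\<Sum>k\<le>1. (\<i> * of_real ?u) ^ k / fact k)"
      unfolding lk_integrand_def uv by simp
    then have "cmod (lk_integrand f J a x) \<le> \<bar>?u\<bar> ^ Suc 1 / fact (Suc 1)"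
      using iexp_approx1[of ?u 1] by (simp only:)
    also have "\<dots> \<le> ?u\<^sup>2" by (simp add: power2_eq_square)
    also have "\<dots> \<le> ?A\<^sup>2 * ?F" by (rule u2)
    also have "\<dots> \<le> (?A\<^sup>2 + 2 + ?A) * ?F" using A F by (intro mult_right_mono) auto
    finally show ?thesis .
  next
    case False
    then obtain j where j: "j \<in> J" "1 < \<bar>f j x\<bar>" by force
    have "1 = min ((f j x)\<^sup>2) 1" using j sq[of "f j x"] by (auto simp: min_def)
    also have "\<dots> \<le> ?F" using assms j by (intro member_le_sum) auto
    finally have F1: "1 \<le> ?F" .
    have "\<bar>?v\<bar> \<le> ?A"
      by (intro order.trans[OF sum_abs] sum_mono) (auto simp: abs_mult indicator_def abs_le_iff intro!: mult_left_le)
    moreover have "cmod (exp (\<i> * of_real ?u) - 1) \<le> 2"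
      using norm_triangle_ineq4[of "exp (\<i> * of_real ?u)" 1] by simp
    moreover have "cmod (lk_integrand f J a x) \<le> cmod (exp (\<i> * of_real ?u) - 1) + cmod (\<i> * of_real ?v)"
      unfolding lk_integrand_def by (rule norm_triangle_ineq4)
    ultimately have "cmod (lk_integrand f J a x) \<le> 2 + ?A" by (simp add: norm_mult del: of_real_sum)
    also have "\<dots> \<le> (2 + ?A) * ?F" using A mult_left_mono[OF F1, of "2 + ?A"] by simp
    also have "\<dots> \<le> (?A\<^sup>2 + 2 + ?A) * ?F" using A F by (intro mult_right_mono) auto
    finally show ?thesis .
  qed
qed

lemma integrable_lk_integrand:
  assumes "finite J" "levy_family \<nu> f J"
  shows "integrable \<nu> (lk_integrand f J a)"
proof (rule Bochner_Integration.integrable_bound)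
  show "integrable \<nu> (\<lambda>x. ((\<Sum>j\<in>J. \<bar>a j\<bar>)\<^sup>2 + 2 + (\<Sum>j\<in>J. \<bar>a j\<bar>)) * (\<Sum>j\<in>J. min ((f j x)\<^sup>2) 1))"
    using levy_familyD(2)[OF assms(2)] by auto
  show "AE x in \<nu>. cmod (lk_integrand f J a x) \<le>
     norm (((\<Sum>j\<in>J. \<bar>a j\<bar>)\<^sup>2 + 2 + (\<Sum>j\<in>J. \<bar>a j\<bar>)) * (\<Sum>j\<in>J. min ((f j x)\<^sup>2) 1))"
    using norm_lk_integrand_le[OF assms(1)] by (auto intro!: AE_I2 order.trans[OF _ abs_ge_self])
qed (rule measurable_lk_integrand[OF assms(2)])

lemma Re_lk_integrand: "Re (lk_integrand f J a x) = cos (\<Sum>j\<in>J. a j * f j x) - 1"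
  by (simp add: lk_integrand_def Re_exp)

lemma integrable_one_minus_cos:
  assumes "finite J" "levy_family \<nu> f J"
  shows "integrable \<nu> (\<lambda>x. 1 - cos (\<Sum>j\<in>J. a j * f j x))"
  using Bochner_Integration.integrable_minus[OF integrable_Re[OF integrable_lk_integrand[OF assms, of a]]]
  by (simp add: Re_lk_integrand)

text \<open>The truncation and the drift are purely imaginary and drop out of the absolute value. While a
  characteristic function determines its exponent only up to multiples of \<open>2 * pi * \<i>\<close>, it determines
  this real integral.\<close>

lemma norm_exp_lk_exponent:
  assumes "finite J" "levy_family \<nu> f J"
  shows "cmod (exp (lk_exponent \<nu> f J b a)) = exp (- (\<integral>x. 1 - cos (\<Sum>j\<in>J. a j * f j x) \<partial>\<nu>))"
proof -
  have "Re (\<integral>x. lk_integrand f J a x \<partial>\<nu>) = (\<integral>x. cos (\<Sum>j\<in>J. a j * f j x) - 1 \<partial>\<nu>)"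
    using integral_Re[OF integrable_lk_integrand[OF assms, of a]] by (simp add: Re_lk_integrand)
  also have "\<dots> = - (\<integral>x. 1 - cos (\<Sum>j\<in>J. a j * f j x) \<partial>\<nu>)"
    by (subst integral_minus[symmetric]) (intro Bochner_Integration.integral_cong, auto)
  finally show ?thesis by (simp add: lk_exponent_def)
qed

lemma lk_exponent_distr:
  assumes "finite J" "levy_family \<nu> f J"
  shows "lk_exponent (distr \<nu> (Rpow J) (\<lambda>x. \<lambda>j\<in>J. f j x)) (\<lambda>j y. y j) J b a = lk_exponent \<nu> f J b a"
proof -
  have m: "(\<lambda>x. \<lambda>j\<in>J. f j x) \<in> measurable \<nu> (Rpow J)"
    using levy_familyD(1)[OF assms(2)] by measurable
  have "lk_integrand (\<lambda>j y. y j) J a \<in> borel_measurable (Rpow J)"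
    unfolding lk_integrand_def[abs_def] by measurable
  moreover have "lk_integrand (\<lambda>j y. y j) J a (\<lambda>j\<in>J. f j x) = lk_integrand f J a x" for x
    by (simp add: lk_integrand_def)
  ultimately show ?thesis
    unfolding lk_exponent_def by (subst integral_distr[OF m]) auto
qed

lemma lk_exponent_density_const:
  assumes "finite J" "levy_family \<nu> f J" "0 \<le> r"
  shows "lk_exponent (density \<nu> (\<lambda>_. ennreal r)) f J (\<lambda>j. r * b j) a = of_real r * lk_exponent \<nu> f J b a"
  unfolding lk_exponent_def
  using measurable_lk_integrand[OF assms(2), of a] assms(3)
  by (subst integral_density) (auto simp: scaleR_conv_of_real ring_distribs sum_distrib_left mult.assoc mult.left_commute)

lemma levy_family_density_const:
  assumes "levy_family \<nu> f J" "0 \<le> r"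
  shows "levy_family (density \<nu> (\<lambda>_. ennreal r)) f J"
  using assms unfolding levy_family_def
  by (auto simp: nn_integral_density nn_integral_cmult ennreal_mult_less_top)

lemma levy_family_of_levy_measure:
  assumes "levy_measure T \<nu>"
  shows "levy_family \<nu> (\<lambda>t x. x t) T"
proof -
  have s: "sets \<nu> = sets (Rpow T)" using assms by (simp add: levy_measure_def)
  have "(\<lambda>x. x t) \<in> borel_measurable \<nu>" if "t \<in> T" for t
    using that by (simp cong: measurable_cong_sets[OF s refl])
  then show ?thesis using assms by (auto simp: levy_family_def levy_measure_def)
qed

section \<open>Uniqueness of characteristic functions on finite powers\<close>

text \<open>After division by its total mass the weight becomes a density, and the one-dimensional
  uniqueness theorem applies to the law of \<open>X\<close> under it. The weights stand for what has already been
  fixed about the other coordinates.\<close>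

lemma weighted_distribution_unique:
  fixes X w :: "'x \<Rightarrow> real"
  assumes "prob_space M1" "prob_space M2" and s: "sets M2 = sets M1"
    and X: "X \<in> borel_measurable M1" and w: "w \<in> borel_measurable M1"
    and w0: "\<And>x. 0 \<le> w x" and wC: "\<And>x. w x \<le> C"
    and cos: "\<And>c. (\<integral>x. w x * cos (c * X x) \<partial>M1) = (\<integral>x. w x * cos (c * X x) \<partial>M2)"
    and sin: "\<And>c. (\<integral>x. w x * sin (c * X x) \<partial>M1) = (\<integral>x. w x * sin (c * X x) \<partial>M2)"
    and B: "B \<in> sets borel"
  shows "(\<integral>x. w x * indicat_real B (X x) \<partial>M1) = (\<integral>x. w x * indicat_real B (X x) \<partial>M2)"
proof -
  define m where "m = (\<integral>x. w x \<partial>M1)"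
  have m2: "m = (\<integral>x. w x \<partial>M2)" using cos[of 0] by (simp add: m_def)
  have m0: "0 \<le> m" unfolding m_def using w0 by simp
  have key: "(\<integral>x. w x * indicat_real B (X x) \<partial>M) = m * measure (distr (density M (\<lambda>x. ennreal (w x / m))) borel X) B
      \<and> (0 < m \<longrightarrow> real_distribution (distr (density M (\<lambda>x. ennreal (w x / m))) borel X) \<and>
      (\<forall>t. char (distr (density M (\<lambda>x. ennreal (w x / m))) borel X) t =
        Complex ((\<integral>x. w x * cos (t * X x) \<partial>M) / m) ((\<integral>x. w x * sin (t * X x) \<partial>M) / m)))"
    if "prob_space M" and sM: "sets M = sets M1" and mM: "m = (\<integral>x. w x \<partial>M)" for M
  proof -
    interpret prob_space M by fact
    have [measurable]: "X \<in> borel_measurable M" "w \<in> borel_measurable M"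
      using X w by (simp_all cong: measurable_cong_sets[OF sM refl])
    have int: "integrable M (\<lambda>x. w x * g x)" if [measurable]: "g \<in> borel_measurable M" and "\<And>x. \<bar>g x\<bar> \<le> 1" for g :: "'x \<Rightarrow> real"
    proof (rule integrable_const_bound)
      have "\<bar>w x * g x\<bar> \<le> C * 1" for x
        unfolding abs_mult using w0[of x] wC[of x] that(2)[of x] by (intro mult_mono) auto
      then show "AE x in M. norm (w x * g x) \<le> C" by simp
    qed measurable
    have int1: "integrable M w" using int[of "\<lambda>_. 1"] by simp
    let ?D = "density M (\<lambda>x. ennreal (w x / m))"
    have meas: "measure (distr ?D borel X) B = (\<integral>x. (w x / m) * indicat_real B (X x) \<partial>M)"
    proof -
      have "measure (distr ?D borel X) B = measure ?D (X -` B \<inter> space M)"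
        using B by (subst measure_distr) auto
      also have "\<dots> = enn2real (\<integral>\<^sup>+x. ennreal (w x / m * indicat_real B (X x)) \<partial>M)"
      proof -
        have "emeasure ?D (X -` B \<inter> space M) = (\<integral>\<^sup>+x. ennreal (w x / m * indicat_real B (X x)) \<partial>M)"
          using B by (subst emeasure_density) (auto intro!: nn_integral_cong split: split_indicator)
        then show ?thesis by (simp add: measure_def)
      qed
      also have "\<dots> = (\<integral>x. w x / m * indicat_real B (X x) \<partial>M)"
        using B m0 w0 by (subst integral_eq_nn_integral) (auto intro!: AE_I2)
      finally show ?thesis .
    qed
    have 1: "(\<integral>x. w x * indicat_real B (X x) \<partial>M) = m * measure (distr ?D borel X) B"
    proof (cases "m = 0")
      case True
      then have "AE x in M. w x = 0"
        using integral_nonneg_eq_0_iff_AE[OF int1] w0 mM by auto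
      then have "(\<integral>x. w x * indicat_real B (X x) \<partial>M) = (\<integral>x. 0 \<partial>M)"
        using B by (intro integral_cong_AE) auto
      with True show ?thesis by simp
    next
      case False
      then show ?thesis unfolding meas by simp
    qed
    have 2: "real_distribution (distr ?D borel X)" if "0 < m"
    proof -
      have "emeasure ?D (space ?D) = (\<integral>\<^sup>+x. ennreal (w x / m) \<partial>M)"
        by (subst emeasure_density) (auto intro!: nn_integral_cong)
      also have "\<dots> = ennreal (\<integral>x. w x / m \<partial>M)"
        using int1 w0 m0 by (subst nn_integral_eq_integral) auto
      also have "\<dots> = 1" using mM that by simp
      finally have "prob_space ?D" by (rule prob_spaceI)
      then have "prob_space (distr ?D borel X)" by (rule prob_space.prob_space_distr) simp
      then show ?thesis by (simp add: real_distribution_def real_distribution_axioms_def)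
    qed
    have 3: "char (distr ?D borel X) t = 
        Complex ((\<integral>x. w x * cos (t * X x) \<partial>M) / m) ((\<integral>x. w x * sin (t * X x) \<partial>M) / m)" for t
    proof -
      have i: "integrable M (\<lambda>x. (w x / m) *\<^sub>R iexp (t * X x))"
        by (rule Bochner_Integration.integrable_bound[where f="\<lambda>x. w x / m"]) (use int1 in auto)
      have "char (distr ?D borel X) t = (\<integral>x. (w x / m) *\<^sub>R iexp (t * X x) \<partial>M)"
        unfolding char_def using w0 m0
        by (subst integral_distr) (auto simp: integral_density)
      moreover have "Re (\<integral>x. (w x / m) *\<^sub>R iexp (t * X x) \<partial>M) = (\<integral>x. w x * cos (t * X x) \<partial>M) / m"
        using integral_Re[OF i] by (simp add: Re_exp)
      moreover have "Im (\<integral>x. (w x / m) *\<^sub>R iexp (t * X x) \<partial>M) = (\<integral>x. w x * sin (t * X x) \<partial>M) / m"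
        using integral_Im[OF i] by (simp add: Im_exp)
      ultimately show ?thesis by (simp add: complex_eq_iff)
    qed
    show ?thesis using 1 2 3 by blast
  qed
  note k1 = key[OF assms(1) refl m_def] and k2 = key[OF assms(2) s m2]
  show ?thesis
  proof (cases "m = 0")
    case True then show ?thesis using k1 k2 by simp
  next
    case False
    then have "0 < m" using m0 by simp
    then have "distr (density M1 (\<lambda>x. ennreal (w x / m))) borel X = distr (density M2 (\<lambda>x. ennreal (w x / m))) borel X"
      using k1 k2 cos sin by (intro Levy_uniqueness) (auto simp: fun_eq_iff)
    then show ?thesis using k1 k2 by simp
  qed
qed

text \<open>Induction on the number of coordinates that are described by Borel sets instead of frequencies.
  The frequencies of the remaining coordinates would give a signed weight \<open>h x * cos (u x + \<theta>)\<close>; the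
  nonnegative weights \<open>h x * (1 + cos (u x + \<theta>))\<close> carry the same information, since the case \<open>u = 0\<close>,
  \<open>\<theta> = pi / 2\<close> returns the first summand on its own.\<close>

theorem characteristic_function_unique:
  fixes \<mu>1 \<mu>2 :: "('j \<Rightarrow> real) measure"
  assumes J: "finite J" and p1: "prob_space \<mu>1" and p2: "prob_space \<mu>2"
    and s1: "sets \<mu>1 = sets (Rpow J)" and s2: "sets \<mu>2 = sets (Rpow J)"
    and eq: "\<And>a. (\<integral>x. exp (\<i> * of_real (\<Sum>j\<in>J. a j * x j)) \<partial>\<mu>1)
               = (\<integral>x. exp (\<i> * of_real (\<Sum>j\<in>J. a j * x j)) \<partial>\<mu>2)"
  shows "\<mu>1 = \<mu>2"
proof -
  interpret p1: prob_space \<mu>1 by fact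
  interpret p2: prob_space \<mu>2 by fact
  have ms: "measurable \<mu>1 borel = measurable (Rpow J) borel" "measurable \<mu>2 borel = measurable (Rpow J) borel"
    using s1 s2 by (simp_all cong: measurable_cong_sets)
  have sp: "space \<mu>1 = space (Rpow J)" "space \<mu>2 = space (Rpow J)"
    using s1 s2 by (simp_all cong: sets_eq_imp_space_eq)
  have int: "integrable \<mu>1 g" "integrable \<mu>2 g" if "g \<in> borel_measurable (Rpow J)" "\<And>x. \<bar>g x\<bar> \<le> 1" for g :: "_ \<Rightarrow> real"
    using that by (auto intro!: p1.integrable_const_bound[of _ 1] p2.integrable_const_bound[of _ 1] simp: ms)
  \<comment> \<open>The phase \<open>\<theta>\<close> gives access to sines.\<close>
  define P where "P S \<longleftrightarrow> (\<forall>B a \<theta>. (\<forall>j. B j \<in> sets borel) \<longrightarrow>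
    (\<integral>x. (\<Prod>j\<in>S. indicat_real (B j) (x j)) * cos ((\<Sum>j\<in>J - S. a j * x j) + \<theta>) \<partial>\<mu>1) =
    (\<integral>x. (\<Prod>j\<in>S. indicat_real (B j) (x j)) * cos ((\<Sum>j\<in>J - S. a j * x j) + \<theta>) \<partial>\<mu>2))" for S
  have base: "P {}"
    unfolding P_def
  proof (intro allI impI, simp)
    fix a :: "'j \<Rightarrow> real" and \<theta>
    have "(\<integral>x. cos ((\<Sum>j\<in>J. a j * x j) + \<theta>) \<partial>\<mu>) = Re (iexp \<theta> * (\<integral>x. exp (\<i> * of_real (\<Sum>j\<in>J. a j * x j)) \<partial>\<mu>))"
      if "prob_space \<mu>" "sets \<mu> = sets (Rpow J)" for \<mu>
    proof -
      interpret prob_space \<mu> by fact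
      have m: "(\<lambda>x. exp (\<i> * of_real (\<Sum>j\<in>J. a j * x j))) \<in> borel_measurable \<mu>"
        by (subst measurable_cong_sets[OF that(2) refl]) measurable
      have i: "integrable \<mu> (\<lambda>x. iexp \<theta> * exp (\<i> * of_real (\<Sum>j\<in>J. a j * x j)))"
        using m by (intro integrable_const_bound[of _ 1]) (auto simp: norm_mult simp del: of_real_sum)
      have "Re (iexp \<theta> * (\<integral>x. exp (\<i> * of_real (\<Sum>j\<in>J. a j * x j)) \<partial>\<mu>))
          = Re (\<integral>x. iexp \<theta> * exp (\<i> * of_real (\<Sum>j\<in>J. a j * x j)) \<partial>\<mu>)"
        by simp
      also have "\<dots> = (\<integral>x. cos ((\<Sum>j\<in>J. a j * x j) + \<theta>) \<partial>\<mu>)"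
        unfolding integral_Re[OF i, symmetric]
        by (simp only: exp_add[symmetric] distrib_left[symmetric] of_real_add[symmetric] Re_exp)
           (simp add: add.commute)
      finally show ?thesis by simp
    qed
    then show "(\<integral>x. cos ((\<Sum>j\<in>J. a j * x j) + \<theta>) \<partial>\<mu>1) = (\<integral>x. cos ((\<Sum>j\<in>J. a j * x j) + \<theta>) \<partial>\<mu>2)"
      using p1 p2 s1 s2 eq by simp
  qed
  have "P S" if "S \<subseteq> J" "finite S" for S
    using that(2,1)
  proof (induction S rule: finite_induct)
    case empty show ?case by (rule base)
  next
    case (insert k S)
    then have IH: "P S" and k: "k \<in> J" "k \<notin> S" "S \<subseteq> J" and fS: "finite S" by auto
    let ?R = "J - insert k S"
    have R: "J - S = insert k ?R" "k \<notin> ?R" "finite ?R" using k J by auto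
    show ?case unfolding P_def
    proof (intro allI impI)
      fix B :: "'j \<Rightarrow> real set" and a :: "'j \<Rightarrow> real" and \<theta>0 assume B: "\<forall>j. B j \<in> sets borel"
      note [measurable] = B[rule_format]
      let ?h = "\<lambda>x. (\<Prod>j\<in>S. indicat_real (B j) (x j))"
      have kJ[measurable]: "(\<lambda>x. x k) \<in> borel_measurable (Rpow J)" using k by measurable
      have h: "0 \<le> ?h x" "?h x \<le> 1" for x by (auto intro!: prod_nonneg prod_le_1)
      have [measurable]: "?h \<in> borel_measurable (Rpow J)"
        using k(3) by (intro borel_measurable_prod) auto
      have [measurable]: "(\<lambda>x. \<Sum>j\<in>?R. a j * x j) \<in> borel_measurable (Rpow J)"
        by (intro borel_measurable_sum borel_measurable_times measurable_component_singleton) auto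
      have gen: "(\<integral>x. ?h x * cos (c * x k + (r * (\<Sum>j\<in>?R. a j * x j) + \<theta>)) \<partial>\<mu>1) =
          (\<integral>x. ?h x * cos (c * x k + (r * (\<Sum>j\<in>?R. a j * x j) + \<theta>)) \<partial>\<mu>2)" for c r \<theta>
      proof -
        have *: "(\<Sum>j\<in>J - S. ((\<lambda>j. r * a j)(k := c)) j * x j) + \<theta> = c * x k + (r * (\<Sum>j\<in>?R. a j * x j) + \<theta>)" for x :: "'j \<Rightarrow> real"
          using R(2,3) unfolding R(1)
          by (subst sum.insert) (auto simp: sum_distrib_left mult.assoc intro!: sum.cong)
        show ?thesis using IH[unfolded P_def, rule_format, of B "(\<lambda>j. r * a j)(k := c)" \<theta>] B
          unfolding * by auto
      qed
      have step: "(\<integral>x. ?h x * (1 + cos (r * (\<Sum>j\<in>?R. a j * x j) + \<theta>)) * indicat_real (B k) (x k) \<partial>\<mu>1) =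
         (\<integral>x. ?h x * (1 + cos (r * (\<Sum>j\<in>?R. a j * x j) + \<theta>)) * indicat_real (B k) (x k) \<partial>\<mu>2)" for r \<theta>
      proof (rule weighted_distribution_unique[where C=2])
        have c1: "\<bar>?h x * g\<bar> \<le> 1" if "\<bar>g\<bar> \<le> 1" for x and g :: real
          using h[of x] that mult_mono[of "?h x" 1 "\<bar>g\<bar>" 1] by (simp add: abs_mult)
        have expand: "(\<integral>x. ?h x * (1 + cos (r * (\<Sum>j\<in>?R. a j * x j) + \<theta>)) * cos (c * x k + \<theta>') \<partial>\<mu>1) =
           (\<integral>x. ?h x * (1 + cos (r * (\<Sum>j\<in>?R. a j * x j) + \<theta>)) * cos (c * x k + \<theta>') \<partial>\<mu>2)" for c \<theta>'
        proof -
          let ?u = "\<lambda>x::'j \<Rightarrow> real. r * (\<Sum>j\<in>?R. a j * x j) + \<theta>"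
          have e: "?h x * (1 + cos (?u x)) * cos (c * x k + \<theta>') =
             ?h x * cos (c * x k + (0 * (\<Sum>j\<in>?R. a j * x j) + \<theta>')) +
             (1/2) * (?h x * cos (c * x k + (r * (\<Sum>j\<in>?R. a j * x j) + (\<theta> + \<theta>')))) +
             (1/2) * (?h x * cos (c * x k + ((-r) * (\<Sum>j\<in>?R. a j * x j) + (\<theta>' - \<theta>))))" for x
          proof -
            have "cos (?u x) * cos (c * x k + \<theta>') =
              (cos (c * x k + (r * (\<Sum>j\<in>?R. a j * x j) + (\<theta> + \<theta>'))) + cos (c * x k + ((-r) * (\<Sum>j\<in>?R. a j * x j) + (\<theta>' - \<theta>)))) / 2"
              by (subst mult.commute, subst cos_times_cos) (simp add: algebra_simps)
            moreover have "h * (1 + A) * C = h * C + (1/2) * (h * D) + (1/2) * (h * E)"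
              if "A * C = (D + E) / 2" for h A C D E :: real
              using arg_cong[OF that, of "\<lambda>y. h * y"] by (simp add: algebra_simps)
            ultimately show ?thesis by simp
          qed
          have i: "integrable \<mu>1 (\<lambda>x. ?h x * cos (c * x k + (r' * (\<Sum>j\<in>?R. a j * x j) + \<theta>'')))"
             "integrable \<mu>2 (\<lambda>x. ?h x * cos (c * x k + (r' * (\<Sum>j\<in>?R. a j * x j) + \<theta>'')))" for r' \<theta>''
            by (auto intro!: int c1)
          show ?thesis unfolding e using i gen
            by (simp only: Bochner_Integration.integral_add Bochner_Integration.integrable_add
               integrable_mult_right integral_mult_right_zero)
        qed
        show "(\<integral>x. ?h x * (1 + cos (r * (\<Sum>j\<in>?R. a j * x j) + \<theta>)) * cos (c * x k) \<partial>\<mu>1) =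
           (\<integral>x. ?h x * (1 + cos (r * (\<Sum>j\<in>?R. a j * x j) + \<theta>)) * cos (c * x k) \<partial>\<mu>2)" for c
          using expand[of c 0] by simp
        show "(\<integral>x. ?h x * (1 + cos (r * (\<Sum>j\<in>?R. a j * x j) + \<theta>)) * sin (c * x k) \<partial>\<mu>1) =
           (\<integral>x. ?h x * (1 + cos (r * (\<Sum>j\<in>?R. a j * x j) + \<theta>)) * sin (c * x k) \<partial>\<mu>2)" for c
        proof -
          \<comment> \<open>A phase shift by \<open>- pi / 2\<close> turns the cosine test functions into sines.\<close>
          have "cos (y + - pi / 2) = sin y" for y :: real by (simp add: cos_diff)
          then show ?thesis using expand[of c "-pi/2"] by simp
        qed
        have c2: "0 \<le> 1 + cos y" "1 + cos y \<le> 2" for y :: real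
          using cos_ge_minus_one[of y] cos_le_one[of y] by linarith+
        show "0 \<le> ?h x * (1 + cos (r * (\<Sum>j\<in>?R. a j * x j) + \<theta>))" for x
          using h(1) c2(1) by (intro mult_nonneg_nonneg)
        show "?h x * (1 + cos (r * (\<Sum>j\<in>?R. a j * x j) + \<theta>)) \<le> 2" for x
          using mult_mono[OF h(2)[of x] c2(2) zero_le_one c2(1)] by simp
        show "(\<lambda>x. x k) \<in> borel_measurable \<mu>1" unfolding ms by (rule kJ)
        show "(\<lambda>x. ?h x * (1 + cos (r * (\<Sum>j\<in>?R. a j * x j) + \<theta>))) \<in> borel_measurable \<mu>1" unfolding ms by measurable
      qed (use p1 p2 s1 s2 B in auto)
      let ?b = "\<lambda>x. ?h x * indicat_real (B k) (x k)"
      have b: "\<bar>?b x * g\<bar> \<le> 1" if "\<bar>g\<bar> \<le> 1" for x and g :: real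
        using h[of x] that mult_mono[of "?h x" 1 "\<bar>g\<bar>" 1] by (auto simp add: abs_mult indicator_def)
      have i: "integrable \<mu>1 (\<lambda>x. ?b x * cos (r * (\<Sum>j\<in>?R. a j * x j) + \<theta>))"
             "integrable \<mu>2 (\<lambda>x. ?b x * cos (r * (\<Sum>j\<in>?R. a j * x j) + \<theta>))" for r \<theta>
        by (auto intro!: int b)
      have i1: "integrable \<mu>1 ?b" "integrable \<mu>2 ?b" using i[of 0 0] by auto
      have split: "?h x * (1 + cos (r * (\<Sum>j\<in>?R. a j * x j) + \<theta>)) * indicat_real (B k) (x k) =
        ?b x + ?b x * cos (r * (\<Sum>j\<in>?R. a j * x j) + \<theta>)" for x r \<theta>
        by (simp add: algebra_simps)
      have tot: "(\<integral>x. ?b x \<partial>\<mu>1) = (\<integral>x. ?b x \<partial>\<mu>2)"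
        using step[of 0 "pi/2"] by simp
      have "(\<integral>x. ?b x * cos (1 * (\<Sum>j\<in>?R. a j * x j) + \<theta>0) \<partial>\<mu>1) = (\<integral>x. ?b x * cos (1 * (\<Sum>j\<in>?R. a j * x j) + \<theta>0) \<partial>\<mu>2)"
        using step[of 1 \<theta>0] tot unfolding split
          Bochner_Integration.integral_add[OF i1(1) i(1)] Bochner_Integration.integral_add[OF i1(2) i(2)] by simp
      then show "(\<integral>x. (\<Prod>j\<in>insert k S. indicat_real (B j) (x j)) * cos ((\<Sum>j\<in>?R. a j * x j) + \<theta>0) \<partial>\<mu>1) =
          (\<integral>x. (\<Prod>j\<in>insert k S. indicat_real (B j) (x j)) * cos ((\<Sum>j\<in>?R. a j * x j) + \<theta>0) \<partial>\<mu>2)"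
        using k(2) fS by (simp add: mult.commute mult.left_commute)
    qed
  qed
  then have PJ: "P J" using J by simp
  have box: "emeasure \<mu>1 (Pi\<^sub>E J B) = emeasure \<mu>2 (Pi\<^sub>E J B)" if B: "\<And>j. B j \<in> sets borel" for B
  proof -
    have e: "emeasure \<mu> (Pi\<^sub>E J B) = ennreal (\<integral>x. (\<Prod>j\<in>J. indicat_real (B j) (x j)) \<partial>\<mu>)"
      if "prob_space \<mu>" "sets \<mu> = sets (Rpow J)" for \<mu>
    proof -
      interpret prob_space \<mu> by fact
      have m: "Pi\<^sub>E J B \<in> sets \<mu>" unfolding that(2) using J B by (intro sets_PiM_I_finite) auto
      have "(\<integral>x. (\<Prod>j\<in>J. indicat_real (B j) (x j)) \<partial>\<mu>) = (\<integral>x. indicat_real (Pi\<^sub>E J B) x \<partial>\<mu>)"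
        using sets_eq_imp_space_eq[OF that(2)] J
        by (intro Bochner_Integration.integral_cong refl)
           (auto simp: indicator_def space_PiM PiE_iff prod_zero_iff)
      also have "\<dots> = measure \<mu> (Pi\<^sub>E J B)" using m by simp
      finally show ?thesis by (simp add: emeasure_eq_measure)
    qed
    show ?thesis
      using PJ[unfolded P_def, rule_format, of B "\<lambda>_. 0" 0] B e[OF p1 s1] e[OF p2 s2] by simp
  qed
  show ?thesis
  proof (rule measure_eqI_PiM_finite[OF J s1 s2])
    show "emeasure \<mu>1 (Pi\<^sub>E J A) = emeasure \<mu>2 (Pi\<^sub>E J A)" if "\<And>i. i \<in> J \<Longrightarrow> A i \<in> sets borel" for A
    proof -
      have "Pi\<^sub>E J A = Pi\<^sub>E J (\<lambda>j. if j \<in> J then A j else {})" by (auto simp: PiE_iff)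
      then show ?thesis using box[of "\<lambda>j. if j \<in> J then A j else {}"] that by simp
    qed
    show "range (\<lambda>_. space (Rpow J)) \<subseteq> prod_algebra J (\<lambda>_. borel)"
      using prod_algebraI_finite[OF J, of "\<lambda>_. UNIV" "\<lambda>_. borel"] by (auto simp: space_PiM)
    show "(\<Union>i::nat. space (Rpow J)) = space (Rpow J)" by simp
    show "emeasure \<mu>1 (space (Rpow J)) \<noteq> \<infinity>" using p1.emeasure_space_1 sp by simp
  qed
qed

section \<open>Compound Poisson vectors\<close>

abbreviation joint_char :: "'j set \<Rightarrow> ('j \<Rightarrow> real) measure \<Rightarrow> ('j \<Rightarrow> real) \<Rightarrow> complex" where
  "joint_char J \<mu> a \<equiv> (\<integral>x. exp (\<i> * of_real (\<Sum>j\<in>J. a j * x j)) \<partial>\<mu>)"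

lemma measurable_linear_form [measurable]:
  "(\<lambda>x. \<Sum>j\<in>J. a j * x j) \<in> borel_measurable (Rpow J)"
  by (intro borel_measurable_sum borel_measurable_times measurable_component_singleton) auto

lemma joint_char_distr:
  assumes "(\<lambda>x. \<lambda>j\<in>J. f j x) \<in> measurable M (Rpow J)"
  shows "joint_char J (distr M (Rpow J) (\<lambda>x. \<lambda>j\<in>J. f j x)) a
       = (\<integral>x. exp (\<i> * of_real (\<Sum>j\<in>J. a j * f j x)) \<partial>M)"
  using assms by (subst integral_distr) (simp_all del: of_real_sum)

lemma joint_char_product:
  assumes K: "finite K" and \<mu>: "\<And>k. prob_space (\<mu> k)" "\<And>k. sets (\<mu> k) = sets (Rpow J)"
  shows "(\<integral>z. exp (\<i> * of_real (\<Sum>j\<in>J. a j * (\<Sum>k\<in>K. z k j))) \<partial>PiM K \<mu>) = (\<Prod>k\<in>K. joint_char J (\<mu> k) a)"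
proof -
  interpret prob_space "\<mu> k" for k by (rule \<mu>(1))
  interpret product_sigma_finite \<mu> by standard
  have e: "exp (\<i> * of_real (\<Sum>j\<in>J. a j * (\<Sum>k\<in>K. z k j))) = (\<Prod>k\<in>K. exp (\<i> * of_real (\<Sum>j\<in>J. a j * z k j)))"
    for z :: "_ \<Rightarrow> _ \<Rightarrow> real"
    unfolding exp_sum[OF K, symmetric] sum_distrib_left[symmetric] of_real_sum[symmetric]
    by (subst sum.swap) (simp only: sum_distrib_left)
  have i: "integrable (\<mu> k) (\<lambda>x. exp (\<i> * of_real (\<Sum>j\<in>J. a j * x j)))" for k
    by (rule integrable_const_bound[where B=1])
       (simp_all del: of_real_sum cong: measurable_cong_sets[OF \<mu>(2) refl])
  show ?thesis unfolding e by (rule product_integral_prod[OF K i])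
qed

lemma joint_char_shift:
  assumes "prob_space \<mu>" "sets \<mu> = sets (Rpow J)"
  obtains \<mu>' where "prob_space \<mu>'" "sets \<mu>' = sets (Rpow J)"
    "\<mu>' = distr \<mu> (Rpow J) (\<lambda>x. \<lambda>j\<in>J. x j + b j)"
    "\<And>a. joint_char J \<mu>' a = joint_char J \<mu> a * exp (\<i> * of_real (\<Sum>j\<in>J. a j * b j))"
proof
  have m: "(\<lambda>x. \<lambda>j\<in>J. x j + b j) \<in> measurable \<mu> (Rpow J)"
    by (subst measurable_cong_sets[OF assms(2) refl]) measurable
  show "prob_space (distr \<mu> (Rpow J) (\<lambda>x. \<lambda>j\<in>J. x j + b j))"
    using assms(1) m by (rule prob_space.prob_space_distr)
  fix a
  show "joint_char J (distr \<mu> (Rpow J) (\<lambda>x. \<lambda>j\<in>J. x j + b j)) a = joint_char J \<mu> a * exp (\<i> * of_real (\<Sum>j\<in>J. a j * b j))"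
    unfolding joint_char_distr[OF m]
    by (subst integral_mult_left_zero[symmetric])
       (simp only: ring_distribs sum.distrib of_real_add exp_add)
qed auto

lemma integral_poisson_power:
  assumes "0 < r"
  shows "(\<integral>n. (z::complex) ^ n \<partial>measure_pmf (poisson_pmf r)) = exp (of_real r * (z - 1))"
proof -
  have s: "(\<lambda>n. (r ^ n / fact n * exp (- r)) *\<^sub>R z ^ n) sums exp (of_real r * (z - 1))"
  proof -
    have "(\<lambda>n. of_real (exp (- r)) * ((of_real r * z) ^ n /\<^sub>R fact n)) sums (of_real (exp (- r)) * exp (of_real r * z))"
      by (intro sums_mult exp_converges)
    also have "of_real (exp (- r)) * exp (of_real r * z) = exp (of_real r * (z - 1))"
      by (simp add: exp_of_real[symmetric] exp_add[symmetric] algebra_simps)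
    finally show ?thesis
      by (simp add: scaleR_conv_of_real power_mult_distrib field_simps)
  qed
  have abs: "summable (\<lambda>n. norm ((r ^ n / fact n * exp (- r)) *\<^sub>R z ^ n))"
    using summable_mult[OF summable_norm_exp[of "of_real r * z"], of "exp (- r)"] assms
    by (simp add: norm_mult norm_power power_mult_distrib field_simps)
  have "(\<integral>n. z ^ n \<partial>measure_pmf (poisson_pmf r)) = (\<integral>n. (r ^ n / fact n * exp (- r)) *\<^sub>R z ^ n \<partial>count_space UNIV)"
    unfolding measure_pmf_eq_density using assms by (subst integral_density) auto
  also have "\<dots> = (\<Sum>n. (r ^ n / fact n * exp (- r)) *\<^sub>R z ^ n)"
    using abs by (intro integral_count_space_nat) (simp add: integrable_count_space_nat_iff)
  finally show ?thesis using s by (simp add: sums_iff)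
qed

text \<open>The law of a sum of \<open>n\<close> independent vectors with the normalised law of \<open>g\<close> under \<open>\<kappa>\<close>, where \<open>n\<close> is
  an independent Poisson variable whose rate is the mass of \<open>\<kappa>\<close>. For \<open>\<kappa> = 0\<close> there is nothing to
  normalise and the sum is the constant zero.\<close>

lemma compound_poisson_exists:
  fixes g :: "'j \<Rightarrow> 'x \<Rightarrow> real"
  assumes J: "finite J" and fin: "finite_measure \<kappa>" and g: "\<And>j. j \<in> J \<Longrightarrow> g j \<in> borel_measurable \<kappa>"
  obtains \<mu> where "prob_space \<mu>" "sets \<mu> = sets (Rpow J)"
    "\<And>a. joint_char J \<mu> a = exp (\<integral>x. exp (\<i> * of_real (\<Sum>j\<in>J. a j * g j x)) - 1 \<partial>\<kappa>)"
proof -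
  interpret finite_measure \<kappa> by fact
  note [measurable] = g
  define r where "r = measure \<kappa> (space \<kappa>)"
  have mg: "(\<lambda>x. \<lambda>j\<in>J. g j x) \<in> measurable \<kappa> (Rpow J)" by measurable
  show thesis
  proof (cases "r = 0")
    case True
    then have "AE x in \<kappa>. False"
      by (subst AE_iff_measurable[of "space \<kappa>"]) (auto simp: r_def emeasure_eq_measure)
    then have 0: "(\<integral>x. h x \<partial>\<kappa>) = 0" for h :: "'x \<Rightarrow> complex"
      by (intro integral_eq_zero_AE) auto
    let ?z = "\<lambda>j\<in>J. 0::real"
    show thesis
    proof (rule that[of "return (Rpow J) ?z"])
      show "prob_space (return (Rpow J) ?z)" by (intro prob_space_return) (auto simp: space_PiM)
      show "joint_char J (return (Rpow J) ?z) a = exp (\<integral>x. exp (\<i> * of_real (\<Sum>j\<in>J. a j * g j x)) - 1 \<partial>\<kappa>)" for a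
        unfolding 0 by (subst integral_return) (auto simp: space_PiM simp del: of_real_sum)
    qed simp
  next
    case False
    then have r: "0 < r" unfolding r_def using measure_nonneg[of \<kappa> "space \<kappa>"] by linarith
    let ?D = "density \<kappa> (\<lambda>_. ennreal (1 / r))"
    have "emeasure ?D (space ?D) = 1"
      using r by (simp add: emeasure_density emeasure_eq_measure r_def[symmetric] ennreal_mult[symmetric])
    then interpret D: prob_space ?D by (rule prob_spaceI)
    have mgD: "(\<lambda>x. \<lambda>j\<in>J. g j x) \<in> measurable ?D (Rpow J)" using mg by simp
    define p where "p = distr ?D (Rpow J) (\<lambda>x. \<lambda>j\<in>J. g j x)"
    have sp[measurable_cong]: "sets p = sets (Rpow J)" by (simp add: p_def)
    interpret p: prob_space p unfolding p_def by (rule D.prob_space_distr[OF mgD])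
    define \<phi> where "\<phi> a = joint_char J p a" for a
    have \<phi>: "r * (\<phi> a - 1) = (\<integral>x. exp (\<i> * of_real (\<Sum>j\<in>J. a j * g j x)) - 1 \<partial>\<kappa>)" for a
    proof -
      have i: "integrable \<kappa> (\<lambda>x. exp (\<i> * of_real (\<Sum>j\<in>J. a j * g j x)))"
        by (rule integrable_const_bound[where B=1]) (simp_all del: of_real_sum)
      have "\<phi> a = (\<integral>x. exp (\<i> * of_real (\<Sum>j\<in>J. a j * g j x)) \<partial>?D)"
        unfolding \<phi>_def p_def by (rule joint_char_distr[OF mgD])
      also have "\<dots> = (\<integral>x. exp (\<i> * of_real (\<Sum>j\<in>J. a j * g j x)) \<partial>\<kappa>) / r"
        using r by (subst integral_density) (auto simp: scaleR_conv_of_real simp del: of_real_sum)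
      finally show ?thesis
        using i r by (simp add: Bochner_Integration.integral_diff algebra_simps r_def scaleR_conv_of_real)
    qed
    interpret pp: product_prob_space "\<lambda>_::nat. p" UNIV by unfold_locales
    interpret N: prob_space "measure_pmf (poisson_pmf r)" by (rule prob_space_measure_pmf)
    interpret pair_prob_space "measure_pmf (poisson_pmf r)" "PiM UNIV (\<lambda>_::nat. p)" ..
    let ?Q = "measure_pmf (poisson_pmf r) \<Otimes>\<^sub>M PiM UNIV (\<lambda>_::nat. p)"
    let ?X = "\<lambda>w. \<lambda>j\<in>J. \<Sum>k<fst w. (snd w :: nat \<Rightarrow> 'j \<Rightarrow> real) k j"
    have mX: "?X \<in> measurable ?Q (Rpow J)"
    proof (rule measurable_restrict)
      fix j assume "j \<in> J"
      then have [measurable]: "(\<lambda>x. x j) \<in> borel_measurable p" by simp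
      have "(\<lambda>w. \<Sum>k<n. (snd w :: nat \<Rightarrow> 'j \<Rightarrow> real) k j) \<in> borel_measurable ?Q" for n :: nat
        by measurable
      then show "(\<lambda>w. \<Sum>k<fst w. (snd w :: nat \<Rightarrow> 'j \<Rightarrow> real) k j) \<in> borel_measurable ?Q"
        by (rule measurable_compose_countable[where f="\<lambda>n w. \<Sum>k<n. snd w k j"]) measurable
    qed
    show thesis
    proof (rule that[of "distr ?Q (Rpow J) ?X"])
      show "prob_space (distr ?Q (Rpow J) ?X)" by (rule P.prob_space_distr[OF mX])
      fix a
      let ?h = "\<lambda>n (z::nat \<Rightarrow> 'j \<Rightarrow> real). exp (\<i> * of_real (\<Sum>j\<in>J. a j * (\<Sum>k<n. z k j)))"
      have inner: "(\<integral>z. ?h n z \<partial>PiM UNIV (\<lambda>_::nat. p)) = \<phi> a ^ n" for n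
      proof -
        have mh: "?h n \<in> borel_measurable (PiM {..<n} (\<lambda>_. p))"
        proof -
          have [measurable]: "(\<lambda>z. z k j) \<in> borel_measurable (PiM {..<n} (\<lambda>_. p))" if "k < n" "j \<in> J" for k j
            using that by (intro measurable_compose[OF measurable_component_singleton[of k]]) auto
          show ?thesis by measurable
        qed
        have "(\<integral>z. ?h n z \<partial>PiM UNIV (\<lambda>_::nat. p)) = (\<integral>z. ?h n (restrict z {..<n}) \<partial>PiM UNIV (\<lambda>_::nat. p))"
          by simp
        also have "\<dots> = (\<integral>z. ?h n z \<partial>distr (PiM UNIV (\<lambda>_. p)) (PiM {..<n} (\<lambda>_. p)) (\<lambda>z. restrict z {..<n}))"
          by (subst integral_distr[OF _ mh]) auto
        also have "\<dots> = (\<integral>z. ?h n z \<partial>PiM {..<n} (\<lambda>_. p))"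
          by (subst pp.distr_PiM_restrict_finite) auto
        also have "\<dots> = \<phi> a ^ n"
          unfolding \<phi>_def by (subst joint_char_product) (auto simp: p.prob_space_axioms sp)
        finally show ?thesis .
      qed
      have mh: "(\<lambda>w. ?h (fst w) (snd w)) \<in> borel_measurable ?Q"
      proof -
        have "(\<lambda>w. exp (\<i> * of_real (\<Sum>j\<in>J. a j * (?X w) j))) \<in> borel_measurable ?Q"
          using measurable_compose[OF mX measurable_linear_form[of a J]] by measurable
        then show ?thesis by simp
      qed
      have "joint_char J (distr ?Q (Rpow J) ?X) a = (\<integral>w. ?h (fst w) (snd w) \<partial>?Q)"
        by (rule joint_char_distr[OF mX])
      also have "\<dots> = (\<integral>n. (\<integral>z. ?h n z \<partial>PiM UNIV (\<lambda>_::nat. p)) \<partial>measure_pmf (poisson_pmf r))"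
      proof (subst integral_fst'[symmetric])
        show "integrable ?Q (\<lambda>w. ?h (fst w) (snd w))"
          using mh by (rule_tac P.integrable_const_bound[where B=1]) (simp_all del: of_real_sum)
      qed simp
      also have "\<dots> = exp (r * (\<phi> a - 1))"
        unfolding inner by (rule integral_poisson_power[OF r])
      finally show "joint_char J (distr ?Q (Rpow J) ?X) a = exp (\<integral>x. exp (\<i> * of_real (\<Sum>j\<in>J. a j * g j x)) - 1 \<partial>\<kappa>)"
        unfolding \<phi> .
    qed simp
  qed
qed

section \<open>Series of independent vectors\<close>

lemma norm_exp_minus_one_le:
  fixes z :: complex
  assumes "Re z \<le> 0"
  shows "cmod (exp z - 1) \<le> cmod z"
proof -
  have "cmod (exp z - exp 0) \<le> 1 * cmod (z - 0)"
  proof (rule field_differentiable_bound[where S="{z. Re z \<le> 0}" and f'=exp])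
    show "convex {z. Re z \<le> 0}" by (rule convex_halfspace_Re_le)
    show "(exp has_field_derivative exp w) (at w within {z. Re z \<le> 0})" for w
      by (rule DERIV_subset[OF DERIV_exp]) simp
  qed (use assms in auto)
  then show ?thesis by simp
qed

text \<open>The exponent is at most \<open>c\<^sup>2 / 2 * (\<integral>x. (y x)\<^sup>2 \<partial>\<kappa>)\<close> in absolute value. Its real part is at most 0, so
  the same bound holds for \<open>1\<close> minus its exponential and for the mean of \<open>1 - cos (c * S)\<close>. As \<open>c\<close> tends to 0, \<open>2 * (1 - cos (c * S)) / c\<^sup>2\<close> tends to \<open>S\<^sup>2\<close>, and Fatou's lemma
  applies.\<close>

lemma second_moment_le:
  fixes S :: "'w \<Rightarrow> real" and y :: "'x \<Rightarrow> real"
  assumes "prob_space M" and S[measurable]: "S \<in> borel_measurable M"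
    and y[measurable]: "y \<in> borel_measurable \<kappa>" and y2: "integrable \<kappa> (\<lambda>x. (y x)\<^sup>2)"
    and cf: "\<And>c. (\<integral>w. iexp (c * S w) \<partial>M) = exp (\<integral>x. iexp (c * y x) - 1 - \<i> * of_real (c * y x) \<partial>\<kappa>)"
  shows "(\<integral>\<^sup>+w. ennreal ((S w)\<^sup>2) \<partial>M) \<le> ennreal (\<integral>x. (y x)\<^sup>2 \<partial>\<kappa>)"
proof -
  interpret prob_space M by fact
  define V where "V = (\<integral>x. (y x)\<^sup>2 \<partial>\<kappa>)"
  have bound: "(\<integral>w. 1 - cos (c * S w) \<partial>M) \<le> c\<^sup>2 * V / 2" for c
  proof -
    define \<psi> where "\<psi> = (\<integral>x. iexp (c * y x) - 1 - \<i> * of_real (c * y x) \<partial>\<kappa>)"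
    have pt: "cmod (iexp (c * y x) - 1 - \<i> * of_real (c * y x)) \<le> c\<^sup>2 / 2 * (y x)\<^sup>2" for x
      using iexp_approx1[of "c * y x" 1] by (simp add: power2_eq_square algebra_simps)
    have i: "integrable \<kappa> (\<lambda>x. iexp (c * y x) - 1 - \<i> * of_real (c * y x))"
    proof (rule Bochner_Integration.integrable_bound)
      show "integrable \<kappa> (\<lambda>x. c\<^sup>2 / 2 * (y x)\<^sup>2)" using y2 by simp
      show "AE x in \<kappa>. norm (iexp (c * y x) - 1 - \<i> * of_real (c * y x)) \<le> norm (c\<^sup>2 / 2 * (y x)\<^sup>2)"
        using pt by (auto intro!: AE_I2 order.trans[OF pt])
    qed measurable
    have "cmod \<psi> \<le> (\<integral>x. c\<^sup>2 / 2 * (y x)\<^sup>2 \<partial>\<kappa>)"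
      unfolding \<psi>_def using y2 by (intro order.trans[OF integral_norm_bound] integral_mono integrable_norm i pt) auto
    then have n: "cmod \<psi> \<le> c\<^sup>2 * V / 2" by (simp add: V_def)
    have "Re \<psi> = (\<integral>x. cos (c * y x) - 1 \<partial>\<kappa>)"
      unfolding \<psi>_def integral_Re[OF i, symmetric] by (simp add: Re_exp)
    also have "\<dots> = - (\<integral>x. 1 - cos (c * y x) \<partial>\<kappa>)"
      by (subst integral_minus[symmetric]) simp
    also have "\<dots> \<le> 0" by simp
    finally have re: "Re \<psi> \<le> 0" .
    have iS: "integrable M (\<lambda>w. iexp (c * S w))"
      by (rule integrable_const_bound[where B=1]) auto
    have "(\<integral>w. 1 - cos (c * S w) \<partial>M) = 1 - Re (\<integral>w. iexp (c * S w) \<partial>M)"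
      unfolding integral_Re[OF iS, symmetric] using integrable_Re[OF iS]
      by (simp add: Re_exp prob_space)
    also have "\<dots> \<le> cmod (exp \<psi> - 1)"
      unfolding cf \<psi>_def[symmetric] using complex_Re_le_cmod[of "1 - exp \<psi>"] by (simp add: norm_minus_commute)
    also have "\<dots> \<le> c\<^sup>2 * V / 2" using norm_exp_minus_one_le[OF re] n by simp
    finally show ?thesis .
  qed
  define u where "u n w = 2 * (1 - cos (S w / real (Suc n))) * (real (Suc n))\<^sup>2" for n w
  have u0: "0 \<le> u n w" for n w by (simp add: u_def)
  have lim: "(\<lambda>n. u n w) \<longlonglongrightarrow> (S w)\<^sup>2" for w
    unfolding u_def power2_eq_square by real_asymp
  have [measurable]: "u n \<in> borel_measurable M" for n unfolding u_def[abs_def] by measurable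
  have int: "(\<integral>\<^sup>+w. ennreal (u n w) \<partial>M) \<le> ennreal V" for n
  proof -
    have i: "integrable M (\<lambda>w. 1 - cos (S w / real (Suc n)))"
    proof (rule integrable_const_bound[where B=2])
      have "\<bar>1 - cos y\<bar> \<le> 2" for y :: real using cos_ge_minus_one[of y] cos_le_one[of y] by linarith
      then show "AE w in M. norm (1 - cos (S w / real (Suc n))) \<le> 2" by simp
    qed measurable
    have "(\<integral>\<^sup>+w. ennreal (u n w) \<partial>M) = ennreal (\<integral>w. u n w \<partial>M)"
      using u0 unfolding u_def
      by (intro nn_integral_eq_integral integrable_mult_left integrable_mult_right i) auto
    also have "(\<integral>w. u n w \<partial>M) = 2 * (real (Suc n))\<^sup>2 * (\<integral>w. 1 - cos (1 / real (Suc n) * S w) \<partial>M)"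
      unfolding u_def integral_mult_right_zero[symmetric]
      by (intro Bochner_Integration.integral_cong) (simp_all only: mult_ac times_divide_eq_right mult_1_left mult_1_right)
    also have "\<dots> \<le> 2 * (real (Suc n))\<^sup>2 * ((1 / real (Suc n))\<^sup>2 * V / 2)"
      by (intro mult_left_mono bound) auto
    also have "\<dots> = V" by (simp add: power2_eq_square)
    finally show ?thesis by (simp add: ennreal_leI)
  qed
  have "(\<integral>\<^sup>+w. ennreal ((S w)\<^sup>2) \<partial>M) = (\<integral>\<^sup>+w. liminf (\<lambda>n. ennreal (u n w)) \<partial>M)"
    by (intro nn_integral_cong lim_imp_Liminf[symmetric] tendsto_ennrealI lim) simp
  also have "\<dots> \<le> liminf (\<lambda>n. \<integral>\<^sup>+w. ennreal (u n w) \<partial>M)"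
    by (rule nn_integral_liminf) measurable
  also have "\<dots> \<le> ennreal V"
    using int by (intro Liminf_le always_eventually) auto
  finally show ?thesis by (simp add: V_def)
qed

lemma absolute_moment_le:
  fixes S :: "'w \<Rightarrow> real"
  assumes "prob_space M" and S[measurable]: "S \<in> borel_measurable M" and d: "0 < d"
    and 2: "(\<integral>\<^sup>+w. ennreal ((S w)\<^sup>2) \<partial>M) \<le> ennreal (d\<^sup>2)"
  shows "(\<integral>\<^sup>+w. ennreal \<bar>S w\<bar> \<partial>M) \<le> ennreal d"
proof -
  interpret prob_space M by fact
  \<comment> \<open>The inequality between arithmetic and geometric means, balanced at \<open>\<bar>s\<bar> = d\<close>.\<close>
  have pt: "\<bar>s\<bar> \<le> s\<^sup>2 / (2 * d) + d / 2" for s :: real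
  proof -
    have "0 \<le> (\<bar>s\<bar> - d)\<^sup>2 / (2 * d)" using d by simp
    also have "\<dots> = s\<^sup>2 / (2 * d) + d / 2 - \<bar>s\<bar>" using d by (simp add: field_simps power2_eq_square)
    finally show ?thesis by simp
  qed
  have "(\<integral>\<^sup>+w. ennreal \<bar>S w\<bar> \<partial>M) \<le> (\<integral>\<^sup>+w. ennreal (1 / (2 * d)) * ennreal ((S w)\<^sup>2) + ennreal (d / 2) \<partial>M)"
  proof (intro nn_integral_mono)
    fix w
    have "ennreal \<bar>S w\<bar> \<le> ennreal (1 / (2 * d) * (S w)\<^sup>2 + d / 2)" using pt[of "S w"] by (intro ennreal_leI) simp
    also have "\<dots> = ennreal (1 / (2 * d)) * ennreal ((S w)\<^sup>2) + ennreal (d / 2)"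
      using d by (subst ennreal_plus) (auto simp: ennreal_mult[symmetric])
    finally show "ennreal \<bar>S w\<bar> \<le> ennreal (1 / (2 * d)) * ennreal ((S w)\<^sup>2) + ennreal (d / 2)" .
  qed
  also have "\<dots> = ennreal (1 / (2 * d)) * (\<integral>\<^sup>+w. ennreal ((S w)\<^sup>2) \<partial>M) + ennreal (d / 2)"
    by (subst nn_integral_add) (auto simp: nn_integral_cmult emeasure_space_1)
  also have "\<dots> \<le> ennreal (1 / (2 * d)) * ennreal (d\<^sup>2) + ennreal (d / 2)"
    by (intro add_right_mono mult_left_mono 2) simp
  also have "\<dots> = ennreal d"
    using d by (simp add: ennreal_mult[symmetric] ennreal_plus[symmetric] power2_eq_square del: ennreal_plus)
  finally show ?thesis .
qed

text \<open>From the second term on, the absolute moments are summable, so the series converges absolutely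
  almost surely in every coordinate. The characteristic functions of the partial sums are products.\<close>

lemma independent_series_exists:
  fixes \<mu> :: "nat \<Rightarrow> ('j \<Rightarrow> real) measure"
  assumes J: "finite J" and \<mu>: "\<And>k. prob_space (\<mu> k)" "\<And>k. sets (\<mu> k) = sets (Rpow J)"
    and cf: "\<And>k a. joint_char J (\<mu> k) a = exp (\<psi> k a)"
    and moment: "\<And>k j. j \<in> J \<Longrightarrow> (\<integral>\<^sup>+x. ennreal \<bar>x j\<bar> \<partial>\<mu> (Suc k)) \<le> ennreal ((1/2) ^ k)"
    and \<Psi>: "\<And>a. (\<lambda>k. \<psi> k a) sums \<Psi> a"
  obtains \<rho> where "prob_space \<rho>" "sets \<rho> = sets (Rpow J)" "\<And>a. joint_char J \<rho> a = exp (\<Psi> a)"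
proof -
  note [measurable_cong] = \<mu>(2)
  interpret p: prob_space "\<mu> k" for k by (rule \<mu>(1))
  have mx: "(\<lambda>x. x j) \<in> borel_measurable (\<mu> k)" if "j \<in> J" for j k
    using that by (subst measurable_cong_sets[OF \<mu>(2) refl]) measurable
  interpret product_prob_space \<mu> UNIV by unfold_locales
  let ?W = "PiM UNIV \<mu>"
  have mc[measurable]: "(\<lambda>z. z k j) \<in> borel_measurable ?W" if "j \<in> J" for k j
    using that by (intro measurable_compose[OF measurable_component_singleton[of k]]) auto
  let ?X = "\<lambda>z. \<lambda>j\<in>J. \<Sum>k. (z :: nat \<Rightarrow> 'j \<Rightarrow> real) k j"
  have mX: "?X \<in> measurable ?W (Rpow J)"
    by (intro measurable_restrict borel_measurable_suminf mc)
  have summ: "AE z in ?W. summable (\<lambda>k. z k j)" if j: "j \<in> J" for j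
  proof -
    have "(\<integral>\<^sup>+z. (\<Sum>k. ennreal \<bar>z (Suc k) j\<bar>) \<partial>?W) = (\<Sum>k. \<integral>\<^sup>+z. ennreal \<bar>z (Suc k) j\<bar> \<partial>?W)"
      using mc[OF j] by (intro nn_integral_suminf) auto
    also have "\<dots> \<le> (\<Sum>k. ennreal ((1/2) ^ k))"
    proof (intro suminf_le)
      fix k
      note [measurable] = mx[OF j]
      have "(\<integral>\<^sup>+z. ennreal \<bar>z (Suc k) j\<bar> \<partial>?W) = (\<integral>\<^sup>+x. ennreal \<bar>x j\<bar> \<partial>distr ?W (\<mu> (Suc k)) (\<lambda>z. z (Suc k)))"
        by (subst nn_integral_distr) auto
      then show "(\<integral>\<^sup>+z. ennreal \<bar>z (Suc k) j\<bar> \<partial>?W) \<le> ennreal ((1/2) ^ k)"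
        using moment[OF j, of k] by (subst (asm) PiM_component) auto
    qed auto
    also have "\<dots> = ennreal (\<Sum>k. (1/2) ^ k)"
      by (intro suminf_ennreal2) auto
    also have "\<dots> < \<infinity>" by simp
    finally have "AE z in ?W. (\<Sum>k. ennreal \<bar>z (Suc k) j\<bar>) \<noteq> \<infinity>"
      using mc[OF j] by (intro nn_integral_PInf_AE) auto
    then show ?thesis
    proof eventually_elim
      case (elim z)
      then have "summable (\<lambda>k. \<bar>z (Suc k) j\<bar>)" by (intro summable_suminf_not_top) auto
      then have "summable (\<lambda>k. z (Suc k) j)" by (rule summable_rabs_cancel)
      then show ?case by (subst (asm) summable_Suc_iff)
    qed
  qed
  then have AE: "AE z in ?W. \<forall>j\<in>J. summable (\<lambda>k. z k j)"
    using J by (intro AE_finite_allI) auto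
  show thesis
  proof (rule that[of "distr ?W (Rpow J) ?X"])
    show "prob_space (distr ?W (Rpow J) ?X)" by (rule P.prob_space_distr[OF mX])
    fix a
    let ?h = "\<lambda>n z. exp (\<i> * of_real (\<Sum>j\<in>J. a j * (\<Sum>k<n. (z :: nat \<Rightarrow> 'j \<Rightarrow> real) k j)))"
    let ?H = "\<lambda>z. exp (\<i> * of_real (\<Sum>j\<in>J. a j * (\<Sum>k. (z :: nat \<Rightarrow> 'j \<Rightarrow> real) k j)))"
    have "(\<lambda>n. \<integral>z. ?h n z \<partial>?W) \<longlonglongrightarrow> (\<integral>z. ?H z \<partial>?W)"
    proof (rule integral_dominated_convergence[where w="\<lambda>_. 1"])
      show "AE z in ?W. (\<lambda>n. ?h n z) \<longlonglongrightarrow> ?H z"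
        using AE
      proof eventually_elim
        case (elim z)
        then have "(\<lambda>n. \<Sum>k<n. z k j) \<longlonglongrightarrow> (\<Sum>k. z k j)" if "j \<in> J" for j
          using that by (auto intro: summable_LIMSEQ)
        then show ?case by (intro tendsto_intros)
      qed
    qed (auto simp del: of_real_sum)
    moreover have "(\<integral>z. ?h n z \<partial>?W) = exp (\<Sum>k<n. \<psi> k a)" for n
    proof -
      have mh: "?h n \<in> borel_measurable (PiM {..<n} \<mu>)"
      proof -
        have [measurable]: "(\<lambda>z. z k j) \<in> borel_measurable (PiM {..<n} \<mu>)" if "k < n" "j \<in> J" for k j
          using that by (intro measurable_compose[OF measurable_component_singleton[of k] mx]) auto
        show ?thesis by measurable
      qed
      have "(\<integral>z. ?h n z \<partial>?W) = (\<integral>z. ?h n (restrict z {..<n}) \<partial>?W)" by simp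
      also have "\<dots> = (\<integral>z. ?h n z \<partial>distr ?W (PiM {..<n} \<mu>) (\<lambda>z. restrict z {..<n}))"
        by (subst integral_distr[OF _ mh]) auto
      also have "\<dots> = (\<integral>z. ?h n z \<partial>PiM {..<n} \<mu>)"
        by (subst distr_PiM_restrict_finite) auto
      also have "\<dots> = exp (\<Sum>k<n. \<psi> k a)"
        by (subst joint_char_product) (simp_all add: p.prob_space_axioms \<mu>(2) cf exp_sum del: of_real_sum)
      finally show ?thesis .
    qed
    moreover have "(\<lambda>n. exp (\<Sum>k<n. \<psi> k a)) \<longlonglongrightarrow> exp (\<Psi> a)"
      using \<Psi>[of a] unfolding sums_def by (intro tendsto_exp)
    ultimately have "(\<integral>z. ?H z \<partial>?W) = exp (\<Psi> a)" by (simp add: LIMSEQ_unique)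
    then show "joint_char J (distr ?W (Rpow J) ?X) a = exp (\<Psi> a)"
      by (simp only: joint_char_distr[OF mX])
  qed simp
qed

section \<open>Existence of Poissonian laws\<close>

text \<open>With \<open>F = (\<Sum>j\<in>J. min ((f j)\<^sup>2) 1)\<close>, the sets \<open>{x. F x > 1/(n+2)}\<close> have finite mass and exhaust all
  jumps. They are cut into disjoint shells \<open>A k\<close> thin enough that, for \<open>k \<ge> 1\<close>, the second moment of the
  jumps in \<open>A k\<close> is at most \<open>(1/4) ^ (k - 1)\<close>. Each shell gives a compound Poisson vector,
  centred at the mean of its jumps of size at most 1; by the second-moment bound the sum of
  these independent vectors converges.\<close>

theorem poissonian_law_exists:
  fixes f :: "'j \<Rightarrow> 'x \<Rightarrow> real"
  assumes J: "finite J" and lf: "levy_family \<nu> f J"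
  obtains \<mu> where "prob_space \<mu>" "sets \<mu> = sets (Rpow J)"
    "\<And>a. joint_char J \<mu> a = exp (lk_exponent \<nu> f J b a)"
proof -
  note [measurable] = levy_familyD(1)[OF lf]
  define F where "F x = (\<Sum>j\<in>J. min ((f j x)\<^sup>2) 1)" for x
  have F0: "0 \<le> F x" for x by (auto simp: F_def intro!: sum_nonneg)
  have iF: "integrable \<nu> F" unfolding F_def[abs_def] using levy_familyD(2)[OF lf] by auto
  have [measurable]: "F \<in> borel_measurable \<nu>" using iF by auto
  have fF: "min ((f j x)\<^sup>2) 1 \<le> F x" if "j \<in> J" for j x
    unfolding F_def using J that by (intro member_le_sum) auto
  define D where "D n = {x \<in> space \<nu>. 1 / (real n + 2) < F x}" for n :: nat
  have [measurable]: "D n \<in> sets \<nu>" for n unfolding D_def by measurable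
  have D_mono: "D n \<subseteq> D m" if "n \<le> m" for n m
  proof -
    have "1 / (real m + 2) \<le> 1 / (real n + 2)" using that by (intro frac_le) auto
    then show ?thesis by (auto simp: D_def)
  qed
  have D_finite: "emeasure \<nu> (D n) < \<infinity>" for n
  proof -
    have "1 \<le> ennreal (real n + 2) * ennreal (F x)" if "x \<in> D n" for x
    proof -
      have "1 \<le> (real n + 2) * F x" using that by (simp add: D_def field_simps)
      then have "ennreal 1 \<le> ennreal ((real n + 2) * F x)" by (rule ennreal_leI)
      then show ?thesis using F0[of x] by (subst ennreal_mult[symmetric]) auto
    qed
    then have "emeasure \<nu> (D n) \<le> emeasure \<nu> {x \<in> space \<nu>. 1 \<le> ennreal (real n + 2) * ennreal (F x)}"
      by (intro emeasure_mono) (auto simp: D_def)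
    also have "\<dots> \<le> ennreal (real n + 2) * (\<integral>\<^sup>+x. ennreal (F x) * indicator (space \<nu>) x \<partial>\<nu>)"
      using nn_integral_Markov_inequality[where u="\<lambda>x. ennreal (F x)" and M=\<nu> and A="space \<nu>" and c="ennreal (real n + 2)"] by simp
    also have "(\<integral>\<^sup>+x. ennreal (F x) * indicator (space \<nu>) x \<partial>\<nu>) = ennreal (\<integral>x. F x \<partial>\<nu>)"
      using iF F0 by (subst nn_integral_eq_integral[symmetric]) (auto intro!: nn_integral_cong)
    also have "ennreal (real n + 2) * ennreal (\<integral>x. F x \<partial>\<nu>) < \<infinity>"
      by (simp add: ennreal_mult_less_top)
    finally show ?thesis .
  qed
  define tail where "tail n = (\<integral>x. indicator (space \<nu> - D n) x * F x \<partial>\<nu>)" for n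
  have itail: "integrable \<nu> (\<lambda>x. indicator (space \<nu> - D n) x * F x)" for n
    using integrable_mult_indicator[OF _ iF, of "space \<nu> - D n"] by simp
  have "tail \<longlonglongrightarrow> (\<integral>x. 0 \<partial>\<nu>)"
    unfolding tail_def
  proof (rule integral_dominated_convergence[where w=F])
    show "AE x in \<nu>. (\<lambda>n. indicator (space \<nu> - D n) x * F x) \<longlonglongrightarrow> 0"
    proof (rule AE_I2, rule tendsto_sandwich)
      fix x
      show "\<forall>\<^sub>F n in sequentially. 0 \<le> indicator (space \<nu> - D n) x * F x"
        using F0 by simp
      show "\<forall>\<^sub>F n in sequentially. indicator (space \<nu> - D n) x * F x \<le> 1 / (real n + 2)"
        by (auto simp: D_def indicator_def not_less)
      show "(\<lambda>n. 1 / (real n + 2)) \<longlonglongrightarrow> 0" by real_asymp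
    qed simp
    show "AE x in \<nu>. norm (indicator (space \<nu> - D n) x * F x) \<le> F x" for n
      using F0 by (auto simp: indicator_def)
  qed (use iF in auto)
  then have tail0: "tail \<longlonglongrightarrow> 0" by simp
  have "\<exists>m. tail m \<le> (1/4) ^ k" for k :: nat
  proof -
    have "\<forall>\<^sub>F m in sequentially. tail m < (1/4) ^ k" using tail0 by (rule order_tendstoD) simp
    then show ?thesis by (auto simp: eventually_sequentially intro: less_imp_le)
  qed
  then obtain m where m: "\<And>k. tail (m k) \<le> (1/4) ^ k" by metis
  \<comment> \<open>The summand \<open>m k\<close> makes the tail small; the summand \<open>k\<close> makes the sets exhaust all jumps even if \<open>m\<close> is
    bounded.\<close>
  define E where "E k = D (m k + k)" for k
  define A where "A = disjointed E"
  have [measurable]: "E k \<in> sets \<nu>" for k by (simp add: E_def)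
  have mA[measurable]: "A k \<in> sets \<nu>" for k
    unfolding A_def disjointed_def by measurable
  have AE_sub: "A k \<subseteq> E k" "x \<in> A (Suc k) \<Longrightarrow> x \<notin> E k" "A k \<subseteq> space \<nu>" for k x
    using disjointed_subset[of E k] sets.sets_into_space[OF mA]
    by (auto simp: A_def disjointed_def)
  define \<kappa> where "\<kappa> k = density \<nu> (\<lambda>x. ennreal (indicator (A k) x))" for k
  have sets_\<kappa>[measurable_cong]: "sets (\<kappa> k) = sets \<nu>" for k by (simp add: \<kappa>_def)
  have fin: "finite_measure (\<kappa> k)" for k
  proof
    have "emeasure (\<kappa> k) (space (\<kappa> k)) = (\<integral>\<^sup>+x. ennreal (indicator (A k) x) * indicator (space \<nu>) x \<partial>\<nu>)"
      unfolding \<kappa>_def by (subst emeasure_density) auto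
    also have "\<dots> = (\<integral>\<^sup>+x. indicator (A k) x \<partial>\<nu>)"
      by (intro nn_integral_cong) (auto simp: indicator_def)
    also have "\<dots> = emeasure \<nu> (A k)" by simp
    also have "\<dots> \<le> emeasure \<nu> (E k)" by (intro emeasure_mono AE_sub) simp
    also have "\<dots> < \<infinity>" unfolding E_def by (rule D_finite)
    finally show "emeasure (\<kappa> k) (space (\<kappa> k)) \<noteq> \<infinity>" by simp
  qed
  have int_\<kappa>: "(\<integral>x. h x \<partial>\<kappa> k) = (\<integral>x. indicator (A k) x *\<^sub>R h x \<partial>\<nu>)"
    if [measurable]: "h \<in> borel_measurable \<nu>" for h :: "'x \<Rightarrow> 'b::{banach, second_countable_topology}" and k
    unfolding \<kappa>_def by (subst integral_density) auto
  have f\<kappa>[measurable]: "f j \<in> borel_measurable (\<kappa> k)" if "j \<in> J" for j k using that by measurable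
  \<comment> \<open>The mean of the jumps of size at most 1 in the shell, which is subtracted as its centring.\<close>
  define d where "d k j = (\<integral>x. f j x * indicat_real {-1..1} (f j x) \<partial>\<kappa> k)" for k j
  define \<psi> where "\<psi> k a = (\<integral>x. lk_integrand f J a x \<partial>\<kappa> k)" for k a
  have mlk: "lk_integrand f J a \<in> borel_measurable \<nu>" for a by (rule measurable_lk_integrand[OF lf])
  have shell: "\<exists>\<mu>. prob_space \<mu> \<and> sets \<mu> = sets (Rpow J) \<and> (\<forall>a. joint_char J \<mu> a = exp (\<psi> k a))" for k
  proof -
    interpret finite_measure "\<kappa> k" by (rule fin)
    obtain \<mu>0 where \<mu>0: "prob_space \<mu>0" "sets \<mu>0 = sets (Rpow J)"
      "\<And>a. joint_char J \<mu>0 a = exp (\<integral>x. exp (\<i> * of_real (\<Sum>j\<in>J. a j * f j x)) - 1 \<partial>\<kappa> k)"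
      by (rule compound_poisson_exists[OF J fin[of k], of f, OF f\<kappa>]) (assumption, rule that, assumption+)
    obtain \<mu> where \<mu>: "prob_space \<mu>" "sets \<mu> = sets (Rpow J)"
      "\<And>a. joint_char J \<mu> a = joint_char J \<mu>0 a * exp (\<i> * of_real (\<Sum>j\<in>J. a j * - d k j))"
      by (rule joint_char_shift[OF \<mu>0(1,2), of "\<lambda>j. - d k j"]) (rule that, assumption+)
    have "joint_char J \<mu> a = exp (\<psi> k a)" for a
    proof -
      have i1: "integrable (\<kappa> k) (\<lambda>x. exp (\<i> * of_real (\<Sum>j\<in>J. a j * f j x)) - 1)"
        by (rule Bochner_Integration.integrable_diff, rule integrable_const_bound[where B=1])
          (simp_all del: of_real_sum)
      have i2: "integrable (\<kappa> k) (\<lambda>x. f j x * indicat_real {-1..1} (f j x))" if "j \<in> J" for j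
        using that by (intro integrable_const_bound[where B=1]) (auto simp: indicator_def)
      have i3: "integrable (\<kappa> k) (\<lambda>x. \<Sum>j\<in>J. a j * f j x * indicat_real {-1..1} (f j x))"
        unfolding mult.assoc by (intro Bochner_Integration.integrable_sum integrable_mult_right i2)
      have d: "(\<integral>x. (\<Sum>j\<in>J. a j * f j x * indicat_real {-1..1} (f j x)) \<partial>\<kappa> k) = (\<Sum>j\<in>J. a j * d k j)"
        unfolding mult.assoc d_def using i2 by (subst Bochner_Integration.integral_sum) auto
      have "\<psi> k a = (\<integral>x. exp (\<i> * of_real (\<Sum>j\<in>J. a j * f j x)) - 1 \<partial>\<kappa> k)
          - (\<integral>x. \<i> * of_real (\<Sum>j\<in>J. a j * f j x * indicat_real {-1..1} (f j x)) \<partial>\<kappa> k)"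
        unfolding \<psi>_def lk_integrand_def
        by (intro Bochner_Integration.integral_diff i1 integrable_mult_right integrable_of_real i3)
      also have "\<dots> = (\<integral>x. exp (\<i> * of_real (\<Sum>j\<in>J. a j * f j x)) - 1 \<partial>\<kappa> k)
          + \<i> * of_real (\<Sum>j\<in>J. a j * - d k j)"
        unfolding integral_mult_right_zero integral_complex_of_real d by (simp add: sum_negf)
      finally show ?thesis unfolding \<mu>(3) \<mu>0(3) by (simp only: exp_add)
    qed
    then show ?thesis using \<mu> by blast
  qed
  then have "\<exists>\<mu>. \<forall>k. prob_space (\<mu> k) \<and> sets (\<mu> k) = sets (Rpow J) \<and> (\<forall>a. joint_char J (\<mu> k) a = exp (\<psi> k a))"
    by (intro choice allI)
  then obtain \<mu> where "\<forall>k. prob_space (\<mu> k) \<and> sets (\<mu> k) = sets (Rpow J) \<and> (\<forall>a. joint_char J (\<mu> k) a = exp (\<psi> k a))" ..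
  then have \<mu>: "\<And>k. prob_space (\<mu> k)" "\<And>k. sets (\<mu> k) = sets (Rpow J)"
    "\<And>k a. joint_char J (\<mu> k) a = exp (\<psi> k a)" by blast+
  have moment: "(\<integral>\<^sup>+x. ennreal \<bar>x j\<bar> \<partial>\<mu> (Suc k)) \<le> ennreal ((1/2) ^ k)" if j: "j \<in> J" for k j
  proof (rule absolute_moment_le[OF \<mu>(1)])
    show mj: "(\<lambda>x. x j) \<in> borel_measurable (\<mu> (Suc k))"
      using j by (subst measurable_cong_sets[OF \<mu>(2) refl]) measurable
    \<comment> \<open>Beyond the first shell all jumps are at most 1, so neither the minimum in \<open>F\<close> nor the
      indicator in the exponent truncates.\<close>
    have small: "(f j x)\<^sup>2 = min ((f j x)\<^sup>2) 1" "\<bar>f j x\<bar> \<le> 1" "x \<in> space \<nu> - D (m k)"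
      if "x \<in> A (Suc k)" for x
    proof -
      have x: "x \<in> space \<nu>" "x \<notin> D (m k + k)" using that AE_sub(2,3) by (auto simp: E_def)
      then have "F x \<le> 1 / (real (m k + k) + 2)" by (auto simp: D_def)
      also have "\<dots> < 1" by simp
      finally have "min ((f j x)\<^sup>2) 1 < 1" using fF[OF j, of x] by simp
      then have "(f j x)\<^sup>2 < 1" by (simp add: min_def split: if_splits)
      then show "(f j x)\<^sup>2 = min ((f j x)\<^sup>2) 1" "\<bar>f j x\<bar> \<le> 1" by (auto simp: abs_square_le_1[symmetric])
      show "x \<in> space \<nu> - D (m k)" using x D_mono[of "m k" "m k + k"] by auto
    qed
    have le: "indicator (A (Suc k)) x *\<^sub>R (f j x)\<^sup>2 \<le> indicator (space \<nu> - D (m k)) x * F x" for x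
      using small[of x] fF[OF j, of x] F0[of x] by (auto simp: indicator_def)
    have i2: "integrable \<nu> (\<lambda>x. indicator (A (Suc k)) x *\<^sub>R (f j x)\<^sup>2)"
      using j le F0 by (intro Bochner_Integration.integrable_bound[OF itail[of "m k"]]) (auto simp: abs_mult)
    have "(\<integral>\<^sup>+x. ennreal ((x j)\<^sup>2) \<partial>\<mu> (Suc k)) \<le> ennreal (\<integral>x. (f j x)\<^sup>2 \<partial>\<kappa> (Suc k))"
    proof (rule second_moment_le[OF \<mu>(1) mj f\<kappa>[OF j]])
      show "integrable (\<kappa> (Suc k)) (\<lambda>x. (f j x)\<^sup>2)"
        unfolding \<kappa>_def using i2 j by (subst integrable_density) auto
      fix c :: real
      let ?a = "\<lambda>i. if i = j then c else 0"
      have s: "(\<Sum>i\<in>J. ?a i * h i) = c * h j" for h :: "'j \<Rightarrow> real"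
        using J j by (simp add: if_distrib[of "\<lambda>y. y * _"] sum.delta cong: if_cong)
      have AE: "AE x in \<kappa> (Suc k). x \<in> A (Suc k)"
        unfolding \<kappa>_def by (subst AE_density) (auto simp: indicator_def)
      have "(\<integral>w. iexp (c * w j) \<partial>\<mu> (Suc k)) = exp (\<psi> (Suc k) ?a)"
        using \<mu>(3)[of "Suc k" ?a] unfolding s .
      also have "\<psi> (Suc k) ?a = (\<integral>x. iexp (c * f j x) - 1 - \<i> * of_real (c * f j x) \<partial>\<kappa> (Suc k))"
        unfolding \<psi>_def
      proof (rule integral_cong_AE)
        show "AE x in \<kappa> (Suc k). lk_integrand f J ?a x = iexp (c * f j x) - 1 - \<i> * of_real (c * f j x)"
          using AE
        proof eventually_elim
          case (elim x)
          then have "indicat_real {-1..1} (f j x) = 1" using small(2)[of x] by (auto simp: indicator_def)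
          then show ?case unfolding lk_integrand_def s mult.assoc by simp
        qed
      qed (use mlk j in measurable)
      finally show "(\<integral>w. iexp (c * w j) \<partial>\<mu> (Suc k)) = exp (\<integral>x. iexp (c * f j x) - 1 - \<i> * of_real (c * f j x) \<partial>\<kappa> (Suc k))" .
    qed
    also have "(\<integral>x. (f j x)\<^sup>2 \<partial>\<kappa> (Suc k)) = (\<integral>x. indicator (A (Suc k)) x *\<^sub>R (f j x)\<^sup>2 \<partial>\<nu>)"
      using j by (intro int_\<kappa>) measurable
    also have "\<dots> \<le> tail (m k)" unfolding tail_def by (intro integral_mono i2 itail le)
    also have "\<dots> \<le> ((1/2) ^ k)\<^sup>2" using m[of k] by (simp add: power2_eq_square power_mult_distrib[symmetric])
    finally show "(\<integral>\<^sup>+x. ennreal ((x j)\<^sup>2) \<partial>\<mu> (Suc k)) \<le> ennreal (((1/2) ^ k)\<^sup>2)"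
      by (simp add: ennreal_leI)
  qed simp
  have sums: "(\<lambda>k. \<psi> k a) sums (\<integral>x. lk_integrand f J a x \<partial>\<nu>)" for a
  proof -
    have ilk: "integrable \<nu> (lk_integrand f J a)" by (rule integrable_lk_integrand[OF J lf])
    have iA: "integrable \<nu> (\<lambda>x. indicator (A k) x *\<^sub>R lk_integrand f J a x)" for k
      by (rule integrable_mult_indicator[OF mA ilk])
    have "(\<lambda>n. \<integral>x. indicator (\<Union>k<n. E k) x *\<^sub>R lk_integrand f J a x \<partial>\<nu>) \<longlonglongrightarrow> (\<integral>x. lk_integrand f J a x \<partial>\<nu>)"
    proof (rule integral_dominated_convergence[where w="\<lambda>x. norm (lk_integrand f J a x)"])
      show "AE x in \<nu>. (\<lambda>n. indicator (\<Union>k<n. E k) x *\<^sub>R lk_integrand f J a x) \<longlonglongrightarrow> lk_integrand f J a x"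
      proof (rule AE_I2)
        fix x assume x: "x \<in> space \<nu>"
        show "(\<lambda>n. indicator (\<Union>k<n. E k) x *\<^sub>R lk_integrand f J a x) \<longlonglongrightarrow> lk_integrand f J a x"
        proof (cases "F x = 0")
          case True
          then have "lk_integrand f J a x = 0"
            using norm_lk_integrand_le[OF J, of f a x] by (simp add: F_def[symmetric])
          then show ?thesis by simp
        next
          case False
          then have "0 < F x" using F0[of x] by simp
          then obtain N where N: "1 / F x < real N" using reals_Archimedean2 by blast
          then have "1 / (real N + 2) < F x" using \<open>0 < F x\<close> by (simp add: field_simps)
          then have "x \<in> E N" using x D_mono[of N "m N + N"] by (auto simp: E_def D_def)
          then have "\<forall>\<^sub>F n in sequentially. indicator (\<Union>k<n. E k) x *\<^sub>R lk_integrand f J a x = lk_integrand f J a x"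
            by (intro eventually_sequentiallyI[of "Suc N"]) (auto simp: indicator_def)
          then show ?thesis by (rule tendsto_eventually)
        qed
      qed
    qed (use mlk ilk in \<open>auto simp: indicator_def\<close>)
    moreover have "(\<integral>x. indicator (\<Union>k<n. E k) x *\<^sub>R lk_integrand f J a x \<partial>\<nu>) = (\<Sum>k<n. \<psi> k a)" for n
    proof -
      have "disjoint_family_on A {..<n}"
        using disjoint_family_disjointed[of E] by (auto simp: A_def disjoint_family_on_def)
      then have "indicator (\<Union>k<n. E k) x = (\<Sum>k<n. indicat_real (A k) x)" for x
        using finite_UN_disjointed_eq[of E n]
        by (subst indicator_UN_disjoint[symmetric]) (auto simp: A_def atLeast0LessThan)
      then have "(\<integral>x. indicator (\<Union>k<n. E k) x *\<^sub>R lk_integrand f J a x \<partial>\<nu>)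
          = (\<integral>x. (\<Sum>k<n. indicator (A k) x *\<^sub>R lk_integrand f J a x) \<partial>\<nu>)"
        by (simp add: scaleR_sum_left)
      also have "\<dots> = (\<Sum>k<n. \<psi> k a)"
        unfolding \<psi>_def int_\<kappa>[OF mlk] by (intro Bochner_Integration.integral_sum iA)
      finally show ?thesis .
    qed
    ultimately show ?thesis by (simp add: sums_def)
  qed
  obtain \<rho> where \<rho>: "prob_space \<rho>" "sets \<rho> = sets (Rpow J)"
    "\<And>a. joint_char J \<rho> a = exp (\<integral>x. lk_integrand f J a x \<partial>\<nu>)"
    by (rule independent_series_exists[OF J \<mu> moment sums]) (assumption, rule that, assumption+)
  obtain \<rho>' where "prob_space \<rho>'" "sets \<rho>' = sets (Rpow J)"
    "\<And>a. joint_char J \<rho>' a = joint_char J \<rho> a * exp (\<i> * of_real (\<Sum>j\<in>J. a j * b j))"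
    by (rule joint_char_shift[OF \<rho>(1,2), of b]) (rule that, assumption+)
  then show thesis
    by (intro that[of \<rho>']) (simp_all only: \<rho>(3) lk_exponent_def exp_add)
qed

section \<open>Poissonian processes\<close>

lemma sum_zero_extend:
  fixes g :: "'j \<Rightarrow> 'b::comm_monoid_add"
  assumes "finite H" "J \<subseteq> H" "\<And>j. j \<in> H - J \<Longrightarrow> g j = 0"
  shows "sum g H = sum g J"
  using assms by (intro sum.mono_neutral_right) auto

lemma lk_exponent_zero_extend:
  assumes "finite H" "J \<subseteq> H" "\<And>j. j \<in> H - J \<Longrightarrow> a j = 0"
  shows "lk_exponent \<nu> f H b a = lk_exponent \<nu> f J b a"
proof -
  have e: "(\<Sum>j\<in>H. a j * g j) = (\<Sum>j\<in>J. a j * g j)" for g :: "_ \<Rightarrow> real"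
    using assms(3) by (intro sum_zero_extend[OF assms(1,2)]) auto
  show ?thesis unfolding lk_exponent_def lk_integrand_def mult.assoc e ..
qed

lemma lk_exponent_cong:
  assumes "\<And>j. j \<in> J \<Longrightarrow> a j = a' j"
  shows "lk_exponent \<nu> f J b a = lk_exponent \<nu> f J b a'"
  unfolding lk_exponent_def lk_integrand_def using assms by (simp cong: sum.cong)

text \<open>Kolmogorov's extension theorem. A marginal of a finite-dimensional law arises by setting the
  superfluous frequencies to zero, which does not change the exponent, so consistency follows from
  uniqueness of characteristic functions.\<close>

theorem poissonian_process_exists:
  fixes f :: "'k \<Rightarrow> 'x \<Rightarrow> real"
  assumes lf: "levy_family \<nu> f K"
  obtains N where "prob_space N" "sets N = sets (Rpow K)"
    "\<And>J a. finite J \<Longrightarrow> J \<subseteq> K \<Longrightarrow> (\<integral>\<omega>. exp (\<i> * of_real (\<Sum>j\<in>J. a j * \<omega> j)) \<partial>N) = exp (lk_exponent \<nu> f J b a)"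
proof -
  have "\<forall>J. \<exists>\<mu>. finite J \<and> J \<subseteq> K \<longrightarrow> prob_space \<mu> \<and> sets \<mu> = sets (Rpow J) \<and>
      (\<forall>a. joint_char J \<mu> a = exp (lk_exponent \<nu> f J b a))"
  proof
    fix J
    show "\<exists>\<mu>. finite J \<and> J \<subseteq> K \<longrightarrow> prob_space \<mu> \<and> sets \<mu> = sets (Rpow J) \<and>
      (\<forall>a. joint_char J \<mu> a = exp (lk_exponent \<nu> f J b a))"
    proof (cases "finite J \<and> J \<subseteq> K")
      case True
      obtain \<mu> where "prob_space \<mu>" "sets \<mu> = sets (Rpow J)"
        "\<And>a. joint_char J \<mu> a = exp (lk_exponent \<nu> f J b a)"
        by (rule poissonian_law_exists[of J \<nu> f b]) (use True levy_family_subset[OF lf] in auto)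
      then show ?thesis by blast
    qed auto
  qed
  from choice[OF this] obtain P where P: "\<forall>J. finite J \<and> J \<subseteq> K \<longrightarrow> prob_space (P J) \<and> sets (P J) = sets (Rpow J) \<and>
      (\<forall>a. joint_char J (P J) a = exp (lk_exponent \<nu> f J b a))" ..
  have pP: "prob_space (P J)" and sP: "sets (P J) = sets (Rpow J)"
    and cP: "\<And>a. joint_char J (P J) a = exp (lk_exponent \<nu> f J b a)" if "finite J" "J \<subseteq> K" for J
    using P that by blast+
  interpret polish_projective K P
    unfolding polish_projective_def
  proof (rule projective_family.intro)
    fix J H assume JH: "J \<subseteq> H" "finite H" "H \<subseteq> K"
    then have J: "finite J" "J \<subseteq> K" by (auto intro: finite_subset)
    have m: "(\<lambda>f. restrict f J) \<in> measurable (P H) (Rpow J)"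
      using JH by (subst measurable_cong_sets[OF sP refl]) (auto intro: measurable_restrict_subset)
    show "P J = distr (P H) (Rpow J) (\<lambda>f. restrict f J)"
    proof (rule characteristic_function_unique[OF J(1)])
      show "prob_space (P J)" by (rule pP[OF J])
      show "prob_space (distr (P H) (Rpow J) (\<lambda>f. restrict f J))"
        by (rule prob_space.prob_space_distr[OF pP m]) (use JH in auto)
      show "sets (P J) = sets (Rpow J)" by (rule sP[OF J])
      fix a :: "'k \<Rightarrow> real"
      let ?a = "\<lambda>j. if j \<in> J then a j else 0"
      have "joint_char J (distr (P H) (Rpow J) (\<lambda>f. restrict f J)) a = (\<integral>x. exp (\<i> * of_real (\<Sum>j\<in>J. a j * x j)) \<partial>P H)"
        using joint_char_distr[where J=J and f="\<lambda>j x. x j" and M="P H"] m by (simp add: restrict_def)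
      also have "\<dots> = joint_char H (P H) ?a"
      proof -
        have "(\<Sum>j\<in>H. ?a j * x j) = (\<Sum>j\<in>J. ?a j * x j)" for x :: "'k \<Rightarrow> real"
          by (rule sum_zero_extend[OF JH(2,1)]) auto
        moreover have "(\<Sum>j\<in>J. ?a j * x j) = (\<Sum>j\<in>J. a j * x j)" for x :: "'k \<Rightarrow> real"
          by (rule sum.cong) auto
        ultimately show ?thesis by (simp only:)
      qed
      also have "\<dots> = exp (lk_exponent \<nu> f J b ?a)"
        unfolding cP[OF JH(2,3)] by (intro arg_cong[where f=exp] lk_exponent_zero_extend[OF JH(2,1)]) simp
      also have "lk_exponent \<nu> f J b ?a = lk_exponent \<nu> f J b a" by (rule lk_exponent_cong) simp
      also have "exp \<dots> = joint_char J (P J) a" by (rule cP[OF J, symmetric])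
      finally show "joint_char J (P J) a = joint_char J (distr (P H) (Rpow J) (\<lambda>f. restrict f J)) a" by (rule sym)
    qed simp
  qed (rule pP)
  have marginal: "distr lim (Rpow J) (\<lambda>\<omega>. restrict \<omega> J) = P J" if J: "finite J" "J \<subseteq> K" for J
  proof (rule measure_eqI)
    have m: "(\<lambda>\<omega>. restrict \<omega> J) \<in> measurable lim (Rpow J)"
      using J by (subst measurable_cong_sets[OF sets_lim refl]) (auto intro: measurable_restrict_subset)
    fix A assume "A \<in> sets (distr lim (Rpow J) (\<lambda>\<omega>. restrict \<omega> J))"
    then have A: "A \<in> sets (Rpow J)" by simp
    have "emeasure (distr lim (Rpow J) (\<lambda>\<omega>. restrict \<omega> J)) A = emeasure lim (emb K J A)"
      using m A by (subst emeasure_distr) (auto simp: prod_emb_def space_PiM)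
    then show "emeasure (distr lim (Rpow J) (\<lambda>\<omega>. restrict \<omega> J)) A = emeasure (P J) A"
      using emeasure_lim_emb[OF J(2,1) A] by simp
  qed (simp add: sP J)
  show thesis
  proof (rule that[of lim])
    show "prob_space lim" by (rule P.prob_space_axioms)
    fix J a assume J: "finite J" "J \<subseteq> K"
    have m: "(\<lambda>\<omega>. \<lambda>j\<in>J. \<omega> j) \<in> measurable lim (Rpow J)"
      using J by (subst measurable_cong_sets[OF sets_lim refl]) (auto intro!: measurable_restrict)
    have "exp (lk_exponent \<nu> f J b a) = joint_char J (distr lim (Rpow J) (\<lambda>\<omega>. \<lambda>j\<in>J. \<omega> j)) a"
      using marginal[OF J] cP[OF J] by (simp add: restrict_def)
    also have "\<dots> = (\<integral>\<omega>. exp (\<i> * of_real (\<Sum>j\<in>J. a j * \<omega> j)) \<partial>lim)" by (rule joint_char_distr[OF m])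
    finally show "(\<integral>\<omega>. exp (\<i> * of_real (\<Sum>j\<in>J. a j * \<omega> j)) \<partial>lim) = exp (lk_exponent \<nu> f J b a)" by (rule sym)
  qed simp
qed

text \<open>For finite \<open>I\<close> the zero path is a measurable singleton, and (L2) just says that it has mass 0.
  Removing it from the image of \<open>\<nu>\<close> does not affect the exponent because the integrand vanishes there.\<close>

lemma nonzero_part_levy_measure:
  assumes I: "finite I" and lf: "levy_family \<nu> f I"
  obtains \<kappa> where "levy_measure I \<kappa>" "\<And>b a. levy_exponent I \<kappa> b a = lk_exponent \<nu> f I b a"
proof -
  let ?z = "\<lambda>t\<in>I. 0::real"
  have mf: "(\<lambda>x. \<lambda>j\<in>I. f j x) \<in> measurable \<nu> (Rpow I)"
    using levy_familyD(1)[OF lf] by (intro measurable_restrict)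
  define G where "G = distr \<nu> (Rpow I) (\<lambda>x. \<lambda>j\<in>I. f j x)"
  have sG[measurable_cong]: "sets G = sets (Rpow I)" by (simp add: G_def)
  have "{?z} = Pi\<^sub>E I (\<lambda>_. {0})" by (auto simp: PiE_iff extensional_def restrict_def)
  then have z[measurable]: "{?z} \<in> sets G"
    unfolding sG using I by (simp only:) (intro sets_PiM_I_finite, auto)
  define \<kappa> where "\<kappa> = density G (indicator (- {?z}))"
  have mi[measurable]: "(indicator (- {?z}) :: _ \<Rightarrow> ennreal) \<in> borel_measurable G"
    "(indicator (- {?z}) :: _ \<Rightarrow> real) \<in> borel_measurable G"
    using z by (auto intro!: borel_measurable_indicator' simp: Diff_eq[symmetric] Int_commute intro: sets.Diff)
  have s\<kappa>: "sets \<kappa> = sets (Rpow I)" by (simp add: \<kappa>_def sG)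
  have e\<kappa>: "emeasure \<kappa> A = emeasure \<kappa> (A - {?z})" if "A \<in> sets (Rpow I)" for A
    unfolding \<kappa>_def using that z
    by (subst (1 2) emeasure_density) (auto simp: sG indicator_def intro!: nn_integral_cong)
  show thesis
  proof (rule that[of \<kappa>])
    show "levy_measure I \<kappa>"
      unfolding levy_measure_def
    proof (intro conjI ballI s\<kappa>)
      fix t assume t: "t \<in> I"
      have "(\<integral>\<^sup>+x. ennreal (min (\<bar>x t\<bar>\<^sup>2) 1) \<partial>\<kappa>) \<le> (\<integral>\<^sup>+x. ennreal (min (\<bar>x t\<bar>\<^sup>2) 1) \<partial>G)"
        unfolding \<kappa>_def using t
        by (subst nn_integral_density) (auto intro!: nn_integral_mono simp: indicator_def)
      also have "\<dots> = (\<integral>\<^sup>+x. ennreal (min (\<bar>f t x\<bar>\<^sup>2) 1) \<partial>\<nu>)"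
        unfolding G_def using t by (subst nn_integral_distr[OF mf]) auto
      also have "\<dots> < \<infinity>" using lf t by (auto simp: levy_family_def)
      finally show "(\<integral>\<^sup>+x. ennreal (min (\<bar>x t\<bar>\<^sup>2) 1) \<partial>\<kappa>) < \<infinity>" .
    next
      fix A assume A: "A \<in> sets (Rpow I)"
      have "inner_measure \<kappa> (A - {?z}) = emeasure \<kappa> (A - {?z})"
        unfolding inner_measure_def
      proof (rule antisym)
        show "Sup {emeasure \<kappa> D |D. D \<in> sets \<kappa> \<and> D \<subseteq> A - {?z}} \<le> emeasure \<kappa> (A - {?z})"
          using A z by (auto intro!: Sup_least emeasure_mono simp: s\<kappa> sG)
        show "emeasure \<kappa> (A - {?z}) \<le> Sup {emeasure \<kappa> D |D. D \<in> sets \<kappa> \<and> D \<subseteq> A - {?z}}"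
          using A z by (auto intro!: Sup_upper simp: s\<kappa> sG)
      qed
      then show "emeasure \<kappa> A = inner_measure \<kappa> (A - {?z})" using e\<kappa>[OF A] by simp
    qed
    fix b a
    have m: "lk_integrand (\<lambda>j y. y j) I a \<in> borel_measurable G"
      unfolding lk_integrand_def[abs_def] by measurable
    have "(\<integral>x. lk_integrand (\<lambda>j y. y j) I a x \<partial>\<kappa>) = (\<integral>x. indicator (- {?z}) x *\<^sub>R lk_integrand (\<lambda>j y. y j) I a x \<partial>G)"
      unfolding \<kappa>_def ennreal_indicator[symmetric] using m by (subst integral_density) auto
    also have "\<dots> = (\<integral>x. lk_integrand (\<lambda>j y. y j) I a x \<partial>G)"
      by (intro Bochner_Integration.integral_cong refl) (auto simp: indicator_def lk_integrand_def)
    finally have "levy_exponent I \<kappa> b a = lk_exponent G (\<lambda>j y. y j) I b a"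
      unfolding levy_exponent_eq_lk_exponent by (simp add: lk_exponent_def)
    also have "\<dots> = lk_exponent \<nu> f I b a" unfolding G_def by (rule lk_exponent_distr[OF I lf])
    finally show "levy_exponent I \<kappa> b a = lk_exponent \<nu> f I b a" .
  qed
qed

text \<open>The \<open>n\<close>-th convolution root has jump measure \<open>\<nu> / n\<close> and drift \<open>b / n\<close>.\<close>

theorem poissonian_id_of_exponents:
  fixes X :: "'k \<Rightarrow> 'w \<Rightarrow> real" and f :: "'k \<Rightarrow> 'x \<Rightarrow> real"
  assumes rp: "real_process N K X" and lf: "levy_family \<nu> f K"
    and cf: "\<And>I a. finite I \<Longrightarrow> I \<noteq> {} \<Longrightarrow> I \<subseteq> K \<Longrightarrow>
       (\<integral>\<omega>. exp (\<i> * of_real (\<Sum>j\<in>I. a j * X j \<omega>)) \<partial>N) = exp (lk_exponent \<nu> f I b a)"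
  shows "poissonian_id N K X"
  unfolding poissonian_id_def
proof (intro conjI allI impI rp)
  fix I assume I: "finite I \<and> I \<noteq> {} \<and> I \<subseteq> K"
  then have fI: "finite I" and lfI: "levy_family \<nu> f I" using levy_family_subset[OF lf] by auto
  have pN: "prob_space N" using rp by (simp add: real_process_def)
  have m: "(\<lambda>\<omega>. \<lambda>t\<in>I. X t \<omega>) \<in> measurable N (Rpow I)"
    using rp I by (intro measurable_restrict) (auto simp: real_process_def)
  have p: "prob_space (fdd N X I)" unfolding fdd_def by (rule prob_space.prob_space_distr[OF pN m])
  have s: "sets (fdd N X I) = sets (Rpow I)" by (simp add: fdd_def)
  have c: "joint_char I (fdd N X I) a = exp (lk_exponent \<nu> f I b a)" for a
    unfolding fdd_def joint_char_distr[OF m] using cf I by blast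
  show "no_gaussian_part I (fdd N X I)"
  proof -
    obtain \<kappa> where "levy_measure I \<kappa>" "\<And>b a. levy_exponent I \<kappa> b a = lk_exponent \<nu> f I b a"
      by (rule nonzero_part_levy_measure[OF fI lfI]) (rule that, assumption+)
    then have "levy_khintchine_triplet I (fdd N X I) (\<lambda>_ _. 0) \<kappa> b"
      unfolding levy_khintchine_triplet_def using c by simp
    then show ?thesis unfolding no_gaussian_part_def by blast
  qed
  show "infinitely_divisible I (fdd N X I)"
    unfolding infinitely_divisible_def
  proof (intro conjI p s allI impI)
    fix n :: nat assume n: "1 \<le> n"
    let ?\<nu> = "density \<nu> (\<lambda>_. ennreal (1 / n))"
    obtain \<rho> where \<rho>: "prob_space \<rho>" "sets \<rho> = sets (Rpow I)"
      "\<And>a. joint_char I \<rho> a = exp (lk_exponent ?\<nu> f I (\<lambda>j. 1 / n * b j) a)"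
      by (rule poissonian_law_exists[OF fI levy_family_density_const[OF lfI, of "1 / n"], of "\<lambda>j. 1 / n * b j"])
         (simp, rule that, assumption+)
    have scale: "lk_exponent ?\<nu> f I (\<lambda>j. 1 / n * b j) a = of_real (1 / n) * lk_exponent \<nu> f I b a" for a
      by (rule lk_exponent_density_const[OF fI lfI]) simp
    have prod: "prob_space (PiM {..<n} (\<lambda>_. \<rho>))" by (intro prob_space_PiM \<rho>)
    have ms: "(\<lambda>z. \<lambda>t\<in>I. \<Sum>k<n. z k t) \<in> measurable (PiM {..<n} (\<lambda>_. \<rho>)) (Rpow I)"
    proof (intro measurable_restrict borel_measurable_sum)
      fix t k assume t: "t \<in> I" "k \<in> {..<n}"
      have "(\<lambda>x. x t) \<in> borel_measurable \<rho>" using t by (subst measurable_cong_sets[OF \<rho>(2) refl]) measurable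
      then show "(\<lambda>z. z k t) \<in> borel_measurable (PiM {..<n} (\<lambda>_. \<rho>))"
        using t by (intro measurable_compose[OF measurable_component_singleton[of k]]) auto
    qed
    have "fdd N X I = distr (PiM {..<n} (\<lambda>_. \<rho>)) (Rpow I) (\<lambda>z. \<lambda>t\<in>I. \<Sum>k<n. z k t)"
    proof (rule characteristic_function_unique[OF fI p _ s])
      show "prob_space (distr (PiM {..<n} (\<lambda>_. \<rho>)) (Rpow I) (\<lambda>z. \<lambda>t\<in>I. \<Sum>k<n. z k t))"
        by (rule prob_space.prob_space_distr[OF prod ms])
      fix a
      have "joint_char I (distr (PiM {..<n} (\<lambda>_. \<rho>)) (Rpow I) (\<lambda>z. \<lambda>t\<in>I. \<Sum>k<n. z k t)) a = (\<Prod>k<n. joint_char I \<rho> a)"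
        unfolding joint_char_distr[OF ms] by (rule joint_char_product) (auto simp: \<rho>)
      also have "\<dots> = exp (of_nat n * (of_real (1 / n) * lk_exponent \<nu> f I b a))"
        unfolding \<rho>(3) scale by (simp only: prod_constant card_lessThan exp_of_nat_mult)
      also have "of_nat n * (of_real (1 / n) * lk_exponent \<nu> f I b a) = lk_exponent \<nu> f I b a"
        using n by simp
      finally show "joint_char I (fdd N X I) a = joint_char I (distr (PiM {..<n} (\<lambda>_. \<rho>)) (Rpow I) (\<lambda>z. \<lambda>t\<in>I. \<Sum>k<n. z k t)) a"
        unfolding c by (rule sym)
    qed simp
    then show "\<exists>\<rho>. prob_space \<rho> \<and> sets \<rho> = sets (Rpow I) \<and>
        fdd N X I = distr (PiM {..<n} (\<lambda>_. \<rho>)) (Rpow I) (\<lambda>z. \<lambda>t\<in>I. \<Sum>k<n. z k t)"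
      using \<rho> by blast
  qed
qed

section \<open>Sigma-finiteness of Levy measures\<close>

text \<open>The sets that depend on countably many coordinates form a \<open>\<sigma>\<close>-algebra that contains the
  cylinders.\<close>

lemma product_set_countable_support:
  assumes "D \<in> sets (PiM T M)"
  shows "\<exists>S. countable S \<and> S \<subseteq> T \<and>
    (\<forall>x\<in>space (PiM T M). \<forall>y\<in>space (PiM T M). (\<forall>t\<in>S. x t = y t) \<longrightarrow> (x \<in> D \<longleftrightarrow> y \<in> D))"
  using assms unfolding sets_PiM_single space_PiM[symmetric]
proof (induction rule: sigma_sets.induct)
  case (Basic A)
  then obtain i B where "A = {f \<in> space (PiM T M). f i \<in> B}" "i \<in> T" by blast
  then show ?case by (intro exI[of _ "{i}"]) auto
next
  case Empty then show ?case by (intro exI[of _ "{}"]) auto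
next
  case (Compl A)
  then obtain S where S: "countable S" "S \<subseteq> T"
    "\<forall>x\<in>space (PiM T M). \<forall>y\<in>space (PiM T M). (\<forall>t\<in>S. x t = y t) \<longrightarrow> (x \<in> A \<longleftrightarrow> y \<in> A)" by auto
  show ?case
  proof (intro exI[of _ S] conjI ballI impI)
    fix x y assume "x \<in> space (PiM T M)" "y \<in> space (PiM T M)" "\<forall>t\<in>S. x t = y t"
    then show "x \<in> space (PiM T M) - A \<longleftrightarrow> y \<in> space (PiM T M) - A" using S(3) by blast
  qed (use S in auto)
next
  case (Union A)
  have "\<forall>i. \<exists>S. countable S \<and> S \<subseteq> T \<and>
    (\<forall>x\<in>space (PiM T M). \<forall>y\<in>space (PiM T M). (\<forall>t\<in>S. x t = y t) \<longrightarrow> (x \<in> A i \<longleftrightarrow> y \<in> A i))"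
    using Union.IH by blast
  from choice[OF this] obtain S where "\<forall>i. countable (S i) \<and> S i \<subseteq> T \<and>
    (\<forall>x\<in>space (PiM T M). \<forall>y\<in>space (PiM T M). (\<forall>t\<in>S i. x t = y t) \<longrightarrow> (x \<in> A i \<longleftrightarrow> y \<in> A i))" ..
  then have S: "\<And>i. countable (S i)" "\<And>i. S i \<subseteq> T"
    "\<And>i x y. x \<in> space (PiM T M) \<Longrightarrow> y \<in> space (PiM T M) \<Longrightarrow> (\<forall>t\<in>S i. x t = y t) \<Longrightarrow> x \<in> A i \<longleftrightarrow> y \<in> A i"
    by blast+
  show ?case
  proof (intro exI[of _ "\<Union>i. S i"] conjI ballI impI)
    fix x y assume "x \<in> space (PiM T M)" "y \<in> space (PiM T M)" "\<forall>t\<in>\<Union>i. S i. x t = y t"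
    then have "x \<in> A i \<longleftrightarrow> y \<in> A i" for i by (intro S(3)) auto
    then show "x \<in> \<Union> (range A) \<longleftrightarrow> y \<in> \<Union> (range A)" by blast
  qed (use S(1,2) in auto)
qed

definition vanishing_on :: "'t set \<Rightarrow> 't set \<Rightarrow> ('t \<Rightarrow> real) set" where
  "vanishing_on T S = {x \<in> space (Rpow T). \<forall>t\<in>S. x t = 0}"

lemma vanishing_on_measurable:
  assumes "countable S" "S \<subseteq> T"
  shows "vanishing_on T S \<in> sets (Rpow T)"
proof (cases "S = {}")
  case True then show ?thesis by (simp add: vanishing_on_def)
next
  case False
  have "vanishing_on T S = (\<Inter>t\<in>S. {x \<in> space (Rpow T). x t = 0})"
    using False by (auto simp: vanishing_on_def)
  also have "\<dots> \<in> sets (Rpow T)"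
  proof (rule sets.countable_INT'[OF assms(1) False], safe)
    fix t assume "t \<in> S"
    then have [measurable]: "(\<lambda>x. x t) \<in> borel_measurable (Rpow T)"
      using assms(2) by (intro measurable_component_singleton) auto
    show "{x \<in> space (Rpow T). x t = 0} \<in> sets (Rpow T)" by measurable
  qed
  finally show ?thesis .
qed

lemma levy_measure_large_coordinate:
  assumes L: "levy_measure T \<nu>" and t: "t \<in> T" and e: "0 < e"
  shows "{x \<in> space \<nu>. e \<le> \<bar>x t\<bar>} \<in> sets \<nu>" "emeasure \<nu> {x \<in> space \<nu>. e \<le> \<bar>x t\<bar>} < \<infinity>"
proof -
  have [measurable]: "(\<lambda>x. x t) \<in> borel_measurable \<nu>"
    using levy_familyD(1)[OF levy_family_of_levy_measure[OF L] t] .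
  let ?c = "min (e\<^sup>2) 1"
  have c: "0 < ?c" using e by simp
  show m: "{x \<in> space \<nu>. e \<le> \<bar>x t\<bar>} \<in> sets \<nu>" by measurable
  have "ennreal ?c * emeasure \<nu> {x \<in> space \<nu>. e \<le> \<bar>x t\<bar>} = (\<integral>\<^sup>+x. ennreal ?c * indicator {x \<in> space \<nu>. e \<le> \<bar>x t\<bar>} x \<partial>\<nu>)"
    using m by (simp add: nn_integral_cmult_indicator)
  also have "\<dots> \<le> (\<integral>\<^sup>+x. ennreal (min (\<bar>x t\<bar>\<^sup>2) 1) \<partial>\<nu>)"
  proof (rule nn_integral_mono)
    fix x
    have "e\<^sup>2 \<le> \<bar>x t\<bar>\<^sup>2" if "e \<le> \<bar>x t\<bar>" using that e by (intro power_mono) auto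
    then have "?c \<le> min (\<bar>x t\<bar>\<^sup>2) 1" if "e \<le> \<bar>x t\<bar>" using that by (auto simp: min_def)
    then show "ennreal ?c * indicator {x \<in> space \<nu>. e \<le> \<bar>x t\<bar>} x \<le> ennreal (min (\<bar>x t\<bar>\<^sup>2) 1)"
      by (cases "e \<le> \<bar>x t\<bar>") (auto simp: indicator_def intro: ennreal_leI)
  qed
  also have "\<dots> < \<infinity>" using L t by (simp add: levy_measure_def)
  finally show "emeasure \<nu> {x \<in> space \<nu>. e \<le> \<bar>x t\<bar>} < \<infinity>"
    using c by (auto simp: ennreal_mult_less_top less_top)
qed

text \<open>Let \<open>A i\<close> be sets of finite mass that cover the space. By (L2) the mass of \<open>A i\<close> is attained by a
  countable union \<open>D\<close> of measurable subsets without the zero path. Such a \<open>D\<close> depends on countably many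
  coordinates \<open>S\<close>, so it contains no path that vanishes on \<open>S\<close>, for it would contain the zero path too.
  Hence the paths in \<open>A i\<close> that vanish on \<open>S\<close> lie in the null set \<open>A i - D\<close>; take the union over \<open>i\<close>.
  Conversely, the paths that do not vanish on \<open>S\<close> are covered by the sets \<open>{x. \<bar>x t\<bar> \<ge> 1/n}\<close>, \<open>t \<in> S\<close>.\<close>

theorem levy_measure_sigma_finite_iff:
  assumes L: "levy_measure T \<nu>"
  shows "sigma_finite_measure \<nu> \<longleftrightarrow>
    (\<exists>S. countable S \<and> S \<subseteq> T \<and> emeasure \<nu> (vanishing_on T S) = 0)"
proof
  have s: "sets \<nu> = sets (Rpow T)" using L by (simp add: levy_measure_def)
  have sp: "space \<nu> = space (Rpow T)" using s by (rule sets_eq_imp_space_eq)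
  assume "sigma_finite_measure \<nu>"
  then interpret sigma_finite_measure \<nu> .
  let ?z = "\<lambda>t\<in>T. 0::real"
  obtain A :: "nat \<Rightarrow> _" where A: "range A \<subseteq> sets \<nu>" "(\<Union>i. A i) = space \<nu>" "\<And>i. emeasure \<nu> (A i) \<noteq> \<infinity>"
    by (rule sigma_finite) (rule that, assumption+)
  have "\<exists>S. countable S \<and> S \<subseteq> T \<and> emeasure \<nu> (A i \<inter> vanishing_on T S) = 0" for i
  proof -
    have Ai: "A i \<in> sets \<nu>" using A(1) by auto
    let ?\<D> = "{D. D \<in> sets \<nu> \<and> D \<subseteq> A i - {?z}}"
    have "emeasure \<nu> (A i) = Sup (emeasure \<nu> ` ?\<D>)"
      using L Ai s unfolding levy_measure_def inner_measure_def image_Collect by auto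
    moreover have "\<exists>g::nat \<Rightarrow> ennreal. range g \<subseteq> emeasure \<nu> ` ?\<D> \<and> Sup (emeasure \<nu> ` ?\<D>) = (SUP n. g n)"
    proof -
      have "emeasure \<nu> ` ?\<D> \<noteq> {}" by (auto intro!: exI[of _ "{}"])
      from ennreal_Sup_countable_SUP[OF this] show ?thesis by blast
    qed
    ultimately obtain g where g: "range g \<subseteq> emeasure \<nu> ` ?\<D>" "emeasure \<nu> (A i) = (SUP n::nat. g n)" by auto
    then have "\<forall>n. \<exists>D. D \<in> sets \<nu> \<and> D \<subseteq> A i - {?z} \<and> g n = emeasure \<nu> D" by (auto simp: subset_iff image_iff)
    from choice[OF this] obtain D where D: "\<And>n. D n \<in> sets \<nu>" "\<And>n. D n \<subseteq> A i - {?z}" "\<And>n. g n = emeasure \<nu> (D n)" by metis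
    let ?D = "\<Union>n. D n"
    have mD: "?D \<in> sets \<nu>" using D(1) by auto
    have "emeasure \<nu> (A i) \<le> emeasure \<nu> ?D"
      unfolding g(2) D(3) by (intro SUP_least emeasure_mono mD) auto
    moreover have "emeasure \<nu> (A i - ?D) = emeasure \<nu> (A i) - emeasure \<nu> ?D"
    proof (rule emeasure_Diff)
      have "emeasure \<nu> ?D \<le> emeasure \<nu> (A i)" using D(2) by (intro emeasure_mono Ai) auto
      then show "emeasure \<nu> ?D \<noteq> \<infinity>" using A(3)[of i] by (auto simp: top_unique)
    qed (use Ai mD D(2) in auto)
    ultimately have null: "emeasure \<nu> (A i - ?D) = 0" using A(3)[of i] by (simp add: diff_eq_0_iff_ennreal less_top)
    obtain S where S: "countable S" "S \<subseteq> T"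
      "\<forall>x\<in>space (Rpow T). \<forall>y\<in>space (Rpow T). (\<forall>t\<in>S. x t = y t) \<longrightarrow> (x \<in> ?D \<longleftrightarrow> y \<in> ?D)"
      using product_set_countable_support[of ?D T "\<lambda>_. borel"] mD s by auto
    have "A i \<inter> vanishing_on T S \<subseteq> A i - ?D"
    proof
      fix x assume x: "x \<in> A i \<inter> vanishing_on T S"
      have "?z \<in> space (Rpow T)" by (auto simp: space_PiM)
      moreover have "\<forall>t\<in>S. x t = ?z t" using x S(2) by (auto simp: vanishing_on_def)
      ultimately have "x \<in> ?D \<longleftrightarrow> ?z \<in> ?D" using S(3) x unfolding vanishing_on_def by blast
      then show "x \<in> A i - ?D" using x D(2) by auto
    qed
    then have "emeasure \<nu> (A i \<inter> vanishing_on T S) \<le> 0"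
      using Ai mD unfolding null[symmetric] by (intro emeasure_mono) auto
    then show ?thesis using S by auto
  qed
  then have "\<forall>i. \<exists>S. countable S \<and> S \<subseteq> T \<and> emeasure \<nu> (A i \<inter> vanishing_on T S) = 0" by blast
  from choice[OF this] obtain S where S: "\<And>i. countable (S i)" "\<And>i. S i \<subseteq> T"
    "\<And>i. emeasure \<nu> (A i \<inter> vanishing_on T (S i)) = 0" by metis
  let ?S = "\<Union>i. S i"
  have "vanishing_on T ?S \<subseteq> (\<Union>i. A i \<inter> vanishing_on T (S i))"
    using A(2) sp by (fastforce simp: vanishing_on_def)
  moreover have "(\<Union>i. A i \<inter> vanishing_on T (S i)) \<in> null_sets \<nu>"
    using A(1) S vanishing_on_measurable[OF S(1,2)] by (intro null_sets_UN null_setsI) (auto simp: s)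
  moreover have "vanishing_on T ?S \<in> sets \<nu>"
    unfolding s using S(1,2) by (intro vanishing_on_measurable) auto
  ultimately have "emeasure \<nu> (vanishing_on T ?S) = 0"
    using null_sets_subset by blast
  then show "\<exists>S. countable S \<and> S \<subseteq> T \<and> emeasure \<nu> (vanishing_on T S) = 0"
    using S(1,2) by (intro exI[of _ ?S]) auto
next
  have s: "sets \<nu> = sets (Rpow T)" using L by (simp add: levy_measure_def)
  have sp: "space \<nu> = space (Rpow T)" using s by (rule sets_eq_imp_space_eq)
  assume "\<exists>S. countable S \<and> S \<subseteq> T \<and> emeasure \<nu> (vanishing_on T S) = 0"
  then obtain S where S: "countable S" "S \<subseteq> T" "emeasure \<nu> (vanishing_on T S) = 0" by blast
  let ?B = "\<lambda>(t, n::nat). {x \<in> space \<nu>. 1 / real (Suc n) \<le> \<bar>x t\<bar>}"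
  let ?\<A> = "insert (vanishing_on T S) (?B ` (S \<times> UNIV))"
  have B: "?B (t, n) \<in> sets \<nu>" "emeasure \<nu> (?B (t, n)) < \<infinity>" if "t \<in> S" for t n
    using levy_measure_large_coordinate[OF L, of t "1 / real (Suc n)"] that S(2) by auto
  show "sigma_finite_measure \<nu>"
  proof
    have "space \<nu> \<subseteq> \<Union>?\<A>"
    proof
      fix x assume x: "x \<in> space \<nu>"
      show "x \<in> \<Union>?\<A>"
      proof (cases "\<forall>t\<in>S. x t = 0")
        case True then show ?thesis using x sp by (auto simp: vanishing_on_def)
      next
        case False
        then obtain t where t: "t \<in> S" "x t \<noteq> 0" by blast
        then obtain n where "inverse (real (Suc n)) < \<bar>x t\<bar>" using reals_Archimedean[of "\<bar>x t\<bar>"] by auto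
        then have "x \<in> ?B (t, n)" using x by (simp add: divide_inverse)
        then show ?thesis using t by blast
      qed
    qed
    moreover have "\<Union>?\<A> \<subseteq> space \<nu>" using sp by (auto simp: vanishing_on_def)
    ultimately have "\<Union>?\<A> = space \<nu>" by (rule antisym[rotated])
    moreover have "?\<A> \<subseteq> sets \<nu>"
      using B(1) vanishing_on_measurable[OF S(1,2)] s by blast
    moreover have "emeasure \<nu> a \<noteq> \<infinity>" if "a \<in> ?\<A>" for a
    proof (cases "a = vanishing_on T S")
      case False
      then obtain t n where "a = ?B (t, n)" "t \<in> S" using \<open>a \<in> ?\<A>\<close> by blast
      then show ?thesis using B(2)[of t n] by (simp only: less_top infinity_ennreal_def)
    qed (simp add: S(3))
    moreover have "countable ?\<A>" using S(1) by (intro countable_insert countable_image countable_SIGMA) auto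
    ultimately show "\<exists>A. countable A \<and> A \<subseteq> sets \<nu> \<and> \<Union>A = space \<nu> \<and> (\<forall>a\<in>A. emeasure \<nu> a \<noteq> \<infinity>)"
      by (intro exI[of _ ?\<A>] conjI ballI)
  qed
qed

text \<open>The set of paths that vanish on \<open>S\<close> has positive mass, so by (L2) it has a measurable subset of
  positive mass without the zero path. A path in this subset is nonzero at one of countably many
  coordinates, and one of these must account for positive mass.\<close>

lemma non_sigma_finite_coordinate:
  assumes L: "levy_measure T \<nu>" and n: "\<not> sigma_finite_measure \<nu>" and S: "countable S" "S \<subseteq> T"
  shows "\<exists>t\<in>T - S. emeasure \<nu> {x \<in> vanishing_on T S. x t \<noteq> 0} \<noteq> 0"
proof (rule ccontr)
  assume contra: "\<not> ?thesis"
  have s: "sets \<nu> = sets (Rpow T)" using L by (simp add: levy_measure_def)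
  let ?z = "\<lambda>t\<in>T. 0::real"
  note mv = vanishing_on_measurable[OF S]
  have "emeasure \<nu> (vanishing_on T S) \<noteq> 0" using levy_measure_sigma_finite_iff[OF L] n S by blast
  then have "inner_measure \<nu> (vanishing_on T S - {?z}) \<noteq> 0" using L mv by (auto simp: levy_measure_def)
  then have "\<exists>D. D \<in> sets \<nu> \<and> D \<subseteq> vanishing_on T S - {?z} \<and> emeasure \<nu> D \<noteq> 0"
  proof (rule contrapos_np)
    assume "\<nexists>D. D \<in> sets \<nu> \<and> D \<subseteq> vanishing_on T S - {?z} \<and> emeasure \<nu> D \<noteq> 0"
    then have "inner_measure \<nu> (vanishing_on T S - {?z}) \<le> 0"
      unfolding inner_measure_def by (intro Sup_least) fastforce
    then show "inner_measure \<nu> (vanishing_on T S - {?z}) = 0" by simp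
  qed
  then obtain D where D: "D \<in> sets \<nu>" "D \<subseteq> vanishing_on T S - {?z}" "emeasure \<nu> D \<noteq> 0" by blast
  obtain S' where S': "countable S'" "S' \<subseteq> T"
    "\<forall>x\<in>space (Rpow T). \<forall>y\<in>space (Rpow T). (\<forall>t\<in>S'. x t = y t) \<longrightarrow> (x \<in> D \<longleftrightarrow> y \<in> D)"
    using product_set_countable_support[of D T "\<lambda>_. borel"] D(1) s by auto
  have sub: "D \<subseteq> (\<Union>t\<in>S' - S. {x \<in> vanishing_on T S. x t \<noteq> 0})"
  proof
    fix x assume x: "x \<in> D"
    then have xv: "x \<in> vanishing_on T S" "x \<in> space (Rpow T)" using D(2) by (auto simp: vanishing_on_def)
    have "\<exists>t\<in>S'. x t \<noteq> 0"
    proof (rule ccontr)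
      assume "\<not> ?thesis"
      then have "\<forall>t\<in>S'. x t = ?z t" using S'(2) by auto
      moreover have "?z \<in> space (Rpow T)" by (auto simp: space_PiM)
      ultimately have "?z \<in> D" using S'(3) x xv by blast
      then show False using D(2) by auto
    qed
    then show "x \<in> (\<Union>t\<in>S' - S. {x \<in> vanishing_on T S. x t \<noteq> 0})" using xv by (auto simp: vanishing_on_def)
  qed
  have "(\<Union>t\<in>S' - S. {x \<in> vanishing_on T S. x t \<noteq> 0}) \<in> null_sets \<nu>"
  proof (rule null_sets_UN')
    show "countable (S' - S)" using S'(1) by auto
    fix t assume t: "t \<in> S' - S"
    then have [measurable]: "(\<lambda>x. x t) \<in> borel_measurable (Rpow T)"
      using S'(2) by (intro measurable_component_singleton) auto
    have "{x \<in> vanishing_on T S. x t \<noteq> 0} = vanishing_on T S \<inter> {x \<in> space (Rpow T). x t \<noteq> 0}"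
      by (auto simp: vanishing_on_def)
    also have "\<dots> \<in> sets (Rpow T)" using mv by (rule sets.Int) measurable
    finally show "{x \<in> vanishing_on T S. x t \<noteq> 0} \<in> null_sets \<nu>"
      using contra t S'(2) by (auto simp: null_sets_def s)
  qed
  then have "emeasure \<nu> D = 0" using null_sets_subset[OF _ D(1) sub] by auto
  then show False using D(3) by simp
qed

section \<open>Splitting excludes sigma-finiteness\<close>

text \<open>The frequencies \<open>1/n\<close> suffice: \<open>cos (y / n) = 1\<close> with \<open>\<bar>y\<bar> < n\<close> forces \<open>y = 0\<close>.\<close>

lemma AE_zero_if_cos_integrals_vanish:
  fixes g :: "'x \<Rightarrow> real"
  assumes g[measurable]: "g \<in> borel_measurable \<kappa>"
    and i: "\<And>c. integrable \<kappa> (\<lambda>x. 1 - cos (c * g x))"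
    and z: "\<And>c. (\<integral>x. 1 - cos (c * g x) \<partial>\<kappa>) = 0"
  shows "AE x in \<kappa>. g x = 0"
proof -
  have "AE x in \<kappa>. 1 - cos (1 / real (Suc n) * g x) = 0" for n
    using z[of "1 / real (Suc n)"] by (subst (asm) integral_nonneg_eq_0_iff_AE[OF i]) simp_all
  then have "AE x in \<kappa>. \<forall>n. 1 - cos (1 / real (Suc n) * g x) = 0"
    by (subst AE_all_countable) blast
  then show ?thesis
  proof eventually_elim
    case (elim x)
    obtain n where "\<bar>g x\<bar> < real n" using reals_Archimedean2 by blast
    then have n: "\<bar>g x\<bar> < real (Suc n)" by simp
    let ?u = "\<bar>1 / real (Suc n) * g x\<bar>"
    have u: "?u \<le> 1" using n by (simp add: abs_mult field_simps)
    have "cos ?u = 1" unfolding cos_abs_real using elim[rule_format, of n] by simp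
    moreover have "cos ?u < cos 0" if "0 < ?u"
    proof (rule cos_monotone_0_pi[OF order.refl that])
      show "?u \<le> pi" using u pi_gt3 by linarith
    qed
    ultimately have "\<not> 0 < ?u" by force
    then have "1 / real (Suc n) * g x = 0" unfolding zero_less_abs_iff by blast
    then show ?case by simp
  qed
qed

text \<open>Symmetrisation: the difference of two independent copies of \<open>\<eta>\<close> has characteristic function
  \<open>\<bar>E exp (i c \<eta>)\<bar>\<^sup>2 = 1\<close>, so it is almost surely zero.\<close>

lemma degenerate_if_norm_char_eq_1:
  assumes "prob_space N" and h[measurable]: "\<eta> \<in> borel_measurable N"
    and one: "\<And>c. cmod (\<integral>\<omega>. iexp (c * \<eta> \<omega>) \<partial>N) = 1"
  shows "\<not> nondegenerate N \<eta>"
proof -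
  interpret prob_space N by fact
  interpret P: pair_prob_space N N ..
  let ?g = "\<lambda>p. \<eta> (fst p) - \<eta> (snd p)"
  have i1: "integrable N (\<lambda>\<omega>. iexp (c * \<eta> \<omega>))" for c
    by (rule integrable_const_bound[where B=1]) auto
  have zero: "(\<integral>p. 1 - cos (c * ?g p) \<partial>(N \<Otimes>\<^sub>M N)) = 0" for c
  proof -
    let ?\<phi> = "\<integral>\<omega>. iexp (c * \<eta> \<omega>) \<partial>N"
    have ip: "integrable (N \<Otimes>\<^sub>M N) (\<lambda>p. iexp (c * ?g p))"
      by (rule P.integrable_const_bound[where B=1]) auto
    have e: "iexp (c * (\<eta> x - \<eta> y)) = iexp (c * \<eta> x) * cnj (iexp (c * \<eta> y))" for x y
      by (simp add: exp_cnj exp_add[symmetric] algebra_simps)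
    have "(\<integral>p. iexp (c * ?g p) \<partial>(N \<Otimes>\<^sub>M N)) = (\<integral>x. \<integral>y. iexp (c * (\<eta> x - \<eta> y)) \<partial>N \<partial>N)"
      using P.integral_fst'[OF ip] by simp
    also have "\<dots> = ?\<phi> * cnj ?\<phi>"
      unfolding e using i1 by simp
    also have "\<dots> = 1" using one[of c] by (simp add: complex_norm_square[symmetric])
    finally have "Re (\<integral>p. iexp (c * ?g p) \<partial>(N \<Otimes>\<^sub>M N)) = 1" by simp
    then have "(\<integral>p. cos (c * ?g p) \<partial>(N \<Otimes>\<^sub>M N)) = 1"
      unfolding integral_Re[OF ip, symmetric] by (simp add: Re_exp)
    then show ?thesis
      using integrable_Re[OF ip] by (subst Bochner_Integration.integral_diff) (simp_all add: Re_exp P.prob_space)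
  qed
  have "AE p in N \<Otimes>\<^sub>M N. ?g p = 0"
  proof (rule AE_zero_if_cos_integrals_vanish)
    show "integrable (N \<Otimes>\<^sub>M N) (\<lambda>p. 1 - cos (c * ?g p))" for c
    proof (rule P.integrable_const_bound[where B=2])
      have "\<bar>1 - cos y\<bar> \<le> 2" for y :: real using cos_ge_minus_one[of y] cos_le_one[of y] by linarith
      then show "AE p in N \<Otimes>\<^sub>M N. norm (1 - cos (c * ?g p)) \<le> 2" by simp
    qed measurable
  qed (use zero in auto)
  then have "AE x in N. AE y in N. \<eta> x - \<eta> y = 0"
    using P.AE_pair[of "\<lambda>p. ?g p = 0"] by simp
  then have "\<exists>x. AE y in N. \<eta> x - \<eta> y = 0"
    by (rule contrapos_pp) simp
  then obtain x where "AE y in N. \<eta> x - \<eta> y = 0" ..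
  then have "AE y in N. \<eta> y = \<eta> x" by eventually_elim simp
  then show ?thesis unfolding nondegenerate_def by blast
qed

lemma preimages_compose_subset:
  assumes X: "X \<in> measurable N A" and g: "g \<in> measurable A B"
  shows "{(\<lambda>\<omega>. g (X \<omega>)) -` E \<inter> space N | E. E \<in> sets B} \<subseteq> {X -` E \<inter> space N | E. E \<in> sets A}"
proof safe
  fix E assume "E \<in> sets B"
  then have "g -` E \<inter> space A \<in> sets A" using g by (rule measurable_sets[rotated])
  moreover have "(\<lambda>\<omega>. g (X \<omega>)) -` E \<inter> space N = X -` (g -` E \<inter> space A) \<inter> space N"
    using measurable_space[OF X] by auto
  ultimately show "\<exists>E'. (\<lambda>\<omega>. g (X \<omega>)) -` E \<inter> space N = X -` E' \<inter> space N \<and> E' \<in> sets A" by blast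
qed

lemma independent_of_imp_indep_var:
  assumes "prob_space N" and ind: "independent_of N X A W B"
    and g: "g \<in> measurable A (borel :: real measure)" and h: "h \<in> measurable B (borel :: real measure)"
  shows "prob_space.indep_var N borel (\<lambda>\<omega>. g (X \<omega>)) borel (\<lambda>\<omega>. h (W \<omega>))"
proof -
  interpret prob_space N by fact
  have X: "X \<in> measurable N A" and W: "W \<in> measurable N B"
    and i: "indep_set {X -` E \<inter> space N | E. E \<in> sets A} {W -` E \<inter> space N | E. E \<in> sets B}"
    using ind by (auto simp: independent_of_def)
  note subX = preimages_compose_subset[OF X g] and subW = preimages_compose_subset[OF W h]
  have "indep_set {(\<lambda>\<omega>. g (X \<omega>)) -` E \<inter> space N | E. E \<in> sets (borel :: real measure)}
      {(\<lambda>\<omega>. h (W \<omega>)) -` E \<inter> space N | E. E \<in> sets (borel :: real measure)}"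
  proof (rule indep_setI)
    show "{(\<lambda>\<omega>. g (X \<omega>)) -` E \<inter> space N | E. E \<in> sets (borel :: real measure)} \<subseteq> events"
      using measurable_sets[OF measurable_compose[OF X g]] by auto
    show "{(\<lambda>\<omega>. h (W \<omega>)) -` E \<inter> space N | E. E \<in> sets (borel :: real measure)} \<subseteq> events"
      using measurable_sets[OF measurable_compose[OF W h]] by auto
  qed (rule indep_setD[OF i subsetD[OF subX] subsetD[OF subW]])
  then have "indep_set (sigma_sets (space N) {(\<lambda>\<omega>. g (X \<omega>)) -` E \<inter> space N | E. E \<in> sets (borel :: real measure)})
      (sigma_sets (space N) {(\<lambda>\<omega>. h (W \<omega>)) -` E \<inter> space N | E. E \<in> sets (borel :: real measure)})"
  proof (rule indep_set_sigma_sets)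
    have "Int_stable {f -` E \<inter> space N | E. E \<in> sets (borel :: real measure)}" for f :: "_ \<Rightarrow> real"
    proof (rule Int_stableI, safe)
      fix E E' :: "real set" assume "E \<in> sets borel" "E' \<in> sets borel"
      then show "\<exists>F. f -` E \<inter> space N \<inter> (f -` E' \<inter> space N) = f -` F \<inter> space N \<and> F \<in> sets borel"
        by (intro exI[of _ "E \<inter> E'"]) auto
    qed
    from this[of "\<lambda>\<omega>. g (X \<omega>)"] this[of "\<lambda>\<omega>. h (W \<omega>)"]
    show "Int_stable {(\<lambda>\<omega>. g (X \<omega>)) -` E \<inter> space N | E. E \<in> sets (borel :: real measure)}"
      "Int_stable {(\<lambda>\<omega>. h (W \<omega>)) -` E \<inter> space N | E. E \<in> sets (borel :: real measure)}" .
  qed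
  then show ?thesis
    unfolding indep_var_eq using measurable_compose[OF X g] measurable_compose[OF W h] by simp
qed

text \<open>Averaging over independent standard Gaussian frequencies turns the cosine into a Gaussian weight in
  \<open>x\<close>. Once \<open>g\<close> is scaled by a large factor, this weight concentrates on the common zeros of the \<open>g t\<close>.\<close>

lemma gaussian_average:
  fixes g :: "'j \<Rightarrow> 'x \<Rightarrow> real" and w :: "'x \<Rightarrow> real"
  assumes I: "finite I" and w: "integrable \<kappa> w" and w0: "\<And>x. 0 \<le> w x"
    and g: "\<And>t. t \<in> I \<Longrightarrow> g t \<in> borel_measurable \<kappa>"
  shows "(\<integral>a. (\<integral>x. w x * cos (\<Sum>t\<in>I. a t * g t x) \<partial>\<kappa>) \<partial>PiM I (\<lambda>_. std_normal_distribution))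
       = (\<integral>x. w x * exp (- (\<Sum>t\<in>I. (g t x)\<^sup>2) / 2) \<partial>\<kappa>)" (is "?average")
    and "integrable (PiM I (\<lambda>_. std_normal_distribution)) (\<lambda>a. \<integral>x. w x * cos (\<Sum>t\<in>I. a t * g t x) \<partial>\<kappa>)" (is "?integrable")
proof -
  note [measurable] = g
  have [measurable]: "w \<in> borel_measurable \<kappa>" using w by auto
  let ?\<Gamma> = "PiM I (\<lambda>_. std_normal_distribution)"
  interpret s: prob_space std_normal_distribution using real_dist_normal_dist by (simp add: real_distribution_def)
  interpret \<Gamma>: prob_space ?\<Gamma> by (intro prob_space_PiM s.prob_space_axioms)
  interpret ps: product_sigma_finite "\<lambda>_. std_normal_distribution" by standard
  define D where "D = density \<kappa> (\<lambda>x. ennreal (w x))"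
  have intD: "(\<integral>x. h x \<partial>D) = (\<integral>x. w x * h x \<partial>\<kappa>)" if [measurable]: "h \<in> borel_measurable \<kappa>" for h :: "_ \<Rightarrow> real"
    unfolding D_def using w0 by (subst integral_density) auto
  have [measurable_cong]: "sets D = sets \<kappa>" by (simp add: D_def)
  interpret D: finite_measure D
  proof
    have "emeasure D (space D) = (\<integral>\<^sup>+x. ennreal (w x) \<partial>\<kappa>)"
      unfolding D_def by (subst emeasure_density) (auto intro!: nn_integral_cong)
    also have "\<dots> < \<infinity>" using w w0 by (subst nn_integral_eq_integral) auto
    finally show "emeasure D (space D) \<noteq> \<infinity>" by simp
  qed
  interpret P: pair_sigma_finite D ?\<Gamma> ..
  interpret Pf: finite_measure "D \<Otimes>\<^sub>M ?\<Gamma>" by (rule finite_measure_pair_measure) unfold_locales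
  have [measurable]: "(\<lambda>a. a t) \<in> borel_measurable ?\<Gamma>" if "t \<in> I" for t
    using measurable_component_singleton[OF that, of "\<lambda>_. std_normal_distribution"] by simp
  have gauss: "(\<integral>a. cos (\<Sum>t\<in>I. a t * y t) \<partial>?\<Gamma>) = exp (- (\<Sum>t\<in>I. (y t)\<^sup>2) / 2)" for y
  proof -
    have i: "integrable ?\<Gamma> (\<lambda>a. iexp (\<Sum>t\<in>I. a t * y t))"
      by (rule \<Gamma>.integrable_const_bound[where B=1]) (simp_all del: of_real_sum)
    have "(\<integral>a. iexp (\<Sum>t\<in>I. a t * y t) \<partial>?\<Gamma>) = (\<integral>a. (\<Prod>t\<in>I. iexp (y t * a t)) \<partial>?\<Gamma>)"
      by (simp add: exp_sum[OF I] sum_distrib_left mult.commute mult.left_commute)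
    also have "\<dots> = (\<Prod>t\<in>I. \<integral>u. iexp (y t * u) \<partial>std_normal_distribution)"
    proof (rule ps.product_integral_prod[OF I])
      show "integrable std_normal_distribution (\<lambda>u. iexp (y t * u))" for t
        by (rule s.integrable_const_bound[where B=1]) auto
    qed
    also have "\<dots> = (\<Prod>t\<in>I. of_real (exp (- ((y t)\<^sup>2) / 2)))"
      using char_std_normal_distribution unfolding char_def fun_eq_iff by simp
    also have "\<dots> = of_real (exp (\<Sum>t\<in>I. - ((y t)\<^sup>2) / 2))"
      unfolding exp_sum[OF I] by simp
    also have "(\<Sum>t\<in>I. - ((y t)\<^sup>2) / 2) = - (\<Sum>t\<in>I. (y t)\<^sup>2) / 2"
      by (simp add: sum_negf sum_divide_distrib)
    finally have "Re (\<integral>a. iexp (\<Sum>t\<in>I. a t * y t) \<partial>?\<Gamma>) = exp (- (\<Sum>t\<in>I. (y t)\<^sup>2) / 2)" by simp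
    then show ?thesis unfolding integral_Re[OF i, symmetric] by (simp add: Re_exp del: of_real_sum)
  qed
  have int: "integrable (D \<Otimes>\<^sub>M ?\<Gamma>) (\<lambda>(x, a). cos (\<Sum>t\<in>I. a t * g t x))"
    by (rule Pf.integrable_const_bound[where B=1]) auto
  have swap: "(\<integral>x. w x * cos (\<Sum>t\<in>I. a t * g t x) \<partial>\<kappa>) = (\<integral>x. cos (\<Sum>t\<in>I. a t * g t x) \<partial>D)" for a
    by (subst intD) measurable
  show ?integrable unfolding swap by (rule P.integrable_snd[OF int])
  have "(\<integral>a. (\<integral>x. w x * cos (\<Sum>t\<in>I. a t * g t x) \<partial>\<kappa>) \<partial>?\<Gamma>)
      = (\<integral>x. (\<integral>a. cos (\<Sum>t\<in>I. a t * g t x) \<partial>?\<Gamma>) \<partial>D)"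
    unfolding swap by (rule P.Fubini_integral[OF int])
  also have "\<dots> = (\<integral>x. w x * exp (- (\<Sum>t\<in>I. (g t x)\<^sup>2) / 2) \<partial>\<kappa>)"
    unfolding gauss by (rule intD) measurable
  finally show ?average .
qed

text \<open>A second difference in the frequency attached to \<open>v\<close> turns \<open>1 - cos\<close> of a sum into a Fourier
  integral in \<open>u\<close> with the integrable nonnegative weight \<open>1 - cos v\<close>, to which the Gaussian average
  applies.\<close>

lemma cos_second_difference:
  fixes u v :: "'x \<Rightarrow> real"
  assumes "integrable \<kappa> (\<lambda>x. 1 - cos (u x + v x))" "integrable \<kappa> (\<lambda>x. 1 - cos (u x - v x))"
    "integrable \<kappa> (\<lambda>x. 1 - cos (u x))"
  shows "(\<integral>x. 1 - cos (u x + v x) \<partial>\<kappa>) + (\<integral>x. 1 - cos (u x - v x) \<partial>\<kappa>) - 2 * (\<integral>x. 1 - cos (u x) \<partial>\<kappa>)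
    = 2 * (\<integral>x. (1 - cos (v x)) * cos (u x) \<partial>\<kappa>)"
proof -
  have "2 * (\<integral>x. (1 - cos (v x)) * cos (u x) \<partial>\<kappa>) = (\<integral>x. 2 * ((1 - cos (v x)) * cos (u x)) \<partial>\<kappa>)" by simp
  also have "(\<lambda>x. 2 * ((1 - cos (v x)) * cos (u x))) = (\<lambda>x. (1 - cos (u x + v x)) + (1 - cos (u x - v x)) - 2 * (1 - cos (u x)))"
    by (simp add: fun_eq_iff cos_add cos_diff algebra_simps)
  also have "(\<integral>x. (1 - cos (u x + v x)) + (1 - cos (u x - v x)) - 2 * (1 - cos (u x)) \<partial>\<kappa>) =
    (\<integral>x. 1 - cos (u x + v x) \<partial>\<kappa>) + (\<integral>x. 1 - cos (u x - v x) \<partial>\<kappa>) - 2 * (\<integral>x. 1 - cos (u x) \<partial>\<kappa>)"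
    using Bochner_Integration.integral_diff[OF Bochner_Integration.integrable_add[OF assms(1,2)] integrable_mult_right[OF assms(3), of 2]]
      Bochner_Integration.integral_add[OF assms(1,2)] by (simp only: integral_mult_right_zero)
  finally show ?thesis by (rule sym)
qed

text \<open>The constant \<open>l\<close> survives any averaging over the frequencies \<open>a\<close>, and the averaged integral with
  respect to \<open>\<kappa>'\<close> is nonnegative. In the application \<open>\<kappa>\<close> and \<open>\<kappa>'\<close> are the Levy
  measures of a vector and of the part of it that remains after an independent summand \<open>\<eta>\<close> of its last
  component is taken away, and \<open>l\<close> is the contribution of \<open>\<eta>\<close>.\<close>

lemma smoothed_mass_ge:
  fixes u :: "'j \<Rightarrow> 'x \<Rightarrow> real" and u' :: "'j \<Rightarrow> 'y \<Rightarrow> real"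
  assumes I: "finite I" and w: "integrable \<kappa> w" "\<And>x. 0 \<le> w x" and w': "integrable \<kappa>' w'" "\<And>x. 0 \<le> w' x"
    and u: "\<And>t. t \<in> I \<Longrightarrow> u t \<in> borel_measurable \<kappa>" and u': "\<And>t. t \<in> I \<Longrightarrow> u' t \<in> borel_measurable \<kappa>'"
    and eq: "\<And>a. (\<integral>x. w x * cos (\<Sum>t\<in>I. a t * u t x) \<partial>\<kappa>) = (\<integral>x. w' x * cos (\<Sum>t\<in>I. a t * u' t x) \<partial>\<kappa>') + l"
  shows "l \<le> (\<integral>x. w x * exp (- (\<Sum>t\<in>I. (s * u t x)\<^sup>2) / 2) \<partial>\<kappa>)"
proof -
  let ?\<Gamma> = "PiM I (\<lambda>_. std_normal_distribution)"
  interpret \<Gamma>: prob_space ?\<Gamma>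
    using real_dist_normal_dist by (intro prob_space_PiM) (simp add: real_distribution_def)
  have m: "(\<lambda>x. s * u t x) \<in> borel_measurable \<kappa>" "(\<lambda>x. s * u' t x) \<in> borel_measurable \<kappa>'" if "t \<in> I" for t
    using u[OF that] u'[OF that] by measurable
  have scale: "(\<Sum>t\<in>I. a t * (s * y t)) = (\<Sum>t\<in>I. (s * a t) * y t)" for a y :: "'j \<Rightarrow> real"
    by (simp add: mult.commute mult.left_commute)
  note avg = gaussian_average[OF I w m(1)] and avg' = gaussian_average[OF I w' m(2)]
  have "(\<integral>x. w x * exp (- (\<Sum>t\<in>I. (s * u t x)\<^sup>2) / 2) \<partial>\<kappa>)
      = (\<integral>a. (\<integral>x. w' x * cos (\<Sum>t\<in>I. a t * (s * u' t x)) \<partial>\<kappa>') + l \<partial>?\<Gamma>)"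
    by (subst avg(1)[symmetric]) (simp_all only: scale eq)
  also have "\<dots> = (\<integral>x. w' x * exp (- (\<Sum>t\<in>I. (s * u' t x)\<^sup>2) / 2) \<partial>\<kappa>') + l"
    using avg'(2) by (simp add: avg'(1) \<Gamma>.prob_space)
  also have "\<dots> \<ge> l" using w'(2) by simp
  finally show ?thesis .
qed

text \<open>Take \<open>T0\<close> such that almost no path vanishes on \<open>T0\<close>, and let \<open>r c = \<bar>E exp (i c \<eta>)\<bar>\<close>. For finite
  \<open>I \<subseteq> T0\<close>, \<open>- ln (r c)\<close> is at most the Gaussian-weighted mass of \<open>1 - cos (c * x t1)\<close> near the paths
  that vanish on \<open>I\<close>. Letting \<open>I\<close> and the scale grow together leaves the paths that vanish
  on \<open>T0\<close>, which have no mass. Therefore \<open>r c = 1\<close> for all \<open>c\<close>.\<close>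

theorem splitting_imp_not_sigma_finite:
  fixes Z :: "'t \<Rightarrow> 'v \<Rightarrow> real"
  assumes T: "T \<noteq> {}" and rp: "real_process M T Y" and hl: "has_levy_measure M T Y \<nu>"
    and ver: "is_version T M Y N Z" and split: "splits_off_independent_summand N T Z"
  shows "\<not> sigma_finite_measure \<nu>"
proof
  assume sf: "sigma_finite_measure \<nu>"
  have L: "levy_measure T \<nu>" using hl by (simp add: has_levy_measure_def)
  have s: "sets \<nu> = sets (Rpow T)" using L by (simp add: levy_measure_def)
  have sp: "space \<nu> = space (Rpow T)" using s by (rule sets_eq_imp_space_eq)
  note lf = levy_family_of_levy_measure[OF L]
  obtain t0 where t0: "t0 \<in> T" using T by blast
  obtain S where S: "countable S" "S \<subseteq> T" "emeasure \<nu> (vanishing_on T S) = 0"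
    using levy_measure_sigma_finite_iff[OF L] sf by blast
  define T0 where "T0 = insert t0 S"
  have T0: "T0 \<noteq> {}" "countable T0" "T0 \<subseteq> T" using S t0 by (auto simp: T0_def)
  have null: "vanishing_on T T0 \<in> null_sets \<nu>"
  proof (rule null_sets_subset)
    show "vanishing_on T S \<in> null_sets \<nu>"
      using S vanishing_on_measurable[OF S(1,2)] by (auto simp: s)
    show "vanishing_on T T0 \<in> sets \<nu>" unfolding s by (rule vanishing_on_measurable[OF T0(2,3)])
  qed (auto simp: vanishing_on_def T0_def)
  obtain t1 \<xi> \<eta> where t1: "t1 \<in> T" "t1 \<notin> T0"
    and sum: "AE \<omega> in N. Z t1 \<omega> = \<xi> \<omega> + \<eta> \<omega>"
    and pid: "poissonian_id N (T0 <+> {True, False}) (adjoin2 Z \<xi> \<eta>)"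
    and nd: "nondegenerate N \<eta>"
    and ind: "independent_of N \<eta> borel (\<lambda>\<omega>. \<lambda>j\<in>T0 <+> {True}. adjoin2 Z \<xi> \<eta> j \<omega>) (Rpow (T0 <+> {True}))"
  proof -
    note split[unfolded splits_off_independent_summand_def, rule_format, OF conjI[OF T0(1) conjI[OF T0(2,3)]]]
    then show thesis by (elim bexE exE conjE) (rule that; simp)
  qed
  let ?X = "adjoin2 Z \<xi> \<eta>"
  interpret N: prob_space N using ver by (simp add: is_version_def real_process_def)
  have mX: "?X j \<in> borel_measurable N" if "j \<in> T0 <+> {True, False}" for j
    using pid that by (auto simp: poissonian_id_def real_process_def)
  have mZ: "Z t \<in> borel_measurable N" if "t \<in> T" for t
    using ver that by (auto simp: is_version_def real_process_def)
  have m\<eta>[measurable]: "\<eta> \<in> borel_measurable N" and m\<xi>[measurable]: "\<xi> \<in> borel_measurable N"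
    using mX[of "Inr False"] mX[of "Inr True"] by (auto simp: adjoin2_def)
  define r where "r c = cmod (\<integral>\<omega>. iexp (c * \<eta> \<omega>) \<partial>N)" for c
  have i\<eta>: "integrable N (\<lambda>\<omega>. iexp (c * \<eta> \<omega>))" for c
    by (rule N.integrable_const_bound[where B=1]) auto
  have r1: "r c \<le> 1" for c
    unfolding r_def using integral_norm_bound[of N "\<lambda>\<omega>. iexp (c * \<eta> \<omega>)"] by (simp add: N.prob_space)
  have r_minus: "r (- c) = r c" for c
  proof -
    have "(\<integral>\<omega>. iexp (- c * \<eta> \<omega>) \<partial>N) = cnj (\<integral>\<omega>. iexp (c * \<eta> \<omega>) \<partial>N)"
      using integral_bounded_linear[OF bounded_linear_cnj i\<eta>[of c]] by (simp add: exp_cnj)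
    then show ?thesis by (simp add: r_def)
  qed
  have r0: "r 0 = 1" by (simp add: r_def N.prob_space)

  have key: "0 < r c \<and> - ln (r c) \<le> (\<integral>x. (1 - cos (c * x t1)) * exp (- (\<Sum>t\<in>I. (q * x t)\<^sup>2) / 2) \<partial>\<nu>)"
    if I: "finite I" "I \<subseteq> T0" for I c q
  proof -
    have t1I: "t1 \<notin> I" "insert t1 I \<subseteq> T" using t1 I T0 by auto
    let ?J = "I <+> {True}"
    have J: "finite ?J" "?J \<noteq> {}" "?J \<subseteq> T0 <+> {True, False}" "?J \<subseteq> T0 <+> {True}" using I by auto
    have mJ: "(\<lambda>\<omega>. \<lambda>j\<in>?J. ?X j \<omega>) \<in> measurable N (Rpow ?J)"
      using J(3) by (intro measurable_restrict mX) (rule subsetD)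
    have "no_gaussian_part ?J (fdd N ?X ?J)" using pid J by (simp add: poissonian_id_def)
    then obtain \<nu>' b' where trip: "levy_khintchine_triplet ?J (fdd N ?X ?J) (\<lambda>_ _. 0) \<nu>' b'"
      by (auto simp: no_gaussian_part_def)
    then have lf': "levy_family \<nu>' (\<lambda>j x. x j) ?J"
      by (intro levy_family_of_levy_measure) (simp add: levy_khintchine_triplet_def)
    have cf': "(\<integral>\<omega>. exp (\<i> * of_real (\<Sum>j\<in>?J. a j * ?X j \<omega>)) \<partial>N) = exp (lk_exponent \<nu>' (\<lambda>j x. x j) ?J b' a)" for a
      using trip unfolding levy_khintchine_triplet_def levy_exponent_eq_lk_exponent fdd_def joint_char_distr[OF mJ] by simp
    have sumJ: "(\<Sum>j\<in>?J. case_sum a (\<lambda>_. c) j * y j) = (\<Sum>t\<in>I. a t * y (Inl t)) + c * y (Inr True)"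
      for a c and y :: "'t + bool \<Rightarrow> real"
      using I(1) by (simp add: sum.Plus)
    have sumI: "(\<Sum>t\<in>insert t1 I. (a(t1 := c)) t * y t) = (\<Sum>t\<in>I. a t * y t) + c * y t1"
      for a c and y :: "'t \<Rightarrow> real"
    proof -
      have "(\<Sum>t\<in>I. (a(t1 := c)) t * y t) = (\<Sum>t\<in>I. a t * y t)"
        using t1I by (intro sum.cong) auto
      then show ?thesis using I t1I by (simp add: sum.insert)
    qed
    \<comment> \<open>Up to sign, the logarithms of the absolute values of the characteristic functions of \<open>(Z I, Z t1)\<close> and
      \<open>(Z I, \<xi>)\<close>.\<close>
    define Q where "Q a c = (\<integral>x. 1 - cos ((\<Sum>t\<in>I. a t * x t) + c * x t1) \<partial>\<nu>)" for a c
    define Q' where "Q' a c = (\<integral>x. 1 - cos ((\<Sum>t\<in>I. a t * x (Inl t)) + c * x (Inr True)) \<partial>\<nu>')" for a c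
    have iQ: "integrable \<nu> (\<lambda>x. 1 - cos ((\<Sum>t\<in>I. a t * x t) + c * x t1))" for a c
      using integrable_one_minus_cos[OF _ levy_family_subset[OF lf t1I(2)], of "a(t1 := c)"] I unfolding sumI by simp
    have iQ': "integrable \<nu>' (\<lambda>x. 1 - cos ((\<Sum>t\<in>I. a t * x (Inl t)) + c * x (Inr True)))" for a c
      using integrable_one_minus_cos[OF J(1) lf', of "case_sum a (\<lambda>_. c)"] unfolding sumJ .
    have modulus: "exp (- Q a c) = exp (- Q' a c) * r c" for a c
    proof -
      have mI: "(\<lambda>\<omega>. \<lambda>t\<in>insert t1 I. Z t \<omega>) \<in> measurable N (Rpow (insert t1 I))"
        using mZ t1I by (intro measurable_restrict) auto
      have mIY: "(\<lambda>\<omega>. \<lambda>t\<in>insert t1 I. Y t \<omega>) \<in> measurable M (Rpow (insert t1 I))"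
        using rp t1I by (intro measurable_restrict) (auto simp: real_process_def)
      obtain b where b: "\<forall>I a. finite I \<and> I \<noteq> {} \<and> I \<subseteq> T \<longrightarrow>
        (\<integral>\<omega>. exp (\<i> * of_real (\<Sum>t\<in>I. a t * Y t \<omega>)) \<partial>M) = exp (levy_exponent I \<nu> b a)"
        using hl by (auto simp: has_levy_measure_def)
      have "(\<integral>\<omega>. exp (\<i> * of_real (\<Sum>t\<in>insert t1 I. (a(t1 := c)) t * Z t \<omega>)) \<partial>N)
          = joint_char (insert t1 I) (fdd N Z (insert t1 I)) (a(t1 := c))"
        unfolding fdd_def by (rule joint_char_distr[OF mI, symmetric])
      also have "fdd N Z (insert t1 I) = fdd M Y (insert t1 I)"
        using ver I t1I by (simp add: is_version_def)
      also have "joint_char (insert t1 I) (fdd M Y (insert t1 I)) (a(t1 := c))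
          = (\<integral>\<omega>. exp (\<i> * of_real (\<Sum>t\<in>insert t1 I. (a(t1 := c)) t * Y t \<omega>)) \<partial>M)"
        unfolding fdd_def by (rule joint_char_distr[OF mIY])
      also have "\<dots> = exp (lk_exponent \<nu> (\<lambda>t x. x t) (insert t1 I) b (a(t1 := c)))"
        using b I t1I unfolding levy_exponent_eq_lk_exponent by blast
      finally have "cmod (\<integral>\<omega>. exp (\<i> * of_real ((\<Sum>t\<in>I. a t * Z t \<omega>) + c * Z t1 \<omega>)) \<partial>N) = exp (- Q a c)"
        using norm_exp_lk_exponent[OF _ levy_family_subset[OF lf t1I(2)], of b "a(t1 := c)"] I
        unfolding sumI Q_def by simp
      moreover have "(\<integral>\<omega>. exp (\<i> * of_real ((\<Sum>t\<in>I. a t * Z t \<omega>) + c * Z t1 \<omega>)) \<partial>N)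
         = (\<integral>\<omega>. iexp (c * \<eta> \<omega>) \<partial>N) * (\<integral>\<omega>. exp (\<i> * of_real ((\<Sum>t\<in>I. a t * Z t \<omega>) + c * \<xi> \<omega>)) \<partial>N)"
      proof -
        let ?W = "\<lambda>\<omega>. \<lambda>j\<in>T0 <+> {True}. ?X j \<omega>"
        let ?h = "\<lambda>y. \<Sum>j\<in>?J. case_sum a (\<lambda>_. c) j * y j"
        have hW: "?h (?W \<omega>) = (\<Sum>t\<in>I. a t * Z t \<omega>) + c * \<xi> \<omega>" for \<omega>
          unfolding sumJ using I by (auto simp: adjoin2_def intro!: sum.cong)
        have mh: "?h \<in> borel_measurable (Rpow (T0 <+> {True}))"
          using J(4) by (intro borel_measurable_sum borel_measurable_times measurable_component_singleton) auto
        have "N.indep_var borel (\<lambda>\<omega>. c * \<eta> \<omega>) borel (\<lambda>\<omega>. ?h (?W \<omega>))"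
          by (rule independent_of_imp_indep_var[OF N.prob_space_axioms ind _ mh]) measurable
        then have iv: "N.indep_var borel (\<lambda>\<omega>. c * \<eta> \<omega>) borel (\<lambda>\<omega>. (\<Sum>t\<in>I. a t * Z t \<omega>) + c * \<xi> \<omega>)"
          unfolding hW .
        have mU[measurable]: "(\<lambda>\<omega>. \<Sum>t\<in>I. a t * Z t \<omega>) \<in> borel_measurable N"
          using mZ t1I by (intro borel_measurable_sum borel_measurable_times) auto
        have [measurable]: "Z t1 \<in> borel_measurable N" by (rule mZ[OF t1(1)])
        have c1: "char (distr N borel f) 1 = (\<integral>\<omega>. iexp (f \<omega>) \<partial>N)" if [measurable]: "f \<in> borel_measurable N" for f
          unfolding char_def by (subst integral_distr) auto
        have "(\<integral>\<omega>. exp (\<i> * of_real ((\<Sum>t\<in>I. a t * Z t \<omega>) + c * Z t1 \<omega>)) \<partial>N)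
            = (\<integral>\<omega>. iexp (c * \<eta> \<omega> + ((\<Sum>t\<in>I. a t * Z t \<omega>) + c * \<xi> \<omega>)) \<partial>N)"
        proof (rule integral_cong_AE)
          show "AE \<omega> in N. exp (\<i> * of_real ((\<Sum>t\<in>I. a t * Z t \<omega>) + c * Z t1 \<omega>))
             = iexp (c * \<eta> \<omega> + ((\<Sum>t\<in>I. a t * Z t \<omega>) + c * \<xi> \<omega>))"
            using sum by eventually_elim (simp add: algebra_simps)
        qed measurable
        also have "\<dots> = char (distr N borel (\<lambda>\<omega>. c * \<eta> \<omega> + ((\<Sum>t\<in>I. a t * Z t \<omega>) + c * \<xi> \<omega>))) 1"
          by (rule c1[symmetric]) measurable
        also have "\<dots> = (\<integral>\<omega>. iexp (c * \<eta> \<omega>) \<partial>N) * (\<integral>\<omega>. iexp ((\<Sum>t\<in>I. a t * Z t \<omega>) + c * \<xi> \<omega>) \<partial>N)"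
          unfolding N.char_distr_add[OF iv] by (subst (1 2) c1) measurable
        finally show ?thesis .
      qed
      moreover have "cmod (\<integral>\<omega>. exp (\<i> * of_real ((\<Sum>t\<in>I. a t * Z t \<omega>) + c * \<xi> \<omega>)) \<partial>N) = exp (- Q' a c)"
        using cf'[of "case_sum a (\<lambda>_. c)"] norm_exp_lk_exponent[OF J(1) lf', of b' "case_sum a (\<lambda>_. c)"]
        unfolding sumJ Q'_def by (simp add: adjoin2_def)
      ultimately show ?thesis by (simp only: norm_mult r_def mult.commute)
    qed
    have pos: "0 < r c" for c
      using modulus[of "\<lambda>_. 0" c] exp_gt_zero[of "- Q (\<lambda>_. 0) c"] r_def[of c]
      by (metis norm_ge_zero less_eq_real_def mult_zero_right)
    have QQ': "Q a c = Q' a c - ln (r c)" for a c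
      using arg_cong[OF modulus[of a c], of ln] pos[of c] by (simp add: ln_mult)
    have eq: "(\<integral>x. (1 - cos (c * x t1)) * cos (\<Sum>t\<in>I. a t * x t) \<partial>\<nu>)
        = (\<integral>x. (1 - cos (c * x (Inr True))) * cos (\<Sum>t\<in>I. a t * x (Inl t)) \<partial>\<nu>') + - ln (r c)" for a
    proof -
      have "Q a c + Q a (- c) - 2 * Q a 0 = 2 * (\<integral>x. (1 - cos (c * x t1)) * cos (\<Sum>t\<in>I. a t * x t) \<partial>\<nu>)"
        using cos_second_difference[of \<nu> "\<lambda>x. \<Sum>t\<in>I. a t * x t" "\<lambda>x. c * x t1"] iQ[of a c] iQ[of a "- c"] iQ[of a 0]
        by (simp add: Q_def)
      moreover have "Q' a c + Q' a (- c) - 2 * Q' a 0 = 2 * (\<integral>x. (1 - cos (c * x (Inr True))) * cos (\<Sum>t\<in>I. a t * x (Inl t)) \<partial>\<nu>')"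
        using cos_second_difference[of \<nu>' "\<lambda>x. \<Sum>t\<in>I. a t * x (Inl t)" "\<lambda>x. c * x (Inr True)"] iQ'[of a c] iQ'[of a "- c"] iQ'[of a 0]
        by (simp add: Q'_def)
      ultimately show ?thesis using r_minus[of c] r0 by (simp add: QQ')
    qed
    have "- ln (r c) \<le> (\<integral>x. (1 - cos (c * x t1)) * exp (- (\<Sum>t\<in>I. (q * x t)\<^sup>2) / 2) \<partial>\<nu>)"
    proof (rule smoothed_mass_ge[OF I(1) _ _ _ _ _ _ eq])
      show "integrable \<nu> (\<lambda>x. 1 - cos (c * x t1))" using iQ[of "\<lambda>_. 0" c] by simp
      show "integrable \<nu>' (\<lambda>x. 1 - cos (c * x (Inr True)))" using iQ'[of "\<lambda>_. 0" c] by simp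
      show "(\<lambda>x. x t) \<in> borel_measurable \<nu>" if "t \<in> I" for t
        using levy_familyD(1)[OF lf, of t] that t1I by auto
      show "(\<lambda>x. x (Inl t)) \<in> borel_measurable \<nu>'" if "t \<in> I" for t
        using levy_familyD(1)[OF lf', of "Inl t"] that by auto
    qed simp_all
    then show ?thesis using pos by blast
  qed

  have "r c = 1" for c
  proof -
    let ?w = "\<lambda>x. 1 - cos (c * x t1)"
    \<comment> \<open>The first \<open>n + 1\<close> elements of an enumeration of \<open>T0\<close>; the number \<open>n\<close> also serves as the scale.\<close>
    let ?I = "\<lambda>n. from_nat_into T0 ` {..n}"
    have I: "finite (?I n)" "?I n \<subseteq> T0" for n using from_nat_into[OF T0(1)] by auto
    have [measurable]: "(\<lambda>x. x t) \<in> borel_measurable \<nu>" if "t \<in> T" for t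
      using levy_familyD(1)[OF lf that] .
    have mI: "(\<lambda>x. x t) \<in> borel_measurable \<nu>" if "t \<in> ?I n" for t n
      using levy_familyD(1)[OF lf, of t] I(2) T0(3) that by blast
    have iw: "integrable \<nu> ?w"
      using integrable_one_minus_cos[OF _ levy_family_subset[OF lf], of "{t1}" "\<lambda>_. c"] t1 by simp
    have "(\<lambda>n. \<integral>x. ?w x * exp (- (\<Sum>t\<in>?I n. (real n * x t)\<^sup>2) / 2) \<partial>\<nu>) \<longlonglongrightarrow> (\<integral>x. ?w x * indicator (vanishing_on T T0) x \<partial>\<nu>)"
    proof (rule integral_dominated_convergence[OF _ _ iw])
      show "AE x in \<nu>. (\<lambda>n. ?w x * exp (- (\<Sum>t\<in>?I n. (real n * x t)\<^sup>2) / 2)) \<longlonglongrightarrow> ?w x * indicator (vanishing_on T T0) x"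
      proof (rule AE_I2)
        fix x assume x: "x \<in> space \<nu>"
        show "(\<lambda>n. ?w x * exp (- (\<Sum>t\<in>?I n. (real n * x t)\<^sup>2) / 2)) \<longlonglongrightarrow> ?w x * indicator (vanishing_on T T0) x"
        proof (cases "x \<in> vanishing_on T T0")
          case True
          then have "x t = 0" if "t \<in> ?I n" for t n using that I(2)[of n] by (auto simp: vanishing_on_def)
          then have "(\<Sum>t\<in>?I n. (real n * x t)\<^sup>2) = 0" for n by (intro sum.neutral) auto
          then show ?thesis using True by simp
        next
          case False
          then obtain t where t: "t \<in> T0" "x t \<noteq> 0" using x sp by (auto simp: vanishing_on_def)
          obtain k where k: "from_nat_into T0 k = t" using from_nat_into_surj[OF T0(2) t(1)] by blast
          have "(\<lambda>n. exp (- (\<Sum>t\<in>?I n. (real n * x t)\<^sup>2) / 2)) \<longlonglongrightarrow> 0"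
          proof (rule tendsto_sandwich)
            show "\<forall>\<^sub>F n in sequentially. 0 \<le> exp (- (\<Sum>t\<in>?I n. (real n * x t)\<^sup>2) / 2)" by simp
            show "\<forall>\<^sub>F n in sequentially. exp (- (\<Sum>t\<in>?I n. (real n * x t)\<^sup>2) / 2) \<le> exp (- (real n * \<bar>x t\<bar>)\<^sup>2 / 2)"
            proof (intro eventually_sequentiallyI[of k])
              fix n assume "k \<le> n"
              then have "t \<in> ?I n" using k by auto
              then have "(real n * x t)\<^sup>2 \<le> (\<Sum>t\<in>?I n. (real n * x t)\<^sup>2)" by (intro member_le_sum) auto
              then show "exp (- (\<Sum>t\<in>?I n. (real n * x t)\<^sup>2) / 2) \<le> exp (- (real n * \<bar>x t\<bar>)\<^sup>2 / 2)"
                by (simp add: power_mult_distrib)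
            qed
            have "0 < \<bar>x t\<bar>" using t by simp
            then show "(\<lambda>n. exp (- (real n * \<bar>x t\<bar>)\<^sup>2 / 2)) \<longlonglongrightarrow> 0" by real_asymp
          qed simp
          then have "(\<lambda>n. ?w x * exp (- (\<Sum>t\<in>?I n. (real n * x t)\<^sup>2) / 2)) \<longlonglongrightarrow> ?w x * 0"
            by (intro tendsto_mult tendsto_const)
          then show ?thesis using False by simp
        qed
      qed
      show "AE x in \<nu>. norm (?w x * exp (- (\<Sum>t\<in>?I n. (real n * x t)\<^sup>2) / 2)) \<le> ?w x" for n
      proof (rule AE_I2)
        fix x
        have "exp (- (\<Sum>t\<in>?I n. (real n * x t)\<^sup>2) / 2) \<le> 1" by (simp add: sum_nonneg)
        then have "?w x * exp (- (\<Sum>t\<in>?I n. (real n * x t)\<^sup>2) / 2) \<le> ?w x * 1" by (intro mult_left_mono) auto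
        then show "norm (?w x * exp (- (\<Sum>t\<in>?I n. (real n * x t)\<^sup>2) / 2)) \<le> ?w x" by simp
      qed
      have mv: "vanishing_on T T0 \<in> sets \<nu>" using null by blast
      show "(\<lambda>x. ?w x * indicator (vanishing_on T T0) x) \<in> borel_measurable \<nu>"
        using mv t1(1) by measurable
      show "(\<lambda>x. ?w x * exp (- (\<Sum>t\<in>?I n. (real n * x t)\<^sup>2) / 2)) \<in> borel_measurable \<nu>" for n
      proof -
        have [measurable]: "(\<lambda>x. \<Sum>t\<in>?I n. (real n * x t)\<^sup>2) \<in> borel_measurable \<nu>"
          using mI by (intro borel_measurable_sum borel_measurable_power borel_measurable_times) auto
        show ?thesis using t1(1) by measurable
      qed
    qed
    moreover have "(\<integral>x. ?w x * indicator (vanishing_on T T0) x \<partial>\<nu>) = 0"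
    proof (rule integral_eq_zero_AE)
      show "AE x in \<nu>. ?w x * indicator (vanishing_on T T0) x = 0"
        using AE_not_in[OF null] by eventually_elim (simp add: indicator_def)
    qed
    ultimately have "(\<lambda>n. \<integral>x. ?w x * exp (- (\<Sum>t\<in>?I n. (real n * x t)\<^sup>2) / 2) \<partial>\<nu>) \<longlonglongrightarrow> 0" by simp
    then have "- ln (r c) \<le> 0"
    proof (rule LIMSEQ_le_const)
      have "- ln (r c) \<le> (\<integral>x. ?w x * exp (- (\<Sum>t\<in>?I n. (real n * x t)\<^sup>2) / 2) \<partial>\<nu>)" for n
        using key[OF I[of n], of c "real n"] by (rule conjunct2)
      then show "\<exists>n0. \<forall>n\<ge>n0. - ln (r c) \<le> (\<integral>x. ?w x * exp (- (\<Sum>t\<in>?I n. (real n * x t)\<^sup>2) / 2) \<partial>\<nu>)"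
        by (intro exI allI impI)
    qed
    moreover have "0 < r c" using key[OF I[of 0], of c 0] by (rule conjunct1)
    ultimately show "r c = 1" using r1[of c] by (intro antisym) (simp_all add: ln_ge_zero_iff)
  qed
  then have "\<not> nondegenerate N \<eta>"
    unfolding r_def by (intro degenerate_if_norm_char_eq_1 N.prob_space_axioms m\<eta>)
  then show False using nd by simp
qed

section \<open>Constructing the splitting version\<close>

text \<open>The factorisation says that \<open>(\<eta>, X)\<close> has the same finite-dimensional characteristic functions as
  \<open>\<eta>\<close> and \<open>X\<close> taken from the two factors of \<open>N \<Otimes>\<^sub>M N\<close>. Both are families indexed by \<open>'j option\<close>,
  with \<open>None\<close> for \<open>\<eta>\<close>, and their laws on the infinite product agree.\<close>

lemma independent_of_if_characters_factorise:
  fixes \<eta> :: "'w \<Rightarrow> real" and X :: "'j \<Rightarrow> 'w \<Rightarrow> real"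
  assumes pN: "prob_space N" and \<eta>[measurable]: "\<eta> \<in> borel_measurable N"
    and X: "\<And>j. j \<in> K \<Longrightarrow> X j \<in> borel_measurable N"
    and factor: "\<And>I a c. finite I \<Longrightarrow> I \<subseteq> K \<Longrightarrow>
      (\<integral>\<omega>. exp (\<i> * of_real (c * \<eta> \<omega> + (\<Sum>j\<in>I. a j * X j \<omega>))) \<partial>N)
        = (\<integral>\<omega>. iexp (c * \<eta> \<omega>) \<partial>N) * (\<integral>\<omega>. exp (\<i> * of_real (\<Sum>j\<in>I. a j * X j \<omega>)) \<partial>N)"
  shows "independent_of N \<eta> borel (\<lambda>\<omega>. \<lambda>j\<in>K. X j \<omega>) (Rpow K)"
proof -
  interpret prob_space N by fact
  interpret P: pair_prob_space N N ..
  let ?W = "\<lambda>\<omega>. \<lambda>j\<in>K. X j \<omega>"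
  have W[measurable]: "?W \<in> measurable N (Rpow K)" using X by (intro measurable_restrict)
  define K' where "K' = insert None (Some ` K)"
  define V where "V k = case_option \<eta> X k" for k
  define U where "U k p = (case k of None \<Rightarrow> \<eta> (fst p) | Some j \<Rightarrow> X j (snd p))" for k p
  have mV: "V k \<in> borel_measurable N" if "k \<in> K'" for k
    using that X by (auto simp: K'_def V_def)
  have mU: "U k \<in> borel_measurable (N \<Otimes>\<^sub>M N)" if "k \<in> K'" for k
  proof (cases k)
    case None
    have "(\<lambda>p. \<eta> (fst p)) \<in> borel_measurable (N \<Otimes>\<^sub>M N)" by measurable
    then show ?thesis using None by (simp add: U_def[abs_def])
  next
    case (Some j)
    then have [measurable]: "X j \<in> borel_measurable N" using that X by (auto simp: K'_def)
    have "(\<lambda>p. X j (snd p)) \<in> borel_measurable (N \<Otimes>\<^sub>M N)" by measurable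
    then show ?thesis using Some by (simp add: U_def[abs_def])
  qed
  have mVJ: "(\<lambda>\<omega>. \<lambda>k\<in>J. V k \<omega>) \<in> measurable N (Rpow J)"
    and mUJ: "(\<lambda>p. \<lambda>k\<in>J. U k p) \<in> measurable (N \<Otimes>\<^sub>M N) (Rpow J)" if "J \<subseteq> K'" for J
    using mV mU that by (intro measurable_restrict; blast)+
  define PV where "PV J = distr N (Rpow J) (\<lambda>\<omega>. \<lambda>k\<in>J. V k \<omega>)" for J
  define PU where "PU J = distr (N \<Otimes>\<^sub>M N) (Rpow J) (\<lambda>p. \<lambda>k\<in>J. U k p)" for J
  have finite_eq: "PV J = PU J" if J: "finite J" "J \<subseteq> K'" for J
  proof (rule characteristic_function_unique[OF J(1)])
    show "prob_space (PV J)" unfolding PV_def by (rule prob_space_distr[OF mVJ[OF J(2)]])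
    show "prob_space (PU J)" unfolding PU_def by (rule P.prob_space_distr[OF mUJ[OF J(2)]])
    fix a :: "'j option \<Rightarrow> real"
    let ?I = "{j. Some j \<in> J}" and ?c = "if None \<in> J then a None else 0"
    have I: "finite ?I" "?I \<subseteq> K"
      using J finite_vimageI[OF J(1), of Some] by (auto simp: K'_def vimage_def)
    have sumJ: "(\<Sum>k\<in>J. a k * y k) = ?c * y None + (\<Sum>j\<in>?I. a (Some j) * y (Some j))" for y :: "_ \<Rightarrow> real"
    proof -
      have JI: "J - {None} = Some ` ?I"
      proof (rule set_eqI)
        show "k \<in> J - {None} \<longleftrightarrow> k \<in> Some ` ?I" for k by (cases k) auto
      qed
      have "(\<Sum>k\<in>J - {None}. a k * y k) = (\<Sum>j\<in>?I. a (Some j) * y (Some j))"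
        unfolding JI by (subst sum.reindex) auto
      then show ?thesis
        using J(1) by (cases "None \<in> J") (auto simp: sum.remove[of J None])
    qed
    have [measurable]: "(\<lambda>\<omega>. \<Sum>j\<in>?I. a (Some j) * X j \<omega>) \<in> borel_measurable N"
      using X I by (intro borel_measurable_sum borel_measurable_times) auto
    have "joint_char J (PV J) a = (\<integral>\<omega>. exp (\<i> * of_real (?c * \<eta> \<omega> + (\<Sum>j\<in>?I. a (Some j) * X j \<omega>))) \<partial>N)"
      unfolding PV_def by (subst joint_char_distr[OF mVJ[OF J(2)]]) (simp only: sumJ V_def option.case)
    also have "\<dots> = (\<integral>\<omega>. iexp (?c * \<eta> \<omega>) \<partial>N) * (\<integral>\<omega>. exp (\<i> * of_real (\<Sum>j\<in>?I. a (Some j) * X j \<omega>)) \<partial>N)"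
      by (rule factor[OF I])
    also have "\<dots> = (\<integral>x. \<integral>y. iexp (?c * \<eta> x) * exp (\<i> * of_real (\<Sum>j\<in>?I. a (Some j) * X j y)) \<partial>N \<partial>N)"
      by (simp only: integral_mult_right_zero integral_mult_left_zero)
    also have "\<dots> = (\<integral>p. iexp (?c * \<eta> (fst p)) * exp (\<i> * of_real (\<Sum>j\<in>?I. a (Some j) * X j (snd p))) \<partial>(N \<Otimes>\<^sub>M N))"
    proof (subst P.integral_fst'[symmetric])
      show "integrable (N \<Otimes>\<^sub>M N) (\<lambda>p. iexp (?c * \<eta> (fst p)) * exp (\<i> * of_real (\<Sum>j\<in>?I. a (Some j) * X j (snd p))))"
        by (rule P.integrable_const_bound[where B=1]) (simp_all add: norm_mult del: of_real_sum)
    qed (simp only: fst_conv snd_conv)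
    also have "\<dots> = joint_char J (PU J) a"
      unfolding PU_def
      by (subst joint_char_distr[OF mUJ[OF J(2)]]) (simp only: sumJ U_def option.case of_real_add distrib_left exp_add)
    finally show "joint_char J (PV J) a = joint_char J (PU J) a" .
  qed (simp_all add: PV_def PU_def)
  have laws_eq: "PV K' = PU K'"
  proof (rule measure_eqI_PiM_infinite)
    show "finite_measure (PV K')"
      using prob_space_distr[OF mVJ[of K']] unfolding PV_def by (simp add: prob_space.finite_measure)
    fix A J assume J: "finite J" "J \<subseteq> K'" and A: "\<And>i. i \<in> J \<Longrightarrow> A i \<in> sets (borel :: real measure)"
    have mA: "Pi\<^sub>E J A \<in> sets (Rpow J)" using J A by (intro sets_PiM_I_finite) auto
    then have mE: "prod_emb K' (\<lambda>_. borel) J (Pi\<^sub>E J A) \<in> sets (Rpow K')" using J by (intro measurable_prod_emb) auto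
    have "emeasure (PV K') (prod_emb K' (\<lambda>_. borel) J (Pi\<^sub>E J A)) = emeasure (PV J) (Pi\<^sub>E J A)"
      unfolding PV_def using J mA mE mVJ[of K'] mVJ[OF J(2)]
      by (subst (1 2) emeasure_distr) (auto simp: prod_emb_def restrict_restrict Int_absorb1 intro!: arg_cong[where f="emeasure N"])
    moreover have "emeasure (PU K') (prod_emb K' (\<lambda>_. borel) J (Pi\<^sub>E J A)) = emeasure (PU J) (Pi\<^sub>E J A)"
      unfolding PU_def using J mA mE mUJ[of K'] mUJ[OF J(2)]
      by (subst (1 2) emeasure_distr) (auto simp: prod_emb_def restrict_restrict Int_absorb1 intro!: arg_cong[where f="emeasure (N \<Otimes>\<^sub>M N)"])
    ultimately show "emeasure (PV K') (prod_emb K' (\<lambda>_. borel) J (Pi\<^sub>E J A)) = emeasure (PU K') (prod_emb K' (\<lambda>_. borel) J (Pi\<^sub>E J A))"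
      using finite_eq[OF J] by simp
  qed (simp_all add: PV_def PU_def)
  have product: "prob ((\<eta> -` E \<inter> space N) \<inter> (?W -` F \<inter> space N)) = prob (\<eta> -` E \<inter> space N) * prob (?W -` F \<inter> space N)"
    if E[measurable]: "E \<in> sets borel" and F[measurable]: "F \<in> sets (Rpow K)" for E F
  proof -
    let ?G = "{y \<in> space (Rpow K'). y None \<in> E \<and> (\<lambda>j\<in>K. y (Some j)) \<in> F}"
    have [measurable]: "(\<lambda>y. y None) \<in> borel_measurable (Rpow K')"
      by (intro measurable_component_singleton) (simp add: K'_def)
    have [measurable]: "(\<lambda>y. \<lambda>j\<in>K. y (Some j)) \<in> measurable (Rpow K') (Rpow K)"
      by (intro measurable_restrict measurable_component_singleton) (simp add: K'_def)
    have G: "?G \<in> sets (Rpow K')" by measurable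
    have "emeasure N ((\<eta> -` E \<inter> space N) \<inter> (?W -` F \<inter> space N)) = emeasure (PV K') ?G"
    proof -
      have "(\<lambda>j\<in>K. restrict (\<lambda>k. V k \<omega>) K' (Some j)) = ?W \<omega>" for \<omega>
        by (auto simp: K'_def V_def restrict_def)
      then show ?thesis
        unfolding PV_def using G mVJ[of K']
        by (subst emeasure_distr) (auto simp: space_PiM K'_def[symmetric] V_def intro!: arg_cong[where f="emeasure N"], auto simp: K'_def V_def)
    qed
    also have "\<dots> = emeasure (PU K') ?G" by (simp only: laws_eq)
    also have "\<dots> = emeasure (N \<Otimes>\<^sub>M N) ((\<eta> -` E \<inter> space N) \<times> (?W -` F \<inter> space N))"
    proof -
      have "(\<lambda>j\<in>K. restrict (\<lambda>k. U k p) K' (Some j)) = ?W (snd p)" for p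
        by (auto simp: K'_def U_def restrict_def)
      moreover have "restrict (\<lambda>k. U k p) K' None = \<eta> (fst p)" for p by (simp add: K'_def U_def)
      ultimately have "(\<lambda>p. \<lambda>k\<in>K'. U k p) -` ?G \<inter> space (N \<Otimes>\<^sub>M N) = (\<eta> -` E \<inter> space N) \<times> (?W -` F \<inter> space N)"
        by (auto simp: space_PiM space_pair_measure)
      then show ?thesis unfolding PU_def using G mUJ[of K'] by (subst emeasure_distr) auto
    qed
    also have "\<dots> = emeasure N (\<eta> -` E \<inter> space N) * emeasure N (?W -` F \<inter> space N)"
      by (rule emeasure_pair_measure_Times) measurable
    finally show ?thesis
      by (simp add: emeasure_eq_measure ennreal_mult[symmetric])
  qed
  show ?thesis
    unfolding independent_of_def
  proof (intro conjI \<eta> W indep_setI)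
    show "{\<eta> -` E \<inter> space N |E. E \<in> sets borel} \<subseteq> events" using measurable_sets[OF \<eta>] by auto
    show "{?W -` E \<inter> space N |E. E \<in> sets (Rpow K)} \<subseteq> events" using measurable_sets[OF W] by auto
  qed (use product in auto)
qed

lemma indep_set_commute:
  assumes "prob_space N" "prob_space.indep_set N A B"
  shows "prob_space.indep_set N B A"
proof -
  interpret prob_space N by fact
  show ?thesis using assms(2) unfolding indep_sets2_eq by (metis Int_commute mult.commute)
qed

text \<open>The index \<open>Inl t\<close> carries the path at \<open>t\<close>, and the index \<open>Inr S\<close>, for countable \<open>S \<subseteq> T\<close>, carries the jumps at
  the coordinate \<open>pick S\<close> along the paths that do not vanish on \<open>S\<close>; all other indices carry no jumps. In
  the resulting process \<open>Z t\<close> is the coordinate at \<open>Inl t\<close>, and for given \<open>T0\<close> the variable \<open>\<xi>\<close> is the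
  coordinate at \<open>Inr T0\<close> and \<open>\<eta>\<close> is \<open>Z (pick T0) - \<xi>\<close>.\<close>

theorem not_sigma_finite_imp_splitting_version:
  fixes T :: "'t set" and Y :: "'t \<Rightarrow> 'w \<Rightarrow> real"
  assumes rp: "real_process M T Y" and hl: "has_levy_measure M T Y \<nu>" and nsf: "\<not> sigma_finite_measure \<nu>"
  shows "uncountable T"
    and "\<exists>(N :: 't version_space measure) Z. is_version T M Y N Z \<and> splits_off_independent_summand N T Z"
proof -
  have L: "levy_measure T \<nu>" using hl by (simp add: has_levy_measure_def)
  have s: "sets \<nu> = sets (Rpow T)" using L by (simp add: levy_measure_def)
  have sp: "space \<nu> = space (Rpow T)" using s by (rule sets_eq_imp_space_eq)
  note lf = levy_family_of_levy_measure[OF L]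
  have mt[measurable]: "(\<lambda>x. x t) \<in> borel_measurable \<nu>" if "t \<in> T" for t using levy_familyD(1)[OF lf that] .
  note coord = non_sigma_finite_coordinate[OF L nsf]
  show unc: "uncountable T" using coord[of T] by auto
  obtain b where b: "\<forall>I a. finite I \<and> I \<noteq> {} \<and> I \<subseteq> T \<longrightarrow>
      (\<integral>\<omega>. exp (\<i> * of_real (\<Sum>t\<in>I. a t * Y t \<omega>)) \<partial>M) = exp (levy_exponent I \<nu> b a)"
    using hl by (auto simp: has_levy_measure_def)

  define pick where "pick S = (SOME t. t \<in> T - S \<and> emeasure \<nu> {x \<in> vanishing_on T S. x t \<noteq> 0} \<noteq> 0)" for S
  have pick: "pick S \<in> T" "pick S \<notin> S" "emeasure \<nu> {x \<in> vanishing_on T S. x (pick S) \<noteq> 0} \<noteq> 0"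
    if "countable S" "S \<subseteq> T" for S
  proof -
    have "\<exists>t. t \<in> T - S \<and> emeasure \<nu> {x \<in> vanishing_on T S. x t \<noteq> 0} \<noteq> 0" using coord[OF that] by blast
    from someI_ex[OF this] show "pick S \<in> T" "pick S \<notin> S" "emeasure \<nu> {x \<in> vanishing_on T S. x (pick S) \<noteq> 0} \<noteq> 0"
      unfolding pick_def by auto
  qed
  define f :: "'t + 't set \<Rightarrow> ('t \<Rightarrow> real) \<Rightarrow> real" where
    "f k x = (case k of Inl t \<Rightarrow> if t \<in> T then x t else 0
       | Inr S \<Rightarrow> if countable S \<and> S \<subseteq> T then x (pick S) * indicator (- vanishing_on T S) x else 0)" for k x
  define b' :: "'t + 't set \<Rightarrow> real" where "b' = case_sum b (\<lambda>_. 0)"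
  have mvan: "vanishing_on T S \<in> sets \<nu>" if "countable S" "S \<subseteq> T" for S
    unfolding s by (rule vanishing_on_measurable[OF that])
  have lff: "levy_family \<nu> f UNIV"
    unfolding levy_family_def
  proof
    fix k
    have dom: "f k \<in> borel_measurable \<nu> \<and> (f k = (\<lambda>_. 0) \<or> (\<exists>t\<in>T. \<forall>x. \<bar>f k x\<bar> \<le> \<bar>x t\<bar>))"
    proof (cases k)
      case (Inl t)
      then have "f k = (if t \<in> T then (\<lambda>x. x t) else (\<lambda>_. 0))" by (auto simp: f_def fun_eq_iff)
      then show ?thesis by (auto intro: mt)
    next
      case (Inr S)
      show ?thesis
      proof (cases "countable S \<and> S \<subseteq> T")
        case True
        then have e: "f k = (\<lambda>x. x (pick S) * (1 - indicat_real (vanishing_on T S) x))"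
          using Inr by (auto simp: f_def fun_eq_iff indicator_def)
        have [measurable]: "vanishing_on T S \<in> sets \<nu>" "pick S \<in> T" using True mvan pick by auto
        have "f k \<in> borel_measurable \<nu>" unfolding e by measurable
        moreover have "\<bar>f k x\<bar> \<le> \<bar>x (pick S)\<bar>" for x unfolding e by (simp add: indicator_def)
        ultimately show ?thesis using pick[of S] True by blast
      next
        case False
        then have "f k = (\<lambda>_. 0)" using Inr by (auto simp: f_def fun_eq_iff)
        then show ?thesis by simp
      qed
    qed
    moreover have "(\<integral>\<^sup>+x. ennreal (min (\<bar>f k x\<bar>\<^sup>2) 1) \<partial>\<nu>) < \<infinity>"
    proof (cases "f k = (\<lambda>_. 0)")
      case False
      then obtain t where t: "t \<in> T" "\<And>x. \<bar>f k x\<bar> \<le> \<bar>x t\<bar>" using dom by blast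
      have "(\<integral>\<^sup>+x. ennreal (min (\<bar>f k x\<bar>\<^sup>2) 1) \<partial>\<nu>) \<le> (\<integral>\<^sup>+x. ennreal (min (\<bar>x t\<bar>\<^sup>2) 1) \<partial>\<nu>)"
        by (intro nn_integral_mono ennreal_leI min.mono power_mono t(2)) auto
      also have "\<dots> < \<infinity>" using L t(1) by (simp add: levy_measure_def)
      finally show ?thesis .
    qed simp
    ultimately show "f k \<in> borel_measurable \<nu> \<and> (\<integral>\<^sup>+x. ennreal (min (\<bar>f k x\<bar>\<^sup>2) 1) \<partial>\<nu>) < \<infinity>" by blast
  qed
  obtain N :: "'t version_space measure" where pN: "prob_space N" and sN: "sets N = sets (Rpow UNIV)"
    and cN: "\<And>J a. finite J \<Longrightarrow> J \<subseteq> UNIV \<Longrightarrow> (\<integral>\<omega>. exp (\<i> * of_real (\<Sum>j\<in>J. a j * \<omega> j)) \<partial>N) = exp (lk_exponent \<nu> f J b' a)"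
    by (rule poissonian_process_exists[OF lff, of b']) (rule that, assumption+)
  interpret N: prob_space N by (rule pN)
  have m\<omega>[measurable]: "(\<lambda>\<omega>. \<omega> k) \<in> borel_measurable N" for k
    by (subst measurable_cong_sets[OF sN refl]) simp
  define Z :: "'t \<Rightarrow> 't version_space \<Rightarrow> real" where "Z t \<omega> = \<omega> (Inl t)" for t \<omega>
  have mZ[measurable]: "Z t \<in> borel_measurable N" for t unfolding Z_def[abs_def] by measurable

  have version: "is_version T M Y N Z"
    unfolding is_version_def
  proof (intro conjI allI impI)
    show "real_process N T Z" using pN by (auto simp: real_process_def)
    fix I assume I: "finite I \<and> I \<noteq> {} \<and> I \<subseteq> T"
    have mI: "(\<lambda>\<omega>. \<lambda>t\<in>I. Z t \<omega>) \<in> measurable N (Rpow I)" by measurable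
    have mIY: "(\<lambda>\<omega>. \<lambda>t\<in>I. Y t \<omega>) \<in> measurable M (Rpow I)"
      using rp I by (intro measurable_restrict) (auto simp: real_process_def)
    show "fdd N Z I = fdd M Y I"
    proof (rule characteristic_function_unique)
      show "prob_space (fdd N Z I)" unfolding fdd_def by (rule N.prob_space_distr[OF mI])
      show "prob_space (fdd M Y I)" unfolding fdd_def
        using rp by (intro prob_space.prob_space_distr[OF _ mIY]) (simp add: real_process_def)
      fix a
      have sumI: "(\<Sum>k\<in>Inl ` I. case_sum a (\<lambda>_. 0) k * y k) = (\<Sum>t\<in>I. a t * y (Inl t))" for y :: "'t + 't set \<Rightarrow> real"
        by (subst sum.reindex) auto
      have fI: "(\<Sum>t\<in>I. a t * g (f (Inl t) x)) = (\<Sum>t\<in>I. a t * g (x t))" for x and g :: "real \<Rightarrow> real"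
        using I by (intro sum.cong) (auto simp: f_def)
      have "joint_char I (fdd N Z I) a = (\<integral>\<omega>. exp (\<i> * of_real (\<Sum>k\<in>Inl ` I. case_sum a (\<lambda>_. 0) k * \<omega> k)) \<partial>N)"
        unfolding fdd_def by (subst joint_char_distr[OF mI]) (simp only: sumI Z_def)
      also have "\<dots> = exp (lk_exponent \<nu> f (Inl ` I) b' (case_sum a (\<lambda>_. 0)))"
        using I by (intro cN) auto
      also have "lk_exponent \<nu> f (Inl ` I) b' (case_sum a (\<lambda>_. 0)) = levy_exponent I \<nu> b a"
      proof -
        have "lk_integrand f (Inl ` I) (case_sum a (\<lambda>_. 0)) x = lk_integrand (\<lambda>t x. x t) I a x" for x
          unfolding lk_integrand_def mult.assoc sumI fI[of "\<lambda>y. y"] fI[of "\<lambda>y. y * indicat_real {-1..1} y"] ..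
        then have "lk_integrand f (Inl ` I) (case_sum a (\<lambda>_. 0)) = lk_integrand (\<lambda>t x. x t) I a" ..
        then show ?thesis
          unfolding levy_exponent_eq_lk_exponent lk_exponent_def sumI by (simp add: b'_def)
      qed
      also have "exp (levy_exponent I \<nu> b a) = joint_char I (fdd M Y I) a"
        unfolding fdd_def joint_char_distr[OF mIY] using b I by simp
      finally show "joint_char I (fdd N Z I) a = joint_char I (fdd M Y I) a" .
    qed (use I in \<open>auto simp: fdd_def\<close>)
  qed

  have "splits_off_independent_summand N T Z"
    unfolding splits_off_independent_summand_def
  proof (intro allI impI)
    fix T0 assume T0: "T0 \<noteq> {} \<and> countable T0 \<and> T0 \<subseteq> T"
    define t1 where "t1 = pick T0"
    have t1: "t1 \<in> T" "t1 \<notin> T0" "emeasure \<nu> {x \<in> vanishing_on T T0. x t1 \<noteq> 0} \<noteq> 0"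
      using pick[of T0] T0 by (auto simp: t1_def)
    define \<xi> :: "'t version_space \<Rightarrow> real" where "\<xi> \<omega> = \<omega> (Inr T0)" for \<omega>
    define \<eta> :: "'t version_space \<Rightarrow> real" where "\<eta> \<omega> = \<omega> (Inl t1) - \<omega> (Inr T0)" for \<omega>
    have m\<xi>[measurable]: "\<xi> \<in> borel_measurable N" unfolding \<xi>_def[abs_def] by measurable
    have m\<eta>[measurable]: "\<eta> \<in> borel_measurable N" unfolding \<eta>_def[abs_def] by measurable
    let ?X = "adjoin2 Z \<xi> \<eta>" and ?K = "T0 <+> {True, False}"
    have mX[measurable]: "?X j \<in> borel_measurable N" for j
      by (cases j) (auto simp: adjoin2_def split: bool.split)
    \<comment> \<open>The jumps of \<open>Z t\<close>, \<open>\<xi>\<close> and \<open>\<eta>\<close>; those of \<open>\<xi>\<close> and \<open>\<eta>\<close> add up to those of \<open>Z t1\<close> and have disjoint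
      supports, so that truncation respects the sum as well.\<close>
    define h :: "'t + bool \<Rightarrow> ('t \<Rightarrow> real) \<Rightarrow> real" where
      "h = case_sum (\<lambda>t x. x t) (\<lambda>c x. if c then f (Inr T0) x else x t1 * indicator (vanishing_on T T0) x)"
    define bb :: "'t + bool \<Rightarrow> real" where "bb = case_sum b (\<lambda>c. if c then 0 else b t1)"
    have fT0: "f (Inr T0) x = x t1 * indicator (- vanishing_on T T0) x" for x
      using T0 by (simp add: f_def t1_def)
    have lfh: "levy_family \<nu> h ?K"
      unfolding levy_family_def
    proof
      fix j assume "j \<in> ?K"
      then consider t where "j = Inl t" "t \<in> T" | "j = Inr True" | "j = Inr False" using T0 by auto
      then show "h j \<in> borel_measurable \<nu> \<and> (\<integral>\<^sup>+x. ennreal (min (\<bar>h j x\<bar>\<^sup>2) 1) \<partial>\<nu>) < \<infinity>"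
      proof cases
        case 1 then show ?thesis using lf by (simp add: h_def levy_family_def)
      next
        case 2 then show ?thesis using lff by (simp add: h_def levy_family_def)
      next
        case 3
        have [measurable]: "vanishing_on T T0 \<in> sets \<nu>" "t1 \<in> T" using T0 mvan t1 by auto
        have e: "h j = (\<lambda>x. x t1 * indicator (vanishing_on T T0) x)" using 3 by (simp add: h_def)
        have "h j \<in> borel_measurable \<nu>" unfolding e by measurable
        moreover have "(\<integral>\<^sup>+x. ennreal (min (\<bar>h j x\<bar>\<^sup>2) 1) \<partial>\<nu>) \<le> (\<integral>\<^sup>+x. ennreal (min (\<bar>x t1\<bar>\<^sup>2) 1) \<partial>\<nu>)"
          unfolding e by (intro nn_integral_mono ennreal_leI min.mono power_mono) (auto simp: indicator_def)
        moreover have "\<dots> < \<infinity>" using L t1(1) by (simp add: levy_measure_def)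
        ultimately show ?thesis by (simp add: order_le_less_trans)
      qed
    qed

    have cf: "(\<integral>\<omega>. exp (\<i> * of_real (\<Sum>j\<in>I. a j * ?X j \<omega>)) \<partial>N) = exp (lk_exponent \<nu> h I bb a)"
      if I: "finite I" "I \<subseteq> ?K" for I :: "('t + bool) set" and a :: "'t + bool \<Rightarrow> real"
    proof -
      \<comment> \<open>Frequencies are extended by 0 to a set that contains both \<open>Inr True\<close> and \<open>Inr False\<close>. There the
        linear form in \<open>Z\<close>, \<open>\<xi>\<close>, \<open>\<eta>\<close> is one in the coordinates \<open>Inl t\<close>, \<open>Inl t1\<close> and \<open>Inr T0\<close>, because
        \<open>\<eta> = Z t1 - \<xi>\<close>; the same identity holds for jumps, truncated jumps and drifts.\<close>
      let ?I = "Inl -` I" and ?aI = "\<lambda>j. if j \<in> I then a j else 0"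
      have fI: "finite ?I" "?I \<subseteq> T0" using I by (auto intro!: finite_vimageI)
      let ?J = "?I <+> {True, False} :: ('t + bool) set"
      have J: "finite ?J" "I \<subseteq> ?J" using fI I by auto
      let ?H = "insert (Inr T0) (insert (Inl t1) (Inl ` ?I))"
      let ?a = "case_sum (\<lambda>t. if t = t1 then ?aI (Inr False) else ?aI (Inl t)) (\<lambda>_. ?aI (Inr True) - ?aI (Inr False))
        :: 't + 't set \<Rightarrow> real"
      have lin: "(\<Sum>k\<in>?H. ?a k * p k) = (\<Sum>j\<in>?J. ?aI j * p' j)"
        if p: "\<And>t. t \<in> ?I \<Longrightarrow> p' (Inl t) = p (Inl t)" "p' (Inr True) = p (Inr T0)" "p' (Inr False) = p (Inl t1) - p (Inr T0)"
        for p :: "'t + 't set \<Rightarrow> real" and p' :: "'t + bool \<Rightarrow> real"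
      proof -
        have t1I: "t1 \<notin> ?I" using fI t1 by blast
        have "(\<Sum>k\<in>Inl ` ?I. ?a k * p k) = (\<Sum>t\<in>?I. ?a (Inl t) * p (Inl t))" by (subst sum.reindex) auto
        also have "\<dots> = (\<Sum>t\<in>?I. ?aI (Inl t) * p' (Inl t))"
          using t1I by (intro sum.cong) (auto simp: p(1))
        finally have 1: "(\<Sum>k\<in>Inl ` ?I. ?a k * p k) = (\<Sum>t\<in>?I. ?aI (Inl t) * p' (Inl t))" .
        have sumH: "sum g ?H = g (Inr T0) + (g (Inl t1) + sum g (Inl ` ?I))" for g :: "'t + 't set \<Rightarrow> real"
        proof -
          have "Inr T0 \<notin> insert (Inl t1) (Inl ` ?I)" "(Inl t1 :: 't + 't set) \<notin> Inl ` ?I" using t1I by auto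
          then show ?thesis using fI by simp
        qed
        have sumJ: "sum g ?J = (\<Sum>t\<in>?I. g (Inl t)) + (g (Inr True) + g (Inr False))" for g :: "'t + bool \<Rightarrow> real"
          using fI by (subst sum.Plus) auto
        have "(\<Sum>k\<in>?H. ?a k * p k) = ?a (Inr T0) * p (Inr T0) + (?a (Inl t1) * p (Inl t1) + (\<Sum>k\<in>Inl ` ?I. ?a k * p k))"
          by (rule sumH)
        also have "\<dots> = (\<Sum>t\<in>?I. ?aI (Inl t) * p' (Inl t)) + (?aI (Inr True) * p' (Inr True) + ?aI (Inr False) * p' (Inr False))"
          unfolding 1 p(2,3) by (simp add: algebra_simps)
        also have "\<dots> = (\<Sum>j\<in>?J. ?aI j * p' j)"
          by (rule sumJ[symmetric])
        finally show ?thesis .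
      qed
      have shrink: "(\<Sum>j\<in>?J. ?aI j * p j) = (\<Sum>j\<in>I. a j * p j)" for p :: "'t + bool \<Rightarrow> real"
      proof -
        have "(\<Sum>j\<in>?J. ?aI j * p j) = (\<Sum>j\<in>I. ?aI j * p j)" by (rule sum_zero_extend[OF J]) auto
        then show ?thesis by (simp cong: sum.cong)
      qed
      have "(\<Sum>k\<in>?H. ?a k * \<omega> k) = (\<Sum>j\<in>I. a j * ?X j \<omega>)" for \<omega>
        unfolding shrink[symmetric] by (rule lin) (simp_all add: adjoin2_def Z_def \<xi>_def \<eta>_def)
      then have "(\<integral>\<omega>. exp (\<i> * of_real (\<Sum>j\<in>I. a j * ?X j \<omega>)) \<partial>N) = exp (lk_exponent \<nu> f ?H b' ?a)"
        using cN[of ?H ?a] fI by simp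
      also have "lk_exponent \<nu> f ?H b' ?a = lk_exponent \<nu> h I bb a"
      proof -
        have "lk_integrand f ?H ?a x = lk_integrand h I a x" if x: "x \<in> space \<nu>" for x
        proof -
          have fh: "h (Inl t) x = f (Inl t) x" if "t \<in> ?I" for t using that fI T0 by (auto simp: h_def f_def)
          have "(\<Sum>k\<in>?H. ?a k * f k x) = (\<Sum>j\<in>I. a j * h j x)"
            unfolding shrink[symmetric] using fh t1(1)
            by (intro lin) (auto simp: h_def fT0 f_def[of "Inl t1"] indicator_def)
          moreover have "(\<Sum>k\<in>?H. ?a k * (f k x * indicat_real {-1..1} (f k x))) = (\<Sum>j\<in>I. a j * (h j x * indicat_real {-1..1} (h j x)))"
            unfolding shrink[symmetric] using fh t1(1)
            by (intro lin) (auto simp: h_def fT0 f_def[of "Inl t1"] indicator_def)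
          ultimately show ?thesis unfolding lk_integrand_def mult.assoc by (simp only:)
        qed
        then have "(\<integral>x. lk_integrand f ?H ?a x \<partial>\<nu>) = (\<integral>x. lk_integrand h I a x \<partial>\<nu>)"
          by (intro Bochner_Integration.integral_cong refl)
        moreover have "(\<Sum>k\<in>?H. ?a k * b' k) = (\<Sum>j\<in>I. a j * bb j)"
          unfolding shrink[symmetric] by (rule lin) (simp_all add: b'_def bb_def)
        ultimately show ?thesis unfolding lk_exponent_def by (simp only:)
      qed
      finally show ?thesis .
    qed

    have K_False: "{Inr False} \<subseteq> ?K" by (auto intro!: InrI)
    have pid: "poissonian_id N ?K ?X"
    proof (rule poissonian_id_of_exponents[OF _ lfh])
      show "real_process N ?K ?X" using pN by (auto simp: real_process_def)
    qed (rule cf)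

    have nd: "nondegenerate N \<eta>"
      unfolding nondegenerate_def
    proof
      assume "\<exists>c. AE \<omega> in N. \<eta> \<omega> = c"
      then obtain k where k: "AE \<omega> in N. \<eta> \<omega> = k" ..
      have lfF: "levy_family \<nu> h {Inr False}" by (rule levy_family_subset[OF lfh K_False])
      have i: "integrable \<nu> (\<lambda>x. 1 - cos (c * h (Inr False) x))" for c
        using integrable_one_minus_cos[OF _ lfF, of "\<lambda>_. c"] by simp
      have "(\<integral>x. 1 - cos (c * h (Inr False) x) \<partial>\<nu>) = 0" for c
      proof -
        have "(\<integral>\<omega>. iexp (c * \<eta> \<omega>) \<partial>N) = (\<integral>\<omega>. iexp (c * k) \<partial>N)"
          using k by (intro integral_cong_AE) auto
        then have "cmod (\<integral>\<omega>. iexp (c * \<eta> \<omega>) \<partial>N) = 1" by (simp add: N.prob_space)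
        moreover have "(\<integral>\<omega>. iexp (c * \<eta> \<omega>) \<partial>N) = exp (lk_exponent \<nu> h {Inr False} bb (\<lambda>_. c))"
          using cf[OF _ K_False, of "\<lambda>_. c"] by (simp add: adjoin2_def)
        ultimately show ?thesis
          using norm_exp_lk_exponent[OF _ lfF, of bb "\<lambda>_. c"] by simp
      qed
      then have "AE x in \<nu>. h (Inr False) x = 0"
        using i levy_familyD(1)[OF lfF] by (intro AE_zero_if_cos_integrals_vanish) auto
      then have "AE x in \<nu>. x \<notin> {x \<in> vanishing_on T T0. x t1 \<noteq> 0}"
        by eventually_elim (auto simp: h_def)
      moreover have "{x \<in> vanishing_on T T0. x t1 \<noteq> 0} \<in> sets \<nu>"
      proof -
        have [measurable]: "vanishing_on T T0 \<in> sets \<nu>" "t1 \<in> T" using T0 mvan t1 by auto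
        have "{x \<in> vanishing_on T T0. x t1 \<noteq> 0} = vanishing_on T T0 \<inter> {x \<in> space \<nu>. x t1 \<noteq> 0}"
          using sp by (auto simp: vanishing_on_def)
        also have "\<dots> \<in> sets \<nu>" by measurable
        finally show ?thesis .
      qed
      ultimately have "{x \<in> vanishing_on T T0. x t1 \<noteq> 0} \<in> null_sets \<nu>" by (simp only: AE_iff_null_sets)
      then show False using t1(3) by blast
    qed

    have ind: "independent_of N \<eta> borel (\<lambda>\<omega>. \<lambda>j\<in>T0 <+> {True}. ?X j \<omega>) (Rpow (T0 <+> {True}))"
    proof (rule independent_of_if_characters_factorise[OF pN m\<eta>])
      fix I and a :: "'t + bool \<Rightarrow> real" and c assume I: "finite I" "I \<subseteq> T0 <+> {True}"
      have F: "Inr False \<notin> I" using I by auto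
      let ?a = "a(Inr False := c)" and ?I = "insert (Inr False) I"
      have IK: "finite ?I" "?I \<subseteq> ?K" "I \<subseteq> ?K" using I K_False by auto
      have sumI: "(\<Sum>j\<in>I. ?a j * y j) = (\<Sum>j\<in>I. a j * y j)" for y :: "'t + bool \<Rightarrow> real"
        using F by (intro sum.cong) auto
      then have sumF: "(\<Sum>j\<in>?I. ?a j * y j) = c * y (Inr False) + (\<Sum>j\<in>I. a j * y j)" for y :: "'t + bool \<Rightarrow> real"
        using I F by (simp add: sum.insert)
      \<comment> \<open>At every path, either \<open>\<eta>\<close> or the whole family \<open>(Z t, \<xi>)\<close> does not jump, so exponents add.\<close>
      have disjoint: "lk_integrand h ?I ?a x = lk_integrand h {Inr False} (\<lambda>_. c) x + lk_integrand h I a x"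
        if x: "x \<in> space \<nu>" for x
      proof (cases "x \<in> vanishing_on T T0")
        case True
        then have "h j x = 0" if "j \<in> I" for j using that I by (auto simp: h_def fT0 vanishing_on_def)
        then have "(\<Sum>j\<in>I. a j * h j x) = 0" "(\<Sum>j\<in>I. a j * (h j x * indicat_real {-1..1} (h j x))) = 0"
          by (auto intro!: sum.neutral)
        then show ?thesis unfolding lk_integrand_def mult.assoc sumF by simp
      next
        case False
        then have "h (Inr False) x = 0" by (simp add: h_def)
        then show ?thesis unfolding lk_integrand_def mult.assoc sumF by (simp del: of_real_sum)
      qed
      have "(\<integral>x. lk_integrand h ?I ?a x \<partial>\<nu>) = (\<integral>x. lk_integrand h {Inr False} (\<lambda>_. c) x + lk_integrand h I a x \<partial>\<nu>)"
        by (intro Bochner_Integration.integral_cong refl disjoint)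
      also have "\<dots> = (\<integral>x. lk_integrand h {Inr False} (\<lambda>_. c) x \<partial>\<nu>) + (\<integral>x. lk_integrand h I a x \<partial>\<nu>)"
        using I IK by (intro Bochner_Integration.integral_add integrable_lk_integrand levy_family_subset[OF lfh]) auto
      finally have "lk_exponent \<nu> h ?I bb ?a = lk_exponent \<nu> h {Inr False} bb (\<lambda>_. c) + lk_exponent \<nu> h I bb a"
        unfolding lk_exponent_def sumF by (simp add: algebra_simps)
      then have "(\<integral>\<omega>. exp (\<i> * of_real (\<Sum>j\<in>?I. ?a j * ?X j \<omega>)) \<partial>N)
          = exp (lk_exponent \<nu> h {Inr False} bb (\<lambda>_. c)) * exp (lk_exponent \<nu> h I bb a)"
        unfolding cf[OF IK(1,2)] by (simp only: exp_add)
      also have "\<dots> = (\<integral>\<omega>. iexp (c * \<eta> \<omega>) \<partial>N) * (\<integral>\<omega>. exp (\<i> * of_real (\<Sum>j\<in>I. a j * ?X j \<omega>)) \<partial>N)"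
        unfolding cf[OF I(1) IK(3)] using cf[OF _ K_False, of "\<lambda>_. c"] by (simp add: adjoin2_def)
      finally show "(\<integral>\<omega>. exp (\<i> * of_real (c * \<eta> \<omega> + (\<Sum>j\<in>I. a j * ?X j \<omega>))) \<partial>N)
        = (\<integral>\<omega>. iexp (c * \<eta> \<omega>) \<partial>N) * (\<integral>\<omega>. exp (\<i> * of_real (\<Sum>j\<in>I. a j * ?X j \<omega>)) \<partial>N)"
        unfolding sumF by (simp add: adjoin2_def)
    qed (rule mX)

    have "N.indep_var borel (\<lambda>\<omega>. \<eta> \<omega>) borel (\<lambda>\<omega>. (\<lambda>j\<in>T0 <+> {True}. ?X j \<omega>) (Inr True))"
      by (rule independent_of_imp_indep_var[OF pN ind measurable_ident, unfolded id_def]) (auto intro: measurable_component_singleton)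
    then have "N.indep_var borel \<eta> borel \<xi>" by (simp add: adjoin2_def InrI)
    then have iv: "N.indep_var borel \<xi> borel \<eta>"
      unfolding N.indep_var_eq using indep_set_commute[OF pN] by blast

    show "\<exists>t1\<in>T - T0. \<exists>\<xi> \<eta>.
          prob_space.indep_var N borel \<xi> borel \<eta> \<and>
          (AE \<omega> in N. Z t1 \<omega> = \<xi> \<omega> + \<eta> \<omega>) \<and>
          poissonian_id N (T0 <+> {True, False}) (adjoin2 Z \<xi> \<eta>) \<and>
          nondegenerate N \<eta> \<and>
          independent_of N \<eta> borel
            (\<lambda>\<omega>. \<lambda>j\<in>T0 <+> {True}. adjoin2 Z \<xi> \<eta> j \<omega>) (Rpow (T0 <+> {True}))"
    proof (rule bexI[of _ t1], rule exI[of _ \<xi>], rule exI[of _ \<eta>], intro conjI iv pid nd ind)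
      show "AE \<omega> in N. Z t1 \<omega> = \<xi> \<omega> + \<eta> \<omega>" by (simp add: Z_def \<xi>_def \<eta>_def)
    qed (use t1 in auto)
  qed
  with version show "\<exists>(N :: 't version_space measure) Z. is_version T M Y N Z \<and> splits_off_independent_summand N T Z"
    by blast
qed

theorem theorem2p14:
  fixes T :: "'t set"
    and M :: "'w measure"
    and Y :: "'t \<Rightarrow> 'w \<Rightarrow> real"
    and \<nu> :: "('t \<Rightarrow> real) measure"
  assumes "T \<noteq> {}"
    and "poissonian_id M T Y"
    and "has_levy_measure M T Y \<nu>"
  shows "(\<not> sigma_finite_measure \<nu> \<longleftrightarrow>
            uncountable T \<and>
            (\<exists>(N :: 't version_space measure) Z.
               is_version T M Y N Z \<and> splits_off_independent_summand N T Z)) \<and>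
         (\<forall>(N :: 'v measure) Z.
            uncountable T \<and> is_version T M Y N Z \<and> splits_off_independent_summand N T Z \<longrightarrow>
              \<not> sigma_finite_measure \<nu>)"
proof -
  have rp: "real_process M T Y" using assms(2) by (simp add: poissonian_id_def)
  note forward = not_sigma_finite_imp_splitting_version[OF rp assms(3)]
  note backward = splitting_imp_not_sigma_finite[OF assms(1) rp assms(3)]
  show ?thesis
  proof (intro conjI iffI allI impI)
    assume "uncountable T \<and> (\<exists>(N :: 't version_space measure) Z.
       is_version T M Y N Z \<and> splits_off_independent_summand N T Z)"
    then show "\<not> sigma_finite_measure \<nu>" by (elim conjE exE) (rule backward)
  next
    fix N :: "'v measure" and Z
    assume "uncountable T \<and> is_version T M Y N Z \<and> splits_off_independent_summand N T Z"
    then show "\<not> sigma_finite_measure \<nu>" by (elim conjE) (rule backward)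
  qed (erule forward)+
qed

end
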